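(* Let $\Omega\subset X$ be a nonempty open set, let $u\in \mathrm{BV}(\Omega)$ and let $1\le q<\infty$. Then there exists $v\in N^{1,1}(\Omega)$ such that \[ \frac{1}{\mu(B(x,r)\cap\Omega)}\int_{B(x,r)\cap \Omega}|v-u|^{q}\,d\mu\to 0\quad \text{as } r\to 0^+ \] uniformly for all $x\in\partial\Omega$.
   Context: Standing assumptions: $(X,d,\mu)$ is a complete metric space with a Borel regular outer measure $\mu$ that is doubling: there is $C_d\ge 1$ with $0<\mu(B(x,2r))\le C_d\,\mu(B(x,r))<\infty$ for all balls $B(x,r)=\{y\in X: d(x,y)<r\}$. $X$ supports a $(1,1)$-Poincaré inequality: there are $C_P>0$, $\lambda\ge 1$ such that for every ball $B(x,r)$, every $u\in L^1_{\mathrm{loc}}(X)$ and every upper gradient $g$ of $u$, $\frac{1}{\mu(B(x,r))}\int_{B(x,r)}|u-u_{B(x,r)}|\,d\mu\le C_P r\,\frac{1}{\mu(B(x,\lambda r))}\int_{B(x,\lambda r)}g\,d\mu$, where $u_B$ is the $\mu$-mean of $u$ over $B$. Functions take values in $[-\infty,\infty]$. A curve is a rectifiable continuous map from a compact interval. A nonnegative Borel function $g$ is an upper gradient of $u$ if $|u(x)-u(y)|\le\int_\gamma g\,ds$ for all nonconstant curves $\gamma$ with end points $x,y$ (with $|u(x)-u(y)|:=\infty$ if $|u(x)|$ or $|u(y)|$ is infinite). A curve family $\Gamma$ has zero $1$-modulus if there is a nonnegative Borel $\rho\in L^1(X)$ with $\int_\gamma\rho\,ds=\infty$ for all $\gamma\in\Gamma$.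 A nonnegative $\mu$-measurable $g$ is a $1$-weak upper gradient of $u$ in $H\subset X$ if the upper gradient inequality holds for all curves in $H$ outside a family of zero $1$-modulus. $\|u\|_{N^{1,1}(H)}:=\|u\|_{L^1(H)}+\inf\|g\|_{L^1(H)}$ (infimum over $1$-weak upper gradients $g$ of $u$ in $H$), and $N^{1,1}(H)=\{u:\|u\|_{N^{1,1}(H)}<\infty\}$. The minimal $1$-weak upper gradient of $u$ is denoted $g_u$. $\Omega'\Subset\Omega$ means $\overline{\Omega'}$ is a compact subset of $\Omega$. Local spaces ($L^1_{\mathrm{loc}}(\Omega)$, $N^{1,1}_{\mathrm{loc}}(\Omega)$) consist of functions belonging to the corresponding space on every open $\Omega'\Subset\Omega$. For $u\in L^1_{\mathrm{loc}}(\Omega)$, $\|Du\|(\Omega):=\inf\{\liminf_{i\to\infty}\int_\Omega g_{u_i}\,d\mu:\ u_i\in N^{1,1}_{\mathrm{loc}}(\Omega),\ u_i\to u \text{ in } L^1_{\mathrm{loc}}(\Omega)\}$, with $g_{u_i}$ the minimal $1$-weak upper gradient of $u_i$ in $\Omega$. $\mathrm{BV}(\Omega)$ is the set of $u\in L^1(\Omega)$ with $\|Du\|(\Omega)<\infty$. *)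

theory Defs
  imports "HOL-Analysis.Analysis"
begin

section \<open>Borel regular outer measures\<close>

definition borel_regular_outer_measure :: "('a::topological_space set \<Rightarrow> ennreal) \<Rightarrow> bool" where
  "borel_regular_outer_measure \<mu> \<longleftrightarrow>
     outer_measure_space (Pow UNIV) \<mu> \<and>
     sets borel \<subseteq> lambda_system UNIV (Pow UNIV) \<mu> \<and>
     (\<forall>A. \<exists>B \<in> sets borel. A \<subseteq> B \<and> \<mu> B = \<mu> A)"

definition caratheodory_measure :: "('a set \<Rightarrow> ennreal) \<Rightarrow> 'a measure" where
  "caratheodory_measure \<mu> = measure_of UNIV (lambda_system UNIV (Pow UNIV) \<mu>) \<mu>"

lemma
  assumes "outer_measure_space (Pow UNIV) \<mu>"
  shows sets_caratheodory_measure: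
      "sets (caratheodory_measure \<mu>) = lambda_system UNIV (Pow UNIV) \<mu>"
    and emeasure_caratheodory_measure:
      "A \<in> lambda_system UNIV (Pow UNIV) \<mu> \<Longrightarrow> emeasure (caratheodory_measure \<mu>) A = \<mu> A"
proof -
  interpret sigma_algebra UNIV "Pow UNIV" by (rule sigma_algebra_Pow)
  have ms: "measure_space UNIV (lambda_system UNIV (Pow UNIV) \<mu>) \<mu>"
    using caratheodory_lemma[OF assms] .
  then have sa: "sigma_algebra UNIV (lambda_system UNIV (Pow UNIV) \<mu>)"
    by (simp add: measure_space_def)
  show "sets (caratheodory_measure \<mu>) = lambda_system UNIV (Pow UNIV) \<mu>"
    unfolding caratheodory_measure_def by (rule sigma_algebra.sets_measure_of_eq[OF sa])
  show "emeasure (caratheodory_measure \<mu>) A = \<mu> A"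
    if "A \<in> lambda_system UNIV (Pow UNIV) \<mu>"
    using emeasure_measure_of_sigma[OF sa _ _ that, of \<mu>] ms
    by (simp add: caratheodory_measure_def measure_space_def)
qed

lemma space_caratheodory_measure [simp]: "space (caratheodory_measure \<mu>) = UNIV"
  by (simp add: caratheodory_measure_def space_measure_of_conv)

definition doubling_measure :: "'a::metric_space measure \<Rightarrow> bool" where
  "doubling_measure M \<longleftrightarrow>
     (\<exists>C::real. C \<ge> 1 \<and> (\<forall>x. \<forall>r>0.
        0 < emeasure M (ball x (2 * r)) \<and>
        emeasure M (ball x (2 * r)) \<le> ennreal C * emeasure M (ball x r) \<and>
        ennreal C * emeasure M (ball x r) < \<infinity>))"


section \<open>Curves, line integrals and upper gradients\<close>

definition path_length_on :: "(real \<Rightarrow> 'a::metric_space) \<Rightarrow> real \<Rightarrow> real \<Rightarrow> ennreal" where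
  "path_length_on \<gamma> a b =
     (SUP ts \<in> {ts. sorted ts \<and> set ts \<subseteq> {a..b}}.
        \<Sum>i<length ts - 1. ennreal (dist (\<gamma> (ts ! i)) (\<gamma> (ts ! Suc i))))"

text \<open>
  Curves are parametrised over \<open>{0..1}\<close>, as the library's paths are. All notions below are
  invariant under affine reparametrisation, so this covers arbitrary compact intervals.
\<close>

definition curve :: "(real \<Rightarrow> 'a::metric_space) \<Rightarrow> bool" where
  "curve \<gamma> \<longleftrightarrow> path \<gamma> \<and> path_length_on \<gamma> 0 1 < \<infinity>"

definition nonconstant_curve :: "(real \<Rightarrow> 'a::metric_space) \<Rightarrow> bool" where
  "nonconstant_curve \<gamma> \<longleftrightarrow> curve \<gamma> \<and> \<not> \<gamma> constant_on {0..1}"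

text \<open>
  For a curve, the length of the initial piece is a continuous function of its end parameter, and
  \<open>\<gamma>\<close> is constant wherever this function is; so the value below exists for
  \<open>0 \<le> s \<le> path_length_on \<gamma> 0 1\<close> and does not depend on the choice of \<open>t\<close>.
\<close>

definition arc_length_param :: "(real \<Rightarrow> 'a::metric_space) \<Rightarrow> real \<Rightarrow> 'a" where
  "arc_length_param \<gamma> s = \<gamma> (SOME t. t \<in> {0..1} \<and> path_length_on \<gamma> 0 t = ennreal s)"

text \<open>
  For a Borel function \<open>g\<close> the integrand is Borel on the interval of integration. For a \<open>g\<close> that is
  measurable only for the completed measure of the space, the integrand is Lebesgue measurable for
  all curves outside a family of zero modulus; on the exceptional curves this is the lower integral.
\<close>

definition line_integral :: "(real \<Rightarrow> 'a::metric_space) \<Rightarrow> ('a \<Rightarrow> ennreal) \<Rightarrow> ennreal" where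
  "line_integral \<gamma> g =
     (\<integral>\<^sup>+ s \<in> {0..enn2real (path_length_on \<gamma> 0 1)}. g (arc_length_param \<gamma> s) \<partial>lebesgue)"

definition ereal_distance :: "ereal \<Rightarrow> ereal \<Rightarrow> ennreal" where
  "ereal_distance a b = (if \<bar>a\<bar> = \<infinity> \<or> \<bar>b\<bar> = \<infinity> then \<infinity> else e2ennreal \<bar>a - b\<bar>)"

definition upper_gradient_inequality ::
    "('a::metric_space \<Rightarrow> ereal) \<Rightarrow> ('a \<Rightarrow> ennreal) \<Rightarrow> (real \<Rightarrow> 'a) \<Rightarrow> bool" where
  "upper_gradient_inequality u g \<gamma> \<longleftrightarrow>
     ereal_distance (u (pathstart \<gamma>)) (u (pathfinish \<gamma>)) \<le> line_integral \<gamma> g"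

definition upper_gradient :: "('a::metric_space \<Rightarrow> ereal) \<Rightarrow> ('a \<Rightarrow> ennreal) \<Rightarrow> bool" where
  "upper_gradient u g \<longleftrightarrow>
     g \<in> borel_measurable borel \<and>
     (\<forall>\<gamma>. nonconstant_curve \<gamma> \<longrightarrow> upper_gradient_inequality u g \<gamma>)"

definition zero_modulus :: "'a::metric_space measure \<Rightarrow> (real \<Rightarrow> 'a) set \<Rightarrow> bool" where
  "zero_modulus M \<Gamma> \<longleftrightarrow>
     (\<forall>\<gamma>\<in>\<Gamma>. curve \<gamma>) \<and>
     (\<exists>\<rho> \<in> borel_measurable borel. (\<integral>\<^sup>+ x. \<rho> x \<partial>M) < \<infinity> \<and> (\<forall>\<gamma>\<in>\<Gamma>. line_integral \<gamma> \<rho> = \<infinity>))"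

definition weak_upper_gradient ::
    "'a::metric_space measure \<Rightarrow> 'a set \<Rightarrow> ('a \<Rightarrow> ereal) \<Rightarrow> ('a \<Rightarrow> ennreal) \<Rightarrow> bool" where
  "weak_upper_gradient M H u g \<longleftrightarrow>
     g \<in> borel_measurable (restrict_space M H) \<and>
     (\<exists>\<Gamma>. zero_modulus M \<Gamma> \<and>
        (\<forall>\<gamma>. nonconstant_curve \<gamma> \<and> path_image \<gamma> \<subseteq> H \<and> \<gamma> \<notin> \<Gamma> \<longrightarrow>
           upper_gradient_inequality u g \<gamma>))"


section \<open>Function spaces\<close>

text \<open>
  Functions on a set \<open>H\<close> are represented by total functions whose values outside \<open>H\<close> are irrelevant.
\<close>

definition L1_norm :: "'a measure \<Rightarrow> 'a set \<Rightarrow> ('a \<Rightarrow> ereal) \<Rightarrow> ennreal" where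
  "L1_norm M H u = (\<integral>\<^sup>+ x \<in> H. e2ennreal \<bar>u x\<bar> \<partial>M)"

definition L1 :: "'a measure \<Rightarrow> 'a set \<Rightarrow> ('a \<Rightarrow> ereal) set" where
  "L1 M H = {u \<in> borel_measurable (restrict_space M H). L1_norm M H u < \<infinity>}"

definition N11_norm :: "'a::metric_space measure \<Rightarrow> 'a set \<Rightarrow> ('a \<Rightarrow> ereal) \<Rightarrow> ennreal" where
  "N11_norm M H u =
     L1_norm M H u + (INF g \<in> {g. weak_upper_gradient M H u g}. \<integral>\<^sup>+ x \<in> H. g x \<partial>M)"

definition N11 :: "'a::metric_space measure \<Rightarrow> 'a set \<Rightarrow> ('a \<Rightarrow> ereal) set" where
  "N11 M H = {u \<in> borel_measurable (restrict_space M H). N11_norm M H u < \<infinity>}"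

definition compactly_inside :: "'a::topological_space set \<Rightarrow> 'a set \<Rightarrow> bool" (infix "\<Subset>" 50) where
  "\<Omega>' \<Subset> \<Omega> \<longleftrightarrow> compact (closure \<Omega>') \<and> closure \<Omega>' \<subseteq> \<Omega>"

definition L1_loc :: "'a::metric_space measure \<Rightarrow> 'a set \<Rightarrow> ('a \<Rightarrow> ereal) set" where
  "L1_loc M \<Omega> = {u. \<forall>\<Omega>'. open \<Omega>' \<and> \<Omega>' \<Subset> \<Omega> \<longrightarrow> u \<in> L1 M \<Omega>'}"

definition N11_loc :: "'a::metric_space measure \<Rightarrow> 'a set \<Rightarrow> ('a \<Rightarrow> ereal) set" where
  "N11_loc M \<Omega> = {u. \<forall>\<Omega>'. open \<Omega>' \<and> \<Omega>' \<Subset> \<Omega> \<longrightarrow> u \<in> N11 M \<Omega>'}"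

definition tendsto_L1_loc ::
    "'a::metric_space measure \<Rightarrow> 'a set \<Rightarrow> (nat \<Rightarrow> 'a \<Rightarrow> ereal) \<Rightarrow> ('a \<Rightarrow> ereal) \<Rightarrow> bool" where
  "tendsto_L1_loc M \<Omega> w u \<longleftrightarrow>
     (\<forall>\<Omega>'. open \<Omega>' \<and> \<Omega>' \<Subset> \<Omega> \<longrightarrow> (\<lambda>i. L1_norm M \<Omega>' (\<lambda>x. w i x - u x)) \<longlonglongrightarrow> 0)"

definition minimal_weak_upper_gradient ::
    "'a::metric_space measure \<Rightarrow> 'a set \<Rightarrow> ('a \<Rightarrow> ereal) \<Rightarrow> ('a \<Rightarrow> ennreal) \<Rightarrow> bool" where
  "minimal_weak_upper_gradient M \<Omega> u g \<longleftrightarrow>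
     weak_upper_gradient M \<Omega> u g \<and> (\<lambda>x. enn2ereal (g x)) \<in> L1_loc M \<Omega> \<and>
     (\<forall>g'. weak_upper_gradient M \<Omega> u g' \<and> (\<lambda>x. enn2ereal (g' x)) \<in> L1_loc M \<Omega> \<longrightarrow>
        (AE x in M. x \<in> \<Omega> \<longrightarrow> g x \<le> g' x))"

text \<open>
  Minimal weak upper gradients are unique only almost everywhere, so they enter the total variation
  through the relation above; the integrals do not depend on the representative.
\<close>

definition total_variation :: "'a::metric_space measure \<Rightarrow> 'a set \<Rightarrow> ('a \<Rightarrow> ereal) \<Rightarrow> ennreal" where
  "total_variation M \<Omega> u =
     Inf {liminf (\<lambda>i. \<integral>\<^sup>+ x \<in> \<Omega>. g i x \<partial>M) | w g.
            (\<forall>i. w i \<in> N11_loc M \<Omega> \<and> minimal_weak_upper_gradient M \<Omega> (w i) (g i)) \<and>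
            tendsto_L1_loc M \<Omega> w u}"

definition BV :: "'a::metric_space measure \<Rightarrow> 'a set \<Rightarrow> ('a \<Rightarrow> ereal) set" where
  "BV M \<Omega> = {u \<in> L1 M \<Omega>. total_variation M \<Omega> u < \<infinity>}"


section \<open>Poincare inequality\<close>

text \<open>
  Locally integrable functions are finite almost everywhere on balls, so passing to real values does
  not change the mean.
\<close>

definition mean_value :: "'a measure \<Rightarrow> 'a set \<Rightarrow> ('a \<Rightarrow> ereal) \<Rightarrow> real" where
  "mean_value M B u = (LINT x:B|M. real_of_ereal (u x)) / measure M B"

definition poincare_1_1 :: "'a::metric_space measure \<Rightarrow> bool" where
  "poincare_1_1 M \<longleftrightarrow>
     (\<exists>C \<Lambda>::real. C > 0 \<and> \<Lambda> \<ge> 1 \<and>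
        (\<forall>x. \<forall>r>0. \<forall>u \<in> L1_loc M UNIV. \<forall>g. upper_gradient u g \<longrightarrow>
           L1_norm M (ball x r) (\<lambda>y. u y - ereal (mean_value M (ball x r) u)) / emeasure M (ball x r)
           \<le> ennreal (C * r) *
             ((\<integral>\<^sup>+ y \<in> ball x (\<Lambda> * r). g y \<partial>M) / emeasure M (ball x (\<Lambda> * r)))))"


section \<open>Powers of extended nonnegative reals\<close>

definition ennreal_powr :: "ennreal \<Rightarrow> real \<Rightarrow> ennreal" where
  "ennreal_powr a q = (if a = \<infinity> then \<infinity> else ennreal (enn2real a powr q))"

end

theory Submission
  imports Defs
begin

text \<open>
  Adding a small multiple of the function that is non-integrable along the exceptional curves turns a
  weak upper gradient into an upper gradient along every curve. Take approximations \<open>w i\<close> of \<open>u\<close> as in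
  the definition of the total variation, a Whitney type decomposition of \<open>\<Omega>\<close> into layers \<open>U j\<close> with a
  Lipschitz partition of unity \<open>\<phi> j\<close>, and cut every function into its slices of height one between
  the levels \<open>k\<close> and \<open>k + 1\<close> (of the absolute value). For each layer and each slice choose a separate
  index \<open>i\<close> for which the slice of \<open>w i\<close> is extremely close to that of \<open>u\<close> in \<open>L\<^sup>1(U j)\<close>, and whose
  energy on \<open>U j\<close> is almost the limit inferior. The glued function, the sum over \<open>j\<close> and \<open>k\<close> of \<open>\<phi> j\<close>
  times the chosen slice, has finite energy because the limit inferior is superadditive, the layers
  overlap boundedly, and the upper gradients of the slices live on disjoint sets. As slices are
  bounded, closeness in \<open>L\<^sup>1\<close> gives closeness in \<open>L\<^sup>q\<close>. Finally, a ball centred at a boundary point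
  that reaches \<open>U j\<close> meets \<open>\<Omega>\<close> in a set whose measure is bounded from below, by compactness, in
  terms of \<open>j\<close>; so the required closeness can be prescribed layer by layer.
\<close>

section \<open>Length and arc length parametrisation of curves\<close>

text \<open>Why the index depends on both layer and slice: passing to the power q costs slice k a
  factor exponential in k (\<open>pigeonhole_powr\<close>), so its tolerance must shrink with k, and
  no single \<open>w i\<close> need meet it for all k. With different indices in play, the energy of
  one \<open>w i\<close> no longer controls the glued function. What survives is the limit inferior
  of each separate energy, and Fatou's lemma for sums bounds the total of these limits. A second
  obstacle: pieces chosen on neighbouring layers are comparable only through u, which has no upper
  gradient and is close to them only in L^1. The Lipschitz bound of a cut-off supplies a factor
  equal to the length of a short arc. Multiplied by this length, a difference at an end point is
  bounded by an integral along the arc, namely a line integral of the error |A - u|. So the error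
  itself, times the Lipschitz constant, enters the upper gradient. Finally, curves see null sets.
  Functions measurable only for the completed measure are therefore replaced by Borel functions that
  dominate them everywhere, not merely by almost everywhere equal ones.\<close>

fun polygon :: "(real \<Rightarrow> 'a::metric_space) \<Rightarrow> real list \<Rightarrow> ennreal" where
  "polygon \<gamma> (x # y # zs) = ennreal (dist (\<gamma> x) (\<gamma> y)) + polygon \<gamma> (y # zs)"
| "polygon \<gamma> _ = 0"

text \<open>The recursive form suits splitting and refining a list at a vertex; the indexed form is
  the one in \<open>path_length_on\<close>.\<close>

lemma polygon_eq_sum:
  "polygon \<gamma> ts = (\<Sum>i<length ts - 1. ennreal (dist (\<gamma> (ts ! i)) (\<gamma> (ts ! Suc i))))"
proof (induction \<gamma> ts rule: polygon.induct)
  case (1 \<gamma> x y zs)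
  then show ?case by (simp add: sum.lessThan_Suc_shift del: sum.lessThan_Suc)
qed auto

lemma path_length_on_eq_SUP:
  "path_length_on \<gamma> a b = (SUP ts \<in> {ts. sorted ts \<and> set ts \<subseteq> {a..b}}. polygon \<gamma> ts)"
  by (simp add: path_length_on_def polygon_eq_sum)

lemma polygon_append: "polygon \<gamma> (xs @ b # ys) = polygon \<gamma> (xs @ [b]) + polygon \<gamma> (b # ys)"
proof (induction xs)
  case (Cons x xs)
  then show ?case by (cases xs) (auto simp: add.assoc)
qed simp

lemma polygon_Cons_le: "polygon \<gamma> ys \<le> polygon \<gamma> (b # ys)"
  by (cases ys) auto

text \<open>The triangle inequality at the inserted vertex; at either end of the list the insertion
  just adds an edge.\<close>

lemma polygon_insert_le: "polygon \<gamma> (xs @ ys) \<le> polygon \<gamma> (xs @ b # ys)"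
proof (induction xs)
  case Nil
  then show ?case by (simp add: polygon_Cons_le)
next
  case (Cons x xs)
  show ?case
  proof (cases xs)
    case Nil
    show ?thesis
    proof (cases ys)
      case (Cons y zs)
      have "ennreal (dist (\<gamma> x) (\<gamma> y)) \<le> ennreal (dist (\<gamma> x) (\<gamma> b)) + ennreal (dist (\<gamma> b) (\<gamma> y))"
        by (simp add: dist_triangle flip: ennreal_plus)
      then show ?thesis
        using Nil Cons by (simp add: add_right_mono flip: add.assoc)
    qed (use Nil in simp)
  next
    case (Cons a list)
    then show ?thesis using Cons.IH by (simp add: add_left_mono)
  qed
qed

lemma polygon_le_path_length:
  "sorted ts \<Longrightarrow> set ts \<subseteq> {a..b} \<Longrightarrow> polygon \<gamma> ts \<le> path_length_on \<gamma> a b"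
  unfolding path_length_on_eq_SUP by (rule SUP_upper) auto

lemma dist_le_path_length: "a \<le> b \<Longrightarrow> ennreal (dist (\<gamma> a) (\<gamma> b)) \<le> path_length_on \<gamma> a b"
  using polygon_le_path_length[of "[a, b]" a b \<gamma>] by simp

lemma path_length_on_refl [simp]: "path_length_on \<gamma> a a = 0"
proof -
  have "polygon \<gamma> ts = 0" if "set ts \<subseteq> {a}" for ts
    using that by (induction \<gamma> ts rule: polygon.induct) auto
  then show ?thesis
    unfolding path_length_on_eq_SUP by (auto intro!: antisym SUP_least)
qed

lemma sorted_filter_split:
  fixes ts :: "'b::linorder list"
  assumes "sorted ts" shows "ts = filter (\<lambda>x. x < b) ts @ filter (\<lambda>x. b \<le> x) ts"
proof (cases "ts = []")
  case False
  show ?thesis using assms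
  proof (induction ts)
    case (Cons a ts)
    show ?case
    proof (cases "a < b")
      case False
      then have "filter (\<lambda>x. x < b) (a # ts) = []" "filter (\<lambda>x. b \<le> x) (a # ts) = a # ts"
        using Cons.prems by (auto simp: filter_empty_conv filter_id_conv)
      then show ?thesis by simp
    qed (use Cons in auto)
  qed simp
qed simp

text \<open>Inserting b as a vertex never decreases a polygonal sum, and a sum with vertex b splits
  there. This gives both inequalities: lists on the two sides are joined at b, and a list on the
  whole interval is cut at b.\<close>

lemma path_length_on_add:
  assumes "a \<le> b" "b \<le> c"
  shows "path_length_on \<gamma> a b + path_length_on \<gamma> b c = path_length_on \<gamma> a c"
proof (rule antisym)
  let ?S = "\<lambda>a b. {ts. sorted ts \<and> set ts \<subseteq> {a..b}}"
  have ne: "?S x y \<noteq> {}" for x y :: real by (auto intro: exI[of _ "[]"])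
  have "path_length_on \<gamma> a b + path_length_on \<gamma> b c =
      (SUP ts\<in>?S a b. SUP ss\<in>?S b c. polygon \<gamma> ts + polygon \<gamma> ss)"
    unfolding path_length_on_eq_SUP[of \<gamma> a b] path_length_on_eq_SUP[of \<gamma> b c]
    by (simp add: ennreal_SUP_add_left[OF ne, symmetric] ennreal_SUP_add_right[OF ne, symmetric])
  also have "\<dots> \<le> path_length_on \<gamma> a c"
  proof (intro SUP_least)
    fix ts ss assume ts: "ts \<in> ?S a b" and ss: "ss \<in> ?S b c"
    have "polygon \<gamma> ts \<le> polygon \<gamma> (ts @ [b])"
      using polygon_insert_le[of \<gamma> ts "[]" b] by simp
    moreover have "polygon \<gamma> ss \<le> polygon \<gamma> (b # ss)" by (rule polygon_Cons_le)
    ultimately have "polygon \<gamma> ts + polygon \<gamma> ss \<le> polygon \<gamma> (ts @ b # ss)"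
      by (subst polygon_append) (rule add_mono)
    also have "\<dots> \<le> path_length_on \<gamma> a c"
      using ts ss assms by (intro polygon_le_path_length) (force simp: sorted_append subset_iff)+
    finally show "polygon \<gamma> ts + polygon \<gamma> ss \<le> path_length_on \<gamma> a c" .
  qed
  finally show "path_length_on \<gamma> a b + path_length_on \<gamma> b c \<le> path_length_on \<gamma> a c" .
  show "path_length_on \<gamma> a c \<le> path_length_on \<gamma> a b + path_length_on \<gamma> b c"
    unfolding path_length_on_eq_SUP[of \<gamma> a c]
  proof (intro SUP_least)
    fix ts assume ts: "ts \<in> ?S a c"
    let ?l = "filter (\<lambda>x. x < b) ts" and ?r = "filter (\<lambda>x. b \<le> x) ts"
    have "polygon \<gamma> ts = polygon \<gamma> (?l @ ?r)"
      using sorted_filter_split[of ts b] ts by simp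
    also have "\<dots> \<le> polygon \<gamma> (?l @ [b]) + polygon \<gamma> (b # ?r)"
      using polygon_insert_le[of \<gamma> ?l ?r b] by (metis polygon_append)
    also have "\<dots> \<le> path_length_on \<gamma> a b + path_length_on \<gamma> b c"
      using ts assms
      by (intro add_mono polygon_le_path_length) (auto simp: sorted_append sorted_wrt_filter)
    finally show "polygon \<gamma> ts \<le> path_length_on \<gamma> a b + path_length_on \<gamma> b c" .
  qed
qed

section \<open>Continuity of the length function\<close>

lemma polygon_le_card:
  assumes "\<And>x y. x \<in> set ts \<Longrightarrow> y \<in> set ts \<Longrightarrow> dist (\<gamma> x) (\<gamma> y) \<le> e"
  shows "polygon \<gamma> ts \<le> of_nat (length ts) * ennreal e"
  using assms
proof (induction \<gamma> ts rule: polygon.induct)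
  case (1 \<gamma> x y zs)
  have "ennreal (dist (\<gamma> x) (\<gamma> y)) \<le> ennreal e" using 1(2) by (intro ennreal_leI) auto
  moreover have "polygon \<gamma> (y # zs) \<le> of_nat (length (y # zs)) * ennreal e"
    using 1 by auto
  ultimately have "ennreal (dist (\<gamma> x) (\<gamma> y)) + polygon \<gamma> (y # zs)
      \<le> ennreal e + of_nat (length (y # zs)) * ennreal e"
    by (rule add_mono)
  then show ?case by (simp add: distrib_right)
qed auto

text \<open>A list whose polygon realises the total length up to e / 2 has a fixed number of
  vertices. By uniform continuity of \<gamma>, its part over a short interval contributes at most e
  / 2, so the two outer pieces already carry all but e of the length. By additivity the short piece
  has length at most e.\<close>

lemma path_length_on_uniformly_small:
  assumes "curve \<gamma>" "e > 0"
  obtains d where "d > 0"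
    "\<And>s t. 0 \<le> s \<Longrightarrow> s \<le> t \<Longrightarrow> t \<le> 1 \<Longrightarrow> t - s < d \<Longrightarrow> path_length_on \<gamma> s t \<le> ennreal e"
proof -
  have fin: "path_length_on \<gamma> 0 1 < \<infinity>" and cont: "continuous_on {0..1} \<gamma>"
    using assms by (auto simp: curve_def path_def)
  have "\<exists>ts. sorted ts \<and> set ts \<subseteq> {0..1} \<and> path_length_on \<gamma> 0 1 \<le> polygon \<gamma> ts + ennreal (e / 2)"
  proof (cases "path_length_on \<gamma> 0 1 = 0")
    case True
    then show ?thesis by (intro exI[of _ "[]"]) auto
  next
    case False
    then have "path_length_on \<gamma> 0 1 - ennreal (e / 2) < path_length_on \<gamma> 0 1"
      using fin assms(2) by (intro ennreal_between) (auto simp: zero_less_iff_neq_zero)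
    then obtain ts where "sorted ts" "set ts \<subseteq> {0..1}"
        "path_length_on \<gamma> 0 1 - ennreal (e / 2) < polygon \<gamma> ts"
      unfolding path_length_on_eq_SUP less_SUP_iff by auto
    then show ?thesis
      by (intro exI[of _ ts]) (auto simp: ennreal_minus_le_iff add.commute dest!: less_imp_le)
  qed
  then obtain ts where ts: "sorted ts" "set ts \<subseteq> {0..1}"
    "path_length_on \<gamma> 0 1 \<le> polygon \<gamma> ts + ennreal (e / 2)" by blast
  \<comment> \<open>The polygon over the short interval runs through its two end points and some
    vertices of \<open>ts\<close>, so it has at most this many vertices.\<close>
  define N where "N = length ts + 2"
  have "uniformly_continuous_on {0..1} \<gamma>" using cont by (simp add: compact_uniformly_continuous)
  moreover have "e / 2 / real N > 0" using assms by (simp add: N_def)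
  ultimately obtain d where d: "d > 0"
    "\<And>x y. x \<in> {0..1} \<Longrightarrow> y \<in> {0..1} \<Longrightarrow> dist y x < d \<Longrightarrow> dist (\<gamma> y) (\<gamma> x) < e / 2 / real N"
    unfolding uniformly_continuous_on_def by metis
  show thesis
  proof (rule that[OF d(1)])
    fix s t :: real assume st: "0 \<le> s" "s \<le> t" "t \<le> 1" "t - s < d"
    let ?L = "path_length_on \<gamma>"
    let ?l = "filter (\<lambda>x. x < s) ts" and ?q = "filter (\<lambda>x. s \<le> x) ts"
    let ?m = "filter (\<lambda>x. x < t) ?q" and ?r = "filter (\<lambda>x. t \<le> x) ?q"
    have q: "?q = ?m @ ?r" using ts(1) by (intro sorted_filter_split) (simp add: sorted_wrt_filter)
    have mid: "polygon \<gamma> (s # ?m @ [t]) \<le> ennreal (e / 2)"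
    proof -
      have "polygon \<gamma> (s # ?m @ [t]) \<le> of_nat (length (s # ?m @ [t])) * ennreal (e / 2 / real N)"
        using st by (intro polygon_le_card less_imp_le d(2)) (auto simp: dist_real_def)
      also have "\<dots> \<le> of_nat N * ennreal (e / 2 / real N)"
        by (intro mult_right_mono of_nat_mono) 
           (auto simp: N_def intro!: order.trans[OF length_filter_le])
      also have "\<dots> = ennreal (e / 2)"
      proof -
        have "of_nat N * ennreal (e / 2 / real N) = ennreal (real N * (e / 2 / real N))"
          using assms by (subst ennreal_mult) (auto simp: ennreal_of_nat_eq_real_of_nat)
        moreover have "real N * (e / 2 / real N) = e / 2"
          using \<open>e / 2 / real N > 0\<close> by (cases "N = 0") auto
        ultimately show ?thesis by metis
      qed
      finally show ?thesis .
    qed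
    \<comment> \<open>Refine by s and t, then split there: the outer parts are bounded by lengths,
      the middle one by \<open>mid\<close>.\<close>
    have "polygon \<gamma> ts = polygon \<gamma> (?l @ ?m @ ?r)"
      using sorted_filter_split[OF ts(1), of s] q by simp
    also have "\<dots> \<le> polygon \<gamma> (?l @ s # ?m @ ?r)" by (rule polygon_insert_le)
    also have "\<dots> \<le> polygon \<gamma> ((?l @ s # ?m) @ t # ?r)"
      using polygon_insert_le[of \<gamma> "?l @ s # ?m" ?r t] by simp
    also have "\<dots> = polygon \<gamma> (?l @ [s]) + polygon \<gamma> (s # ?m @ [t]) + polygon \<gamma> (t # ?r)"
      using polygon_append[of \<gamma> "?l @ s # ?m" t ?r] polygon_append[of \<gamma> ?l s "?m @ [t]"] by simp
    also have "\<dots> \<le> ?L 0 s + ennreal (e / 2) + ?L t 1"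
      using ts st mid
      by (intro add_mono polygon_le_path_length) (auto simp: sorted_append sorted_wrt_filter)
    finally have "polygon \<gamma> ts \<le> ?L 0 s + ennreal (e / 2) + ?L t 1" .
    then have "?L 0 1 \<le> ?L 0 s + ennreal (e / 2) + ?L t 1 + ennreal (e / 2)"
      using ts(3) by (meson add_right_mono order.trans)
    also have "\<dots> = (?L 0 s + ?L t 1) + ennreal e"
      using assms by (simp add: ac_simps flip: ennreal_plus)
    finally have 1: "?L 0 1 \<le> (?L 0 s + ?L t 1) + ennreal e" .
    have "?L 0 1 = (?L 0 s + ?L t 1) + ?L s t"
      using path_length_on_add[of 0 s 1 \<gamma>] path_length_on_add[of s t 1 \<gamma>] st by (simp add: ac_simps)
    with 1 fin show "?L s t \<le> ennreal e"
      by (auto simp: ennreal_add_left_cancel_le)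
  qed
qed

lemma path_length_on_affine:
  assumes "0 < k"
  shows "path_length_on (\<lambda>t. \<gamma> (k * t + a)) s t = path_length_on \<gamma> (k * s + a) (k * t + a)"
proof -
  have pm: "polygon (\<lambda>t. \<gamma> (k * t + a)) ts = polygon \<gamma> (map (\<lambda>t. k * t + a) ts)" for ts
  proof (induction ts)
    case (Cons x xs) then show ?case by (cases xs) auto
  qed simp
  have "(\<lambda>ts. map (\<lambda>t. k * t + a) ts) ` {ts. sorted ts \<and> set ts \<subseteq> {s..t}} =
      {ts. sorted ts \<and> set ts \<subseteq> {k * s + a..k * t + a}}" (is "?f ` ?A = ?B")
  proof (intro equalityI subsetI)
    fix x assume "x \<in> ?f ` ?A"
    then show "x \<in> ?B"
      using assms by (auto simp: sorted_map subset_iff elim!: sorted_wrt_mono_rel[rotated])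
  next
    fix x assume x: "x \<in> ?B"
    let ?y = "map (\<lambda>t. (t - a) / k) x"
    have "?f ?y = x" using assms by (simp add: comp_def)
    moreover have "?y \<in> ?A"
      using x assms 
      by (auto simp: sorted_map field_simps elim!: sorted_wrt_mono_rel[rotated])
    ultimately show "x \<in> ?f ` ?A" by force
  qed
  then show ?thesis
    unfolding path_length_on_eq_SUP pm by (simp add: image_image flip: \<open>?f ` ?A = ?B\<close>)
qed

section \<open>Arc length parametrisation\<close>

text \<open>The initial length \<Lambda> is continuous and nondecreasing, and \<gamma> is constant
  wherever \<Lambda> is; hence \<gamma> factors through \<Lambda> by a 1-Lipschitz map. The last
  clause lets an inequality known for all curves be applied to each piece of a given one.\<close>

lemma curve_arc_length:
  fixes \<gamma> :: "real \<Rightarrow> 'a::metric_space"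
  assumes "nonconstant_curve \<gamma>"
  obtains c :: "real \<Rightarrow> 'a" and l :: real where "0 < l" "\<And>s t. dist (c s) (c t) \<le> \<bar>s - t\<bar>"
    "c 0 = pathstart \<gamma>" "c l = pathfinish \<gamma>" "range c \<subseteq> path_image \<gamma>"
    "\<And>g. line_integral \<gamma> g = (\<integral>\<^sup>+ s \<in> {0..l}. g (c s) \<partial>lebesgue)"
    "\<And>s t. 0 \<le> s \<Longrightarrow> s < t \<Longrightarrow> t \<le> l \<Longrightarrow> \<exists>\<sigma>. nonconstant_curve \<sigma> \<and> path_image \<sigma> \<subseteq> path_image \<gamma> \<and>
       pathstart \<sigma> = c s \<and> pathfinish \<sigma> = c t \<and>
       (\<forall>g. line_integral \<sigma> g = (\<integral>\<^sup>+ r \<in> {0..t - s}. g (c (s + r)) \<partial>lebesgue))"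
proof -
  let ?L = "path_length_on \<gamma>"
  have curve: "curve \<gamma>" and nc: "\<not> \<gamma> constant_on {0..1}" and path: "path \<gamma>" and fin: "?L 0 1 < \<infinity>"
    using assms by (auto simp: nonconstant_curve_def curve_def)
  have Lfin: "?L a b < \<infinity>" if "0 \<le> a" "a \<le> b" "b \<le> 1" for a b
  proof -
    have "?L 0 a + (?L a b + ?L b 1) = ?L 0 1"
      using path_length_on_add[of 0 a 1 \<gamma>] path_length_on_add[of a b 1 \<gamma>] that by simp
    with fin have "?L 0 a + (?L a b + ?L b 1) < \<infinity>" by simp
    then show ?thesis by simp
  qed
  define \<Lambda> where "\<Lambda> t = enn2real (?L 0 t)" for t
  have eL: "ennreal (\<Lambda> t) = ?L 0 t" if "0 \<le> t" "t \<le> 1" for t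
    using Lfin[of 0 t] that by (simp add: \<Lambda>_def ennreal_enn2real_if)
  have Ldiff: "\<Lambda> a \<le> \<Lambda> b \<and> ?L a b = ennreal (\<Lambda> b - \<Lambda> a)" if "0 \<le> a" "a \<le> b" "b \<le> 1" for a b
  proof -
    obtain x where x: "?L a b = ennreal x" "0 \<le> x"
      using Lfin[OF \<open>0 \<le> a\<close> \<open>a \<le> b\<close> \<open>b \<le> 1\<close>] by (cases "?L a b") auto
    have "ennreal (\<Lambda> a) + ennreal x = ennreal (\<Lambda> b)"
      using path_length_on_add[of 0 a b \<gamma>] that x eL[of a] eL[of b] by auto
    then have "\<Lambda> a + x = \<Lambda> b"
      using x by (metis \<Lambda>_def enn2real_nonneg ennreal_inj ennreal_plus add_nonneg_nonneg)
    then show ?thesis using x by auto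
  qed
  define l where "l = \<Lambda> 1"
  have \<Lambda>0 [simp]: "\<Lambda> 0 = 0" by (simp add: \<Lambda>_def)
  have const: "\<gamma> a = \<gamma> b" if "0 \<le> a" "a \<le> b" "b \<le> 1" "\<Lambda> a = \<Lambda> b" for a b
    using dist_le_path_length[of a b \<gamma>] Ldiff[of a b] that by (simp add: ennreal_eq_0_iff)
  have lpos: "0 < l"
  proof (rule ccontr)
    assume "\<not> 0 < l"
    then have "l = 0" by (simp add: l_def \<Lambda>_def not_less antisym)
    have "\<gamma> t = \<gamma> 0" if "t \<in> {0..1}" for t
      using const[of 0 t] Ldiff[of 0 t] Ldiff[of t 1] that \<open>l = 0\<close> by (auto simp: l_def)
    then have "\<gamma> constant_on {0..1}" unfolding constant_on_def by blast
    with nc show False by contradiction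
  qed
  have cont: "continuous_on {0..1} \<Lambda>"
    unfolding continuous_on_iff
  proof (intro ballI allI impI)
    fix x :: real and e :: real assume x: "x \<in> {0..1}" and e: "0 < e"
    obtain d where d: "d > 0"
      "\<And>s t. 0 \<le> s \<Longrightarrow> s \<le> t \<Longrightarrow> t \<le> 1 \<Longrightarrow> t - s < d \<Longrightarrow> ?L s t \<le> ennreal (e / 2)"
      by (rule path_length_on_uniformly_small[OF curve half_gt_zero[OF e]]) blast
    have *: "\<Lambda> t - \<Lambda> s \<le> e / 2 \<and> \<Lambda> s \<le> \<Lambda> t" if "0 \<le> s" "s \<le> t" "t \<le> 1" "t - s < d" for s t
      using d(2)[of s t] Ldiff[of s t] that e by auto
    show "\<exists>d>0. \<forall>x'\<in>{0..1}. dist x' x < d \<longrightarrow> dist (\<Lambda> x') (\<Lambda> x) < e"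
    proof (intro exI[of _ d] conjI ballI impI d(1))
      fix y assume y: "y \<in> {0..1}" "dist y x < d"
      show "dist (\<Lambda> y) (\<Lambda> x) < e"
        using *[of x y] *[of y x] x y e by (cases "x \<le> y") (auto simp: dist_real_def)
    qed
  qed
  have surj: "\<exists>t\<in>{0..1}. \<Lambda> t = s" if "0 \<le> s" "s \<le> l" for s
    using IVT'[of \<Lambda> 0 s 1] cont that by (auto simp: l_def)
  \<comment> \<open>Clamping the argument extends the parametrisation by constants. It becomes
    1-Lipschitz on the whole line, and integrals over \<open>{0..l}\<close> are unchanged.\<close>
  define c where "c s = arc_length_param \<gamma> (max 0 (min l s))" for s
  have ce: "c (\<Lambda> t) = \<gamma> t" if "0 \<le> t" "t \<le> 1" for t
  proof -
    have "0 \<le> \<Lambda> t" "\<Lambda> t \<le> l" using Ldiff[of t 1] that by (auto simp: l_def \<Lambda>_def)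
    then have m: "max 0 (min l (\<Lambda> t)) = \<Lambda> t" by simp
    \<comment> \<open>Whatever parameter the choice operator returns, it has the same initial length
      as t, and \<gamma> agrees at any two such parameters.\<close>
    define z where "z = (SOME r. r \<in> {0..1} \<and> ?L 0 r = ennreal (\<Lambda> t))"
    have "z \<in> {0..1} \<and> ?L 0 z = ennreal (\<Lambda> t)"
      unfolding z_def by (rule someI[of _ t]) (use that eL in auto)
    then have z: "0 \<le> z" "z \<le> 1" "\<Lambda> z = \<Lambda> t" by (auto simp: \<Lambda>_def)
    have "\<gamma> z = \<gamma> t"
    proof (cases "z \<le> t")
      case True
      show ?thesis by (rule const[OF z(1) True that(2) z(3)])
    next
      case False
      show ?thesis by (rule const[OF that(1) _ z(2) z(3)[symmetric], symmetric]) (use False in simp)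
    qed
    then show ?thesis unfolding c_def m arc_length_param_def z_def[symmetric] .
  qed
  have clamp: "c s = c (max 0 (min l s))" for s using lpos by (simp add: c_def)
  have lip0: "dist (c s) (c t) \<le> t - s" if st: "0 \<le> s" "s \<le> t" "t \<le> l" for s t
  proof -
    obtain a b where ab: "a \<in> {0..1}" "\<Lambda> a = s" "b \<in> {0..1}" "\<Lambda> b = t"
      using surj[of s] surj[of t] st by force
    show ?thesis
    proof (cases "a \<le> b")
      case True
      then show ?thesis using dist_le_path_length[of a b \<gamma>] Ldiff[of a b] ab ce[of a] ce[of b] by auto
    next
      case False
      then have "\<Lambda> b \<le> \<Lambda> a" using Ldiff[of b a] ab by auto
      then have "s = t" using ab that by auto
      then show ?thesis by simp
    qed
  qed
  have lip: "dist (c s) (c t) \<le> \<bar>s - t\<bar>" for s t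
  proof -
    have "dist (c s) (c t) \<le> \<bar>max 0 (min l s) - max 0 (min l t)\<bar>"
      using lip0[of "max 0 (min l s)" "max 0 (min l t)"] lip0[of "max 0 (min l t)" "max 0 (min l s)"]
        clamp[of s] clamp[of t] lpos by (cases "s \<le> t") (auto simp: dist_commute)
    also have "\<dots> \<le> \<bar>s - t\<bar>" using lpos by auto
    finally show ?thesis .
  qed
  have range: "range c \<subseteq> path_image \<gamma>"
  proof
    fix x assume "x \<in> range c"
    then obtain s where "x = c s" by auto
    moreover obtain t where "t \<in> {0..1}" "\<Lambda> t = max 0 (min l s)" using surj[of "max 0 (min l s)"] lpos by auto
    ultimately show "x \<in> path_image \<gamma>" using clamp[of s] ce[of t] by (auto simp: path_image_def)
  qed
  have li: "line_integral \<gamma> g = (\<integral>\<^sup>+ s \<in> {0..l}. g (c s) \<partial>lebesgue)" for g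
    unfolding line_integral_def l_def[symmetric, unfolded \<Lambda>_def]
    by (intro nn_integral_cong) (auto simp: c_def indicator_def)
  have sub: "\<exists>\<sigma>. nonconstant_curve \<sigma> \<and> path_image \<sigma> \<subseteq> path_image \<gamma> \<and>
       pathstart \<sigma> = c s \<and> pathfinish \<sigma> = c t \<and>
       (\<forall>g. line_integral \<sigma> g = (\<integral>\<^sup>+ r \<in> {0..t - s}. g (c (s + r)) \<partial>lebesgue))"
    if st: "0 \<le> s" "s < t" "t \<le> l" for s t
  proof -
    obtain a b where ab: "a \<in> {0..1}" "\<Lambda> a = s" "b \<in> {0..1}" "\<Lambda> b = t"
      using surj[of s] surj[of t] st by auto
    have "a < b" using Ldiff[of b a] ab st by (cases "a < b") auto
    \<comment> \<open>The piece of \<open>c\<close> over \<open>{s..t}\<close> is \<gamma>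
      restricted to \<open>{a..b}\<close> and rescaled to the unit interval. Its initial lengths are
      those of \<gamma> minus s, so its own arc length parametrisation is \<open>c\<close> shifted
      by s.\<close>
    define \<sigma> where "\<sigma> t = \<gamma> ((b - a) * t + a)" for t
    have \<sigma>_eq: "\<sigma> = (\<lambda>t. \<gamma> ((b - a) * t + a))" by (simp add: \<sigma>_def fun_eq_iff)
    have in_ab: "a \<le> (b - a) * r + a \<and> (b - a) * r + a \<le> b" if "r \<in> {0..1}" for r
    proof -
      define p where "p = (b - a) * r"
      have "p \<le> b - a" "0 \<le> p"
        using that \<open>a < b\<close> by (auto simp: p_def intro: mult_left_le)
      then show ?thesis unfolding p_def[symmetric] by simp
    qed
    have L\<sigma>: "path_length_on \<sigma> 0 r = ennreal (\<Lambda> ((b - a) * r + a) - s)" if "r \<in> {0..1}" for r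
    proof -
      have "a \<le> (b - a) * r + a" "(b - a) * r + a \<le> b" using in_ab[OF that] by auto
      then show ?thesis
        unfolding \<sigma>_eq using path_length_on_affine[of "b - a" \<gamma> a 0 r] \<open>a < b\<close> Ldiff[of a "(b - a) * r + a"] ab
        by auto
    qed
    have len: "path_length_on \<sigma> 0 1 = ennreal (t - s)" using L\<sigma>[of 1] ab by simp
    have \<sigma>: "curve \<sigma>"
      unfolding curve_def path_def
    proof
      show "continuous_on {0..1} \<sigma>"
        unfolding \<sigma>_eq
      proof (rule continuous_on_compose2[of "{0..1}" \<gamma>])
        show "(\<lambda>t. (b - a) * t + a) ` {0..1} \<subseteq> {0..1}" using in_ab ab by force
      qed (use path in \<open>auto simp: path_def intro!: continuous_intros\<close>)
    qed (simp add: len)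
    have nc\<sigma>: "\<not> \<sigma> constant_on {0..1}"
    proof
      assume "\<sigma> constant_on {0..1}"
      then obtain z where z: "\<And>r. r \<in> {0..1} \<Longrightarrow> \<sigma> r = z" by (auto simp: constant_on_def)
      have "polygon \<sigma> ts = 0" if "set ts \<subseteq> {0..1}" for ts
        using that z by (induction \<sigma> ts rule: polygon.induct) auto
      then have "path_length_on \<sigma> 0 1 = 0"
        unfolding path_length_on_eq_SUP by (auto intro!: antisym SUP_least)
      then show False using len st by (simp add: ennreal_eq_0_iff)
    qed
    have param: "arc_length_param \<sigma> r = c (s + r)" if r: "r \<in> {0..t - s}" for r
    proof -
      obtain p where p: "a \<le> p" "p \<le> b" "\<Lambda> p = s + r"
        using IVT'[of \<Lambda> a "s + r" b] continuous_on_subset[OF cont, of "{a..b}"] ab r \<open>a < b\<close> by auto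
      define z where "z = (SOME q. q \<in> {0..1} \<and> path_length_on \<sigma> 0 q = ennreal r)"
      have "z \<in> {0..1} \<and> path_length_on \<sigma> 0 z = ennreal r"
        unfolding z_def
        by (rule someI[of _ "(p - a) / (b - a)"]) (use p \<open>a < b\<close> L\<sigma>[of "(p - a) / (b - a)"] in auto)
      then have z: "z \<in> {0..1}" "path_length_on \<sigma> 0 z = ennreal r" by auto
      let ?w = "(b - a) * z + a"
      have w: "a \<le> ?w" "?w \<le> b"
        using in_ab[OF z(1)] by auto
      have "\<Lambda> ?w \<ge> s" using Ldiff[of a ?w] w ab by auto
      then have "\<Lambda> ?w = s + r" using L\<sigma>[OF z(1)] z(2) r by auto
      then have "c (s + r) = \<gamma> ?w" using ce[of ?w] w ab by auto
      then show ?thesis unfolding arc_length_param_def z_def[symmetric] by (simp add: \<sigma>_def)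
    qed
    have "line_integral \<sigma> g = (\<integral>\<^sup>+ r \<in> {0..t - s}. g (c (s + r)) \<partial>lebesgue)" for g
      unfolding line_integral_def len using st
      by (intro nn_integral_cong) (auto simp: param indicator_def)
    moreover have "path_image \<sigma> \<subseteq> path_image \<gamma>" "pathstart \<sigma> = c s" "pathfinish \<sigma> = c t"
      using ab ce[of a] ce[of b] in_ab
      by (force simp: \<sigma>_def path_image_def pathstart_def pathfinish_def)+
    ultimately show ?thesis using \<sigma> nc\<sigma> by (intro exI[of _ \<sigma>]) (auto simp: nonconstant_curve_def)
  qed
  have "c 0 = pathstart \<gamma>" "c l = pathfinish \<gamma>"
    using ce[of 0] ce[of 1] by (auto simp: pathstart_def pathfinish_def l_def)
  then show thesis by (rule that[OF lpos lip _ _ range li sub])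
qed

section \<open>Upper gradients along every curve\<close>

text \<open>In contrast to \<open>weak_upper_gradient\<close> there is no exceptional family, so the
  inequality passes to subarcs without tracking families of curves. Real values make differences and
  series of such functions available.\<close>

definition real_upper_gradient :: "'a::metric_space set \<Rightarrow> ('a \<Rightarrow> real) \<Rightarrow> ('a \<Rightarrow> ennreal) \<Rightarrow> bool" where
  "real_upper_gradient \<Omega> f g \<longleftrightarrow> g \<in> borel_measurable borel \<and>
     (\<forall>\<gamma>. nonconstant_curve \<gamma> \<and> path_image \<gamma> \<subseteq> \<Omega> \<longrightarrow>
        ennreal \<bar>f (pathstart \<gamma>) - f (pathfinish \<gamma>)\<bar> \<le> line_integral \<gamma> g)"

text \<open>
  A curve inside \<open>\<Omega>\<close> in arc length parametrisation, extended by constants to the whole line. The last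
  clause holds because the pieces of a curve are again curves.
\<close>

definition test_arc :: "'a::metric_space set \<Rightarrow> (real \<Rightarrow> 'a) \<Rightarrow> real \<Rightarrow> bool" where
  "test_arc \<Omega> c l \<longleftrightarrow> 0 < l \<and> (\<forall>s t. dist (c s) (c t) \<le> \<bar>s - t\<bar>) \<and> range c \<subseteq> \<Omega> \<and>
     (\<forall>f g s t. real_upper_gradient \<Omega> f g \<longrightarrow> 0 \<le> s \<longrightarrow> s \<le> t \<longrightarrow> t \<le> l \<longrightarrow>
        ennreal \<bar>f (c s) - f (c t)\<bar> \<le> (\<integral>\<^sup>+ r \<in> {s..t}. g (c r) \<partial>lborel))"

lemma test_arc_continuous: "test_arc \<Omega> c l \<Longrightarrow> continuous_on UNIV c"
  unfolding test_arc_def continuous_on_iff dist_real_def by (meson UNIV_I order.strict_trans1)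

lemma test_arc_measurable: "test_arc \<Omega> c l \<Longrightarrow> c \<in> borel_measurable borel"
  by (auto dest: test_arc_continuous intro: borel_measurable_continuous_onI)

lemma test_arc_measurable_comp:
  "test_arc \<Omega> c l \<Longrightarrow> g \<in> borel_measurable borel \<Longrightarrow> (\<lambda>r. g (c r)) \<in> borel_measurable borel"
  using measurable_compose[OF test_arc_measurable] .

lemma curve_test_arc:
  assumes "nonconstant_curve \<gamma>" "path_image \<gamma> \<subseteq> \<Omega>"
  obtains c l where "test_arc \<Omega> c l" "c 0 = pathstart \<gamma>" "c l = pathfinish \<gamma>"
    "\<And>g. line_integral \<gamma> g = (\<integral>\<^sup>+ s \<in> {0..l}. g (c s) \<partial>lborel)"
proof -
  obtain c l where c: "0 < l" "\<And>s t. dist (c s) (c t) \<le> \<bar>s - t\<bar>"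
    "c 0 = pathstart \<gamma>" "c l = pathfinish \<gamma>" "range c \<subseteq> path_image \<gamma>"
    "\<And>g. line_integral \<gamma> g = (\<integral>\<^sup>+ s \<in> {0..l}. g (c s) \<partial>lebesgue)"
    "\<And>s t. 0 \<le> s \<Longrightarrow> s < t \<Longrightarrow> t \<le> l \<Longrightarrow> \<exists>\<sigma>. nonconstant_curve \<sigma> \<and> path_image \<sigma> \<subseteq> path_image \<gamma> \<and>
       pathstart \<sigma> = c s \<and> pathfinish \<sigma> = c t \<and>
       (\<forall>g. line_integral \<sigma> g = (\<integral>\<^sup>+ r \<in> {0..t - s}. g (c (s + r)) \<partial>lebesgue))"
    by (rule curve_arc_length[OF assms(1)]) blast
  have "continuous_on UNIV c"
    unfolding continuous_on_iff dist_real_def using c(2) by (meson UNIV_I order.strict_trans1)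
  then have cm: "c \<in> borel_measurable borel" by (rule borel_measurable_continuous_onI)
  have "ennreal \<bar>f (c s) - f (c t)\<bar> \<le> (\<integral>\<^sup>+ r \<in> {s..t}. g (c r) \<partial>lborel)"
    if g: "real_upper_gradient \<Omega> f g" and st: "0 \<le> s" "s \<le> t" "t \<le> l" for f g s t
  proof (cases "s = t")
    case False
    then obtain \<sigma> where \<sigma>: "nonconstant_curve \<sigma>" "path_image \<sigma> \<subseteq> path_image \<gamma>"
      "pathstart \<sigma> = c s" "pathfinish \<sigma> = c t"
      "\<And>g. line_integral \<sigma> g = (\<integral>\<^sup>+ r \<in> {0..t - s}. g (c (s + r)) \<partial>lebesgue)"
      using c(7)[of s t] st by auto
    have gm: "(\<lambda>r. g (c r)) \<in> borel_measurable borel"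
      using g cm by (auto simp: real_upper_gradient_def)
    have "ennreal \<bar>f (c s) - f (c t)\<bar> \<le> line_integral \<sigma> g"
      using g \<sigma>(1-4) assms(2) unfolding real_upper_gradient_def by (metis subset_trans)
    also have "\<dots> = (\<integral>\<^sup>+ r. g (c (s + r)) * indicator {0..t - s} r \<partial>lborel)"
      by (simp add: \<sigma>(5) nn_integral_completion)
    also have "\<dots> = (\<integral>\<^sup>+ r. g (c (s + 1 * r)) * indicator {s..t} (s + 1 * r) \<partial>lborel)"
      by (intro nn_integral_cong) (auto simp: indicator_def)
    also have "\<dots> = (\<integral>\<^sup>+ r \<in> {s..t}. g (c r) \<partial>lborel)"
      using nn_integral_real_affine[of "\<lambda>r. g (c r) * indicator {s..t} r" 1 s] gm by simp
    finally show ?thesis .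
  qed simp
  then have "test_arc \<Omega> c l" using c assms(2) by (auto simp: test_arc_def)
  then show thesis using c by (intro that[of c l]) (auto simp: nn_integral_completion)
qed

lemma real_upper_gradientI:
  assumes "g \<in> borel_measurable borel"
    and "\<And>c l. test_arc \<Omega> c l \<Longrightarrow> ennreal \<bar>f (c 0) - f (c l)\<bar> \<le> (\<integral>\<^sup>+ r \<in> {0..l}. g (c r) \<partial>lborel)"
  shows "real_upper_gradient \<Omega> f g"
  unfolding real_upper_gradient_def
proof (intro conjI allI impI assms(1))
  fix \<gamma> :: "real \<Rightarrow> 'a" assume "nonconstant_curve \<gamma> \<and> path_image \<gamma> \<subseteq> \<Omega>"
  then have \<gamma>: "nonconstant_curve \<gamma>" "path_image \<gamma> \<subseteq> \<Omega>" by auto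
  obtain c l where "test_arc \<Omega> c l" "c 0 = pathstart \<gamma>" "c l = pathfinish \<gamma>"
    "\<And>g. line_integral \<gamma> g = (\<integral>\<^sup>+ s \<in> {0..l}. g (c s) \<partial>lborel)"
    by (rule curve_test_arc[OF \<gamma>]) blast
  then show "ennreal \<bar>f (pathstart \<gamma>) - f (pathfinish \<gamma>)\<bar> \<le> line_integral \<gamma> g"
    using assms(2)[of c l] by simp
qed

lemma test_arcD:
  assumes "test_arc \<Omega> c l" "real_upper_gradient \<Omega> f g" "0 \<le> s" "s \<le> t" "t \<le> l"
  shows "ennreal \<bar>f (c s) - f (c t)\<bar> \<le> (\<integral>\<^sup>+ r \<in> {s..t}. g (c r) \<partial>lborel)"
  using assms by (auto simp: test_arc_def)

section \<open>Functions of one variable with increments bounded by integrals\<close>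

lemma nn_integral_Icc_add:
  fixes H :: "real \<Rightarrow> ennreal"
  assumes "H \<in> borel_measurable borel" "a \<le> b" "b \<le> c"
  shows "(\<integral>\<^sup>+ r \<in> {a..b}. H r \<partial>lborel) + (\<integral>\<^sup>+ r \<in> {b..c}. H r \<partial>lborel) = (\<integral>\<^sup>+ r \<in> {a..c}. H r \<partial>lborel)"
proof -
  have "(\<integral>\<^sup>+ r \<in> {a..b}. H r \<partial>lborel) + (\<integral>\<^sup>+ r \<in> {b..c}. H r \<partial>lborel)
      = (\<integral>\<^sup>+ r. H r * indicator {a..b} r + H r * indicator {b..c} r \<partial>lborel)"
    using assms by (intro nn_integral_add[symmetric]) auto
  also have "\<dots> = (\<integral>\<^sup>+ r \<in> {a..c}. H r \<partial>lborel)"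
    by (rule nn_integral_cong_AE)
       (use assms AE_lborel_singleton[of b] in \<open>auto elim!: eventually_mono simp: indicator_def\<close>)
  finally show ?thesis .
qed

lemma nn_integral_Icc_mono:
  fixes H :: "real \<Rightarrow> ennreal"
  assumes "a' \<le> a" "b \<le> b'"
  shows "(\<integral>\<^sup>+ r \<in> {a..b}. H r \<partial>lborel) \<le> (\<integral>\<^sup>+ r \<in> {a'..b'}. H r \<partial>lborel)"
  using assms by (intro nn_integral_mono) (auto simp: indicator_def)

text \<open>The increments of f are dominated by those of the indefinite integral of H, which is
  continuous because H is integrable on \<open>{0..l}\<close>.\<close>

lemma continuous_on_of_nn_integral_bound:
  fixes f :: "real \<Rightarrow> real"
  assumes H: "H \<in> borel_measurable borel" and fin: "(\<integral>\<^sup>+ r \<in> {0..l}. H r \<partial>lborel) < \<infinity>"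
    and f: "\<And>s t. 0 \<le> s \<Longrightarrow> s \<le> t \<Longrightarrow> t \<le> l \<Longrightarrow> ennreal \<bar>f s - f t\<bar> \<le> (\<integral>\<^sup>+ r \<in> {s..t}. H r \<partial>lborel)"
  shows "continuous_on {0..l} f"
proof (cases "0 \<le> l")
  case True
  \<comment> \<open>H is finite almost everywhere on \<open>{0..l}\<close>, so this real version has
    the same integrals and the theory of real indefinite integrals applies.\<close>
  define h where "h r = enn2real (H r)" for r
  have ae: "AE r in lborel. r \<in> {0..l} \<longrightarrow> H r < \<infinity>"
  proof -
    have "AE r in lborel. H r * indicator {0..l} r \<noteq> \<infinity>"
      using H fin by (intro nn_integral_noteq_infinite) auto
    then show ?thesis by eventually_elim (auto simp: indicator_def less_top split: if_splits)
  qed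
  have hm [measurable]: "h \<in> borel_measurable borel" using H unfolding h_def[abs_def] by simp
  have eq: "(\<integral>\<^sup>+ r \<in> {s..t}. H r \<partial>lborel) = (\<integral>\<^sup>+ r. ennreal (h r * indicator {s..t} r) \<partial>lborel)"
    if "0 \<le> s" "t \<le> l" for s t
    using ae that by (intro nn_integral_cong_AE) (auto elim!: eventually_mono simp: h_def indicator_def)
  have int: "set_integrable lborel {0..l} h"
    unfolding set_integrable_def
  proof (rule integrableI_nonneg)
    show "(\<integral>\<^sup>+ r. ennreal (indicator {0..l} r *\<^sub>R h r) \<partial>lborel) < \<infinity>"
      using fin eq[of 0 l] by (simp add: mult.commute)
      show "(\<lambda>r. indicator {0..l} r *\<^sub>R h r) \<in> borel_measurable lborel"
      using hm by measurable
  qed (simp add: h_def)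
  have hi: "h integrable_on {0..l}"
    by (rule set_borel_integral_eq_integral(1)[OF int])
  define P where "P t = integral {0..t} h" for t
  have P: "continuous_on {0..l} P" unfolding P_def by (rule indefinite_integral_continuous_1[OF hi])
  have le: "\<bar>f s - f t\<bar> \<le> P t - P s" if st: "0 \<le> s" "s \<le> t" "t \<le> l" for s t
  proof -
    have int': "set_integrable lborel {s..t} h"
      by (rule set_integrable_subset[OF int]) (use st in auto)
    have "(\<integral>\<^sup>+ r \<in> {s..t}. H r \<partial>lborel) = ennreal (LINT r:{s..t}|lborel. h r)"
      using int' eq[of s t] st
      unfolding set_integrable_def set_lebesgue_integral_def
      by (subst nn_integral_eq_integral[symmetric]) (auto simp: h_def mult.commute)
    also have "(LINT r:{s..t}|lborel. h r) = integral {s..t} h"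
      by (rule set_borel_integral_eq_integral(2)[OF int'])
    also have "\<dots> = P t - P s"
      using Henstock_Kurzweil_Integration.integral_combine[of 0 s t h]
        integrable_subinterval_real[OF hi, of 0 t] st by (simp add: P_def)
    finally have "ennreal \<bar>f s - f t\<bar> \<le> ennreal (P t - P s)" using f[OF st] by simp
    moreover have "0 \<le> integral {s..t} h"
      using integrable_subinterval_real[OF hi, of s t] st by (intro integral_nonneg) (auto simp: h_def)
    ultimately show ?thesis using \<open>integral {s..t} h = P t - P s\<close> by simp
  qed
  show ?thesis
    unfolding continuous_on_iff dist_real_def
  proof (intro ballI allI impI)
    fix x e assume x: "x \<in> {0..l}" and e: "(0::real) < e"
    then obtain d where d: "d > 0" "\<And>y. y \<in> {0..l} \<Longrightarrow> \<bar>y - x\<bar> < d \<Longrightarrow> \<bar>P y - P x\<bar> < e"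
      using P unfolding continuous_on_iff dist_real_def by blast
    show "\<exists>d>0. \<forall>x'\<in>{0..l}. \<bar>x' - x\<bar> < d \<longrightarrow> \<bar>f x' - f x\<bar> < e"
    proof (intro exI[of _ d] conjI ballI impI d(1))
      fix y assume y: "y \<in> {0..l}" "\<bar>y - x\<bar> < d"
      show "\<bar>f y - f x\<bar> < e"
        using d(2)[OF y] le[of x y] le[of y x] x y by (cases "x \<le> y") auto
    qed
  qed
qed simp

definition clip :: "real \<Rightarrow> real \<Rightarrow> real \<Rightarrow> real" where
  "clip a b x = max a (min b x)"

lemma continuous_on_clip [continuous_intros]:
  "continuous_on S f \<Longrightarrow> continuous_on S (\<lambda>x. clip a b (f x))"
  unfolding clip_def by (intro continuous_intros)

text \<open>Let y be the first time at which the truncation F reaches F t, and x the last time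
  before y at which F is at most F s. Strictly between x and y the truncation is not saturated, so f
  runs inside the open interval from a to b, where H is bounded by H'. The increment of F from s to
  t is no larger than that of f from x to y.\<close>

lemma clip_increment_le_aux:
  fixes f :: "real \<Rightarrow> real"
  assumes f: "continuous_on {s..t} f" and st: "s \<le> t" and ab: "a \<le> b"
    and lt: "clip a b (f s) < clip a b (f t)"
    and H: "\<And>x y. s \<le> x \<Longrightarrow> x \<le> y \<Longrightarrow> y \<le> t \<Longrightarrow> ennreal \<bar>f x - f y\<bar> \<le> (\<integral>\<^sup>+ r \<in> {x..y}. H r \<partial>lborel)"
    and H': "\<And>r. r \<in> {s..t} \<Longrightarrow> a < f r \<Longrightarrow> f r < b \<Longrightarrow> H r \<le> H' r"
  shows "ennreal \<bar>clip a b (f s) - clip a b (f t)\<bar> \<le> (\<integral>\<^sup>+ r \<in> {s..t}. H' r \<partial>lborel)"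
proof -
  define F where "F r = clip a b (f r)" for r
  have F: "continuous_on {s..t} F" unfolding F_def by (intro continuous_intros f)
  have "compact ({s..t} \<inter> F -` {F t..})"
    by (auto simp: compact_eq_bounded_closed bounded_Int intro: continuous_closed_preimage[OF F])
  moreover have "t \<in> {s..t} \<inter> F -` {F t..}" using st by auto
  ultimately obtain y where y: "y \<in> {s..t} \<inter> F -` {F t..}" "\<And>z. z \<in> {s..t} \<inter> F -` {F t..} \<Longrightarrow> y \<le> z"
    using compact_attains_inf[of "{s..t} \<inter> F -` {F t..}"] by blast
  have Fy: "continuous_on {s..y} F" by (rule continuous_on_subset[OF F]) (use y in auto)
  have "compact ({s..y} \<inter> F -` {..F s})"
    by (auto simp: compact_eq_bounded_closed bounded_Int intro: continuous_closed_preimage[OF Fy])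
  moreover have "s \<in> {s..y} \<inter> F -` {..F s}" using y by auto
  ultimately obtain x where x: "x \<in> {s..y} \<inter> F -` {..F s}" "\<And>z. z \<in> {s..y} \<inter> F -` {..F s} \<Longrightarrow> z \<le> x"
    using compact_attains_sup[of "{s..y} \<inter> F -` {..F s}"] by blast
  have mid: "F s < F r \<and> F r < F t" if "x < r" "r < y" for r
    using x(2)[of r] y(2)[of r] x(1) y(1) that by force
  \<comment> \<open>These bounds turn the strict inequalities for F between x and y into a < f r <
    b.\<close>
  have "a \<le> F s" "F t \<le> b" using ab by (auto simp: F_def clip_def)
  have "\<bar>F s - F t\<bar> \<le> \<bar>F x - F y\<bar>" using x y lt unfolding F_def[symmetric] by auto
  also have "\<dots> \<le> \<bar>f x - f y\<bar>" by (auto simp: F_def clip_def)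
  finally have "ennreal \<bar>F s - F t\<bar> \<le> ennreal \<bar>f x - f y\<bar>" by (rule ennreal_leI)
  also have "\<dots> \<le> (\<integral>\<^sup>+ r \<in> {x..y}. H r \<partial>lborel)" using x y by (intro H) auto
  also have "\<dots> \<le> (\<integral>\<^sup>+ r \<in> {x..y}. H' r \<partial>lborel)"
  proof (rule nn_integral_mono_AE)
    have "AE r in lborel. r \<noteq> x \<and> r \<noteq> y"
      using AE_lborel_singleton[of x] AE_lborel_singleton[of y] by eventually_elim auto
    then show "AE r in lborel. H r * indicator {x..y} r \<le> H' r * indicator {x..y} r"
    proof eventually_elim
      case (elim r)
      show ?case
      proof (cases "r \<in> {x..y}")
        case True
        with elim have "F s < F r \<and> F r < F t" by (intro mid) auto
        with \<open>a \<le> F s\<close> \<open>F t \<le> b\<close> have "a < f r" "f r < b" by (auto simp: F_def clip_def split: if_splits)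
        then show ?thesis using H'[of r] True x y by auto
      qed simp
    qed
  qed
  also have "\<dots> \<le> (\<integral>\<^sup>+ r \<in> {s..t}. H' r \<partial>lborel)" using x y by (intro nn_integral_Icc_mono) auto
  finally show ?thesis by (simp add: F_def)
qed

text \<open>A decrease becomes an increase on replacing f by its negative, which reflects the
  truncation interval.\<close>

lemma clip_increment_le:
  fixes f :: "real \<Rightarrow> real"
  assumes f: "continuous_on {s..t} f" and st: "s \<le> t" and ab: "a \<le> b"
    and H: "\<And>x y. s \<le> x \<Longrightarrow> x \<le> y \<Longrightarrow> y \<le> t \<Longrightarrow> ennreal \<bar>f x - f y\<bar> \<le> (\<integral>\<^sup>+ r \<in> {x..y}. H r \<partial>lborel)"
    and H': "\<And>r. r \<in> {s..t} \<Longrightarrow> a < f r \<Longrightarrow> f r < b \<Longrightarrow> H r \<le> H' r"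
  shows "ennreal \<bar>clip a b (f s) - clip a b (f t)\<bar> \<le> (\<integral>\<^sup>+ r \<in> {s..t}. H' r \<partial>lborel)"
proof (cases "clip a b (f s)" "clip a b (f t)" rule: linorder_cases)
  case less
  show ?thesis by (rule clip_increment_le_aux[OF f st ab less H H'])
next
  case greater
  have neg: "clip (- b) (- a) (- x) = - clip a b x" for x using ab by (auto simp: clip_def)
  have "ennreal \<bar>clip (- b) (- a) (- f s) - clip (- b) (- a) (- f t)\<bar> \<le> (\<integral>\<^sup>+ r \<in> {s..t}. H' r \<partial>lborel)"
  proof (rule clip_increment_le_aux[where H = H])
    show "ennreal \<bar>- f x - - f y\<bar> \<le> (\<integral>\<^sup>+ r \<in> {x..y}. H r \<partial>lborel)" if "s \<le> x" "x \<le> y" "y \<le> t" for x y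
      using H[OF that] by (simp add: abs_minus_commute)
    show "continuous_on {s..t} (\<lambda>x. - f x)" by (intro continuous_intros f)
    show "clip (- b) (- a) (- f s) < clip (- b) (- a) (- f t)" using greater by (simp add: neg)
  qed (use st ab H' in auto)
  then show ?thesis by (simp add: neg abs_minus_commute)
qed simp

section \<open>Doubling spaces\<close>

locale doubling_space =
  fixes M :: "'a::complete_space measure"
  assumes space_M [simp]: "space M = UNIV"
    and borel_sets: "sets borel \<subseteq> sets M"
    and outer_regular: "A \<in> sets M \<Longrightarrow> \<exists>B\<in>sets borel. A \<subseteq> B \<and> emeasure M B = emeasure M A"
    and doubling: "doubling_measure M"
begin

lemma borel_setsD [measurable_dest]: "A \<in> sets borel \<Longrightarrow> A \<in> sets M"
  using borel_sets by auto

lemma open_sets [intro]: "open A \<Longrightarrow> A \<in> sets M"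
  by (intro borel_setsD) auto

lemma borel_measurable_imp_measurable [measurable_dest]:
  "f \<in> measurable borel N \<Longrightarrow> f \<in> measurable M N"
  unfolding measurable_def using borel_sets by auto

lemma emeasure_ball_pos: "0 < r \<Longrightarrow> 0 < emeasure M (ball x r)"
  using doubling unfolding doubling_measure_def by (metis mult_2 field_sum_of_halves half_gt_zero)

lemma emeasure_ball_finite: "emeasure M (ball x r) < \<infinity>"
proof (cases "0 < r")
  case True
  obtain C where C: "C \<ge> (1::real)" "\<And>x r. 0 < r \<Longrightarrow> ennreal C * emeasure M (ball x r) < \<infinity>"
    using doubling unfolding doubling_measure_def by blast
  have "1 * emeasure M (ball x r) \<le> ennreal C * emeasure M (ball x r)"
    using C(1) by (intro mult_right_mono) (auto simp flip: ennreal_1)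
  with C(2)[OF True, of x] show ?thesis by auto
qed (simp add: not_less ball_empty)

section \<open>Borel hulls and Borel majorants\<close>

text \<open>Equality of measures makes the difference null only when the measure is finite; hence A
  is first cut by balls, and the hulls of the pieces are united.\<close>

lemma borel_hull:
  assumes A: "A \<in> sets M"
  obtains B where "B \<in> sets borel" "A \<subseteq> B" "emeasure M (B - A) = 0"
proof -
  fix x0 :: 'a
  define D where "D n = A \<inter> ball x0 (real n)" for n :: nat
  have D: "D n \<in> sets M" for n using A by (auto simp: D_def)
  then have "\<forall>n. \<exists>B\<in>sets borel. D n \<subseteq> B \<and> emeasure M B = emeasure M (D n)"
    using outer_regular by blast
  then obtain B where B: "\<And>n. B n \<in> sets borel" "\<And>n. D n \<subseteq> B n" "\<And>n. emeasure M (B n) = emeasure M (D n)"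
    by metis
  have fin: "emeasure M (D n) < \<infinity>" for n
    using emeasure_mono[of "D n" "ball x0 (real n)" M] emeasure_ball_finite[of x0 "real n"]
    by (auto simp: D_def less_top top_unique open_sets intro: le_less_trans)
  have 0: "emeasure M (B n - D n) = 0" for n
    using emeasure_Diff[of M "D n" "B n"] B[of n] D[of n] fin[of n] by (auto simp: borel_setsD)
  have AD: "A = (\<Union>n. D n)"
  proof -
    have "\<exists>n. dist x0 y < real n" for y using reals_Archimedean2 by blast
    then show ?thesis by (auto simp: D_def)
  qed
  have "emeasure M ((\<Union>n. B n) - A) \<le> emeasure M (\<Union>n. B n - D n)"
    using B(1) D by (intro emeasure_mono) (auto simp: AD borel_setsD)
  also have "\<dots> = 0"
    using 0 B(1) D by (intro emeasure_UN_eq_0) (auto simp: borel_setsD)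
  finally show thesis using B by (intro that[of "\<Union>n. B n"]) (auto simp: AD)
qed

text \<open>Indicators have majorants by \<open>borel_hull\<close>, and multiples, sums and
  increasing limits preserve the property. Domination at every point matters because a null set may
  contain a whole curve, so an almost everywhere equal function need not have the same line
  integrals.\<close>

lemma borel_majorant:
  fixes f :: "'a \<Rightarrow> ennreal"
  assumes "f \<in> borel_measurable M"
  obtains g where "g \<in> borel_measurable borel" "\<And>x. f x \<le> g x" "AE x in M. g x = f x"
proof -
  have "\<exists>g. g \<in> borel_measurable borel \<and> (\<forall>x. f x \<le> g x) \<and> (AE x in M. g x = f x)"
    using assms
  proof (induction rule: borel_measurable_induct)
    case (cong f g)
    then show ?case by (auto simp: fun_eq_iff[symmetric] cong: AE_cong)
  next
    case (set A)
    then obtain B where B: "B \<in> sets borel" "A \<subseteq> B" "emeasure M (B - A) = 0" by (rule borel_hull)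
    have "AE x in M. indicator B x = (indicator A x :: ennreal)"
    proof (rule AE_I[OF _ B(3)])
      show "B - A \<in> sets M" using B set by (auto simp: borel_setsD)
    qed (use B in \<open>auto simp: indicator_def\<close>)
    with B show ?case by (intro exI[of _ "indicator B"]) (auto simp: indicator_def)
  next
    case (mult u c)
    then obtain g where "g \<in> borel_measurable borel" "\<forall>x. u x \<le> g x" "AE x in M. g x = u x" by auto
    then show ?case by (intro exI[of _ "\<lambda>x. c * g x"]) (auto intro!: mult_left_mono)
  next
    case (add u v)
    then obtain g h where "g \<in> borel_measurable borel" "\<forall>x. u x \<le> g x" "AE x in M. g x = u x"
      "h \<in> borel_measurable borel" "\<forall>x. v x \<le> h x" "AE x in M. h x = v x" by auto
    then show ?case by (intro exI[of _ "\<lambda>x. h x + g x"]) (auto intro!: add_mono)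
  next
    case (seq U)
    then have "\<forall>i. \<exists>g. g \<in> borel_measurable borel \<and> (\<forall>x. U i x \<le> g x) \<and> (AE x in M. g x = U i x)" by auto
    then obtain g where g: "\<And>i. g i \<in> borel_measurable borel" "\<And>i x. U i x \<le> g i x"
      "\<And>i. AE x in M. g i x = U i x" by metis
    have "AE x in M. \<forall>i. g i x = U i x" using g(3) by (simp add: AE_all_countable)
    then have "AE x in M. (SUP i. g i x) = (SUP i. U i) x" by eventually_elim (simp add: image_image)
    moreover have "(\<lambda>x. SUP i. g i x) \<in> borel_measurable borel" using g(1) by measurable
    ultimately show ?case
      using g(2) by (intro exI[of _ "\<lambda>x. SUP i. g i x"]) (auto intro!: SUP_mono simp: image_image)
  qed
  then show thesis using that by blast
qed

section \<open>Doubling and compactness of closed balls\<close>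

lemma doubling_power:
  obtains C where "C \<ge> 1" "\<And>x r n. 0 < r \<Longrightarrow> emeasure M (ball x (2 ^ n * r)) \<le> ennreal (C ^ n) * emeasure M (ball x r)"
proof -
  obtain C where C: "C \<ge> (1::real)"
    "\<And>x r. 0 < r \<Longrightarrow> emeasure M (ball x (2 * r)) \<le> ennreal C * emeasure M (ball x r)"
    using doubling unfolding doubling_measure_def by blast
  have "emeasure M (ball x (2 ^ n * r)) \<le> ennreal (C ^ n) * emeasure M (ball x r)" if "0 < r" for x r n
  proof (induction n)
    case (Suc n)
    have "emeasure M (ball x (2 ^ Suc n * r)) \<le> ennreal C * emeasure M (ball x (2 ^ n * r))"
      using C(2)[of "2 ^ n * r" x] that by (simp add: mult.assoc)
    also have "\<dots> \<le> ennreal C * (ennreal (C ^ n) * emeasure M (ball x r))"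
      by (intro mult_left_mono Suc) auto
    also have "\<dots> = ennreal (C ^ Suc n) * emeasure M (ball x r)"
      using C(1) by (simp add: ennreal_mult mult.assoc)
    finally show ?case .
  qed simp
  with C(1) show thesis by (rule that)
qed

text \<open>A maximal separated set of a ball is finite, because the disjoint balls around its points have
  measure bounded from below by doubling.\<close>

lemma compact_cball: "compact (cball x0 R :: 'a set)"
  unfolding compact_eq_totally_bounded
proof (intro conjI allI impI)
  show "complete (cball x0 R)" by (simp add: complete_eq_closed)
  fix e :: real assume e: "0 < e"
  show "\<exists>k. finite k \<and> cball x0 R \<subseteq> (\<Union>x\<in>k. ball x e)"
  proof (cases "0 \<le> R")
    case False
    then show ?thesis by (intro exI[of _ "{}"]) auto
  next
    case R: True
    define V where "V = ball x0 (R + e)"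
    obtain C where C: "C \<ge> 1"
      "\<And>x r n. 0 < r \<Longrightarrow> emeasure M (ball x (2 ^ n * r)) \<le> ennreal (C ^ n) * emeasure M (ball x r)"
      by (rule doubling_power) blast
    \<comment> \<open>After n doublings the radius e / 2 exceeds 2 * (R + e), and a ball of that
      size about any point of \<open>cball x0 R\<close> contains V.\<close>
    obtain n :: nat where n: "2 * (R + e) / (e / 2) < 2 ^ n"
      using real_arch_pow[of 2 "2 * (R + e) / (e / 2)"] by auto
    have low: "emeasure M V \<le> ennreal (C ^ n) * emeasure M (ball y (e / 2))" if "y \<in> cball x0 R" for y
    proof -
      have "2 * (R + e) \<le> 2 ^ n * (e / 2)" using n e by (simp add: field_simps)
      then have "V \<subseteq> ball y (2 ^ n * (e / 2))"
      proof -
        have "dist y z < 2 ^ n * (e / 2)" if "dist x0 z < R + e" for z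
          using dist_triangle3[of y z x0] that \<open>y \<in> cball x0 R\<close> \<open>2 * (R + e) \<le> _\<close> e by auto
        then show ?thesis by (auto simp: V_def)
      qed
      then have "emeasure M V \<le> emeasure M (ball y (2 ^ n * (e / 2)))" by (intro emeasure_mono) auto
      also have "\<dots> \<le> ennreal (C ^ n) * emeasure M (ball y (e / 2))" using C(2) e half_gt_zero by blast
      finally show ?thesis .
    qed
    have V: "0 < emeasure M V" "emeasure M V < \<infinity>"
      using emeasure_ball_pos[of "R + e" x0] emeasure_ball_finite[of x0 "R + e"] R e by (auto simp: V_def)
    define sep where "sep k \<longleftrightarrow> finite k \<and> k \<subseteq> cball x0 R \<and> (\<forall>x\<in>k. \<forall>y\<in>k. x \<noteq> y \<longrightarrow> e \<le> dist x y)" for k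
    have bound: "real (card k) \<le> C ^ n" if k: "sep k" for k
    proof -
      have fk: "finite k" and kR: "k \<subseteq> cball x0 R" using k by (auto simp: sep_def)
      have dis: "disjoint_family_on (\<lambda>y. ball y (e / 2)) k"
      proof (unfold disjoint_family_on_def, intro ballI impI)
        fix x y assume "x \<in> k" "y \<in> k" "x \<noteq> y"
        then have "e \<le> dist x y" using k by (auto simp: sep_def)
        then show "ball x (e / 2) \<inter> ball y (e / 2) = {}"
          using dist_triangle_less_add[of x _ "e / 2" y "e / 2"] by (fastforce simp: dist_commute)
      qed
      have "ennreal (card k) * emeasure M V = (\<Sum>y\<in>k. emeasure M V)"
        by (simp add: ennreal_of_nat_eq_real_of_nat)
      also have "\<dots> \<le> (\<Sum>y\<in>k. ennreal (C ^ n) * emeasure M (ball y (e / 2)))"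
        using kR by (intro sum_mono low) auto
      also have "\<dots> = ennreal (C ^ n) * (\<Sum>y\<in>k. emeasure M (ball y (e / 2)))"
        by (simp add: sum_distrib_left)
      also have "(\<Sum>y\<in>k. emeasure M (ball y (e / 2))) = emeasure M (\<Union>y\<in>k. ball y (e / 2))"
        using fk dis by (intro sum_emeasure) auto
      also have "emeasure M (\<Union>y\<in>k. ball y (e / 2)) \<le> emeasure M V"
      proof (intro emeasure_mono)
        show "(\<Union>y\<in>k. ball y (e / 2)) \<subseteq> V"
        proof (intro UN_least subsetI)
          fix y z assume "y \<in> k" "z \<in> ball y (e / 2)"
          then show "z \<in> V" using dist_triangle[of x0 z y] kR e by (auto simp: V_def)
        qed
      qed (auto simp: V_def)
      finally have "ennreal (card k) * emeasure M V \<le> ennreal (C ^ n) * emeasure M V"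
        by (simp add: mult_left_mono)
      moreover obtain v where v: "emeasure M V = ennreal v" "0 < v" 
        using V by (cases "emeasure M V") auto
      ultimately show ?thesis using C(1) by (simp flip: ennreal_mult add: ennreal_mult[symmetric])
    qed
    have "sep {}" by (simp add: sep_def)
    moreover have "\<forall>k. sep k \<longrightarrow> card k \<le> nat \<lceil>C ^ n\<rceil>"
      using bound by (metis of_nat_ceiling of_nat_le_iff order.trans real_nat_ceiling_ge)
    ultimately obtain k where k: "sep k" "\<And>k'. sep k' \<Longrightarrow> card k' \<le> card k"
      using ex_has_greatest_nat[of sep "{}" card "Suc (nat \<lceil>C ^ n\<rceil>)"]
      unfolding less_Suc_eq_le by blast
    have "cball x0 R \<subseteq> (\<Union>x\<in>k. ball x e)"
    proof (rule ccontr)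
      assume "\<not> ?thesis"
      then obtain y where "y \<in> cball x0 R" "y \<notin> (\<Union>x\<in>k. ball x e)" by blast
      then have y: "y \<in> cball x0 R" "\<And>x. x \<in> k \<Longrightarrow> e \<le> dist x y"
        by (simp, meson UN_iff linorder_not_less mem_ball)
      then have "sep (insert y k)" using k(1) by (auto simp: sep_def dist_commute)
      then have "card (insert y k) \<le> card k" by (rule k(2))
      moreover have "y \<notin> k" using y(2)[of y] e by auto
      moreover have "finite k" using k(1) by (simp add: sep_def)
      ultimately show False by simp
    qed
    then show ?thesis using k(1) by (auto simp: sep_def)
  qed
qed

text \<open>The minimum of the distance to the complement and 1 / (1 + \<open>dist x0 x\<close>).
  The first vanishes exactly off \<Omega>; the second keeps superlevel sets in a bounded ball, where
  \<open>compact_cball\<close> applies.\<close>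

lemma exhaustion_function:
  fixes \<Omega> :: "'a set"
  assumes "open \<Omega>"
  obtains \<rho> :: "'a \<Rightarrow> real" where "\<And>x y. \<bar>\<rho> x - \<rho> y\<bar> \<le> dist x y" "\<And>x. 0 \<le> \<rho> x" "\<And>x. \<rho> x \<le> 1"
    "\<And>x. 0 < \<rho> x \<longleftrightarrow> x \<in> \<Omega>" "\<And>s. 0 < s \<Longrightarrow> compact {x. s \<le> \<rho> x}"
proof -
  fix x0 :: 'a
  \<comment> \<open>\<open>infdist\<close> to the empty set is 0, so the whole space needs its own
    positive value.\<close>
  define d where "d x = (if \<Omega> = UNIV then 1 else infdist x (- \<Omega>))" for x
  have d_lip: "\<bar>d x - d y\<bar> \<le> dist x y" for x y
    using infdist_triangle_abs[of x "- \<Omega>" y] by (simp add: d_def)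
  have d_pos: "0 < d x \<longleftrightarrow> x \<in> \<Omega>" for x
    using in_closed_iff_infdist_zero[of "- \<Omega>" x] infdist_nonneg[of x "- \<Omega>"] assms
    by (auto simp: d_def less_le)
  have d0: "0 \<le> d x" for x by (simp add: d_def infdist_nonneg)
  define b where "b x = 1 / (1 + dist x0 x)" for x
  have b_lip: "\<bar>b x - b y\<bar> \<le> dist x y" for x y
  proof -
    have pos: "0 < 1 + dist x0 x" "0 < 1 + dist x0 y" by (auto intro: add_pos_nonneg)
    have "b x - b y = (dist x0 y - dist x0 x) / ((1 + dist x0 x) * (1 + dist x0 y))"
      using pos by (simp add: b_def field_simps)
    then have "\<bar>b x - b y\<bar> = \<bar>dist x0 y - dist x0 x\<bar> / ((1 + dist x0 x) * (1 + dist x0 y))"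
      using pos by (simp add: abs_divide abs_mult)
    also have "\<dots> \<le> \<bar>dist x0 y - dist x0 x\<bar> / 1"
      using mult_mono[of 1 "1 + dist x0 x" 1 "1 + dist x0 y"] by (intro divide_left_mono) auto
    also have "\<dots> \<le> dist x y" using abs_dist_diff_le[of x x0 y] by (simp add: dist_commute abs_minus_commute)
    finally show ?thesis .
  qed
  have b_pos: "0 < b x" "b x \<le> 1" for x by (auto simp: b_def add_pos_nonneg)
  define \<rho> where "\<rho> x = min (d x) (b x)" for x
  have lip: "\<bar>\<rho> x - \<rho> y\<bar> \<le> dist x y" for x y
    using d_lip[of x y] b_lip[of x y] by (auto simp: \<rho>_def)
  have "compact {x. s \<le> \<rho> x}" if "0 < s" for s
  proof -
    have "continuous_on UNIV \<rho>"
      unfolding continuous_on_iff dist_real_def using lip by (meson UNIV_I order.strict_trans1)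
    then have "closed {x. s \<le> \<rho> x}"
      by (intro closed_Collect_le continuous_on_const) 
    moreover have "{x. s \<le> \<rho> x} \<subseteq> cball x0 (1 / s)"
    proof
      fix x assume "x \<in> {x. s \<le> \<rho> x}"
      then have "s * (1 + dist x0 x) \<le> 1"
        using add_pos_nonneg[of 1 "dist x0 x"] by (auto simp: \<rho>_def b_def field_simps)
      then show "x \<in> cball x0 (1 / s)" using that by (simp add: field_simps)
    qed
    ultimately show ?thesis using compact_cball[of x0 "1 / s"] by (metis compact_Int_closed inf.absorb2)
  qed
  moreover have "0 \<le> \<rho> x" "\<rho> x \<le> 1" "0 < \<rho> x \<longleftrightarrow> x \<in> \<Omega>" for x
    using d0[of x] b_pos[of x] d_pos[of x] by (auto simp: \<rho>_def)
  ultimately show thesis using lip that by blast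
qed

end

section \<open>Slices, gluing and series of functions with upper gradients\<close>

lemma ennreal_abs_diff_le_ereal_distance:
  "ennreal \<bar>real_of_ereal a - real_of_ereal b\<bar> \<le> ereal_distance a b"
  by (cases a; cases b) (auto simp: ereal_distance_def)

text \<open>At most one of the two summands differs from its boundary value k or -k, and these
  constants cancel. This is the odd function that for x \<ge> 0 gives the part of x between the
  levels k and k + 1. The form with \<open>clip\<close> makes \<open>clip_increment_le\<close>
  applicable to each summand.\<close>

definition slice :: "nat \<Rightarrow> real \<Rightarrow> real" where
  "slice k x = clip (real k) (real k + 1) x + clip (- (real k + 1)) (- real k) x"

section \<open>Genuine upper gradients for real-valued functions and their slices\<close>

context doubling_space
begin

text \<open>Any positive multiple of \<rho> has infinite integral along the exceptional curves, and
  a small multiple costs little. The Borel majorant of g keeps the inequality on all other curves.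
  Replacing infinite values by 0 is harmless, as \<open>ereal_distance\<close> is infinite
  there.\<close>

lemma weak_upper_gradient_imp_real_upper_gradient:
  assumes wg: "weak_upper_gradient M \<Omega> w g" and \<Omega>: "open \<Omega>"
  obtains h where "real_upper_gradient \<Omega> (\<lambda>x. real_of_ereal (w x)) h"
    "(\<integral>\<^sup>+ x \<in> \<Omega>. h x \<partial>M) \<le> (\<integral>\<^sup>+ x \<in> \<Omega>. g x \<partial>M) + 1"
proof -
  have \<Omega>M: "\<Omega> \<in> sets M" using \<Omega> by auto
  obtain \<Gamma> where gm: "g \<in> borel_measurable (restrict_space M \<Omega>)" and zm: "zero_modulus M \<Gamma>"
    and ug: "\<And>\<gamma>. nonconstant_curve \<gamma> \<Longrightarrow> path_image \<gamma> \<subseteq> \<Omega> \<Longrightarrow> \<gamma> \<notin> \<Gamma> \<Longrightarrow> upper_gradient_inequality w g \<gamma>"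
    using wg unfolding weak_upper_gradient_def by blast
  obtain \<rho> where \<rho>: "\<rho> \<in> borel_measurable borel" "(\<integral>\<^sup>+ x. \<rho> x \<partial>M) < \<infinity>" "\<And>\<gamma>. \<gamma> \<in> \<Gamma> \<Longrightarrow> line_integral \<gamma> \<rho> = \<infinity>"
    using zm unfolding zero_modulus_def by blast
  have "(\<lambda>x. g x * indicator \<Omega> x) \<in> borel_measurable M"
    using gm \<Omega>M by (subst borel_measurable_restrict_space_iff_ennreal[symmetric]) auto
  then obtain g' where g': "g' \<in> borel_measurable borel" "\<And>x. g x * indicator \<Omega> x \<le> g' x"
    "AE x in M. g' x = g x * indicator \<Omega> x" by (rule borel_majorant) blast
  obtain K where K: "(\<integral>\<^sup>+ x. \<rho> x \<partial>M) = ennreal K" "0 \<le> K"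
    using \<rho>(2) by (cases "\<integral>\<^sup>+ x. \<rho> x \<partial>M") auto
  \<comment> \<open>This keeps the added energy a * K at most 1 and stays positive and defined for K
    = 0.\<close>
  define a where "a = 1 / (1 + K)"
  have a: "0 < a" "a * K \<le> 1" using K by (auto simp: a_def field_simps)
  define h where "h x = g' x + ennreal a * \<rho> x" for x
  have hm: "h \<in> borel_measurable borel" unfolding h_def[abs_def] using g' \<rho> by measurable
  have "real_upper_gradient \<Omega> (\<lambda>x. real_of_ereal (w x)) h"
    unfolding real_upper_gradient_def
  proof (intro conjI allI impI hm)
    fix \<gamma> :: "real \<Rightarrow> 'a" assume "nonconstant_curve \<gamma> \<and> path_image \<gamma> \<subseteq> \<Omega>"
    then have \<gamma>: "nonconstant_curve \<gamma>" "path_image \<gamma> \<subseteq> \<Omega>" by auto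
    obtain c l where c: "test_arc \<Omega> c l" and li: "\<And>g. line_integral \<gamma> g = (\<integral>\<^sup>+ s \<in> {0..l}. g (c s) \<partial>lborel)"
      by (rule curve_test_arc[OF \<gamma>]) blast
    show "ennreal \<bar>real_of_ereal (w (pathstart \<gamma>)) - real_of_ereal (w (pathfinish \<gamma>))\<bar> \<le> line_integral \<gamma> h"
    proof (cases "\<gamma> \<in> \<Gamma>")
      case True
      have "\<infinity> = ennreal a * line_integral \<gamma> \<rho>"
        using \<rho>(3)[OF True] a by (simp add: ennreal_mult_top)
      also have "\<dots> = (\<integral>\<^sup>+ s. ennreal a * (\<rho> (c s) * indicator {0..l} s) \<partial>lborel)"
        unfolding li using test_arc_measurable_comp[OF c \<rho>(1)] by (subst nn_integral_cmult) auto
      also have "\<dots> \<le> line_integral \<gamma> h"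
        unfolding li by (intro nn_integral_mono) (auto simp: h_def indicator_def)
      finally show ?thesis by (simp add: top_unique)
    next
      case False
      have "ennreal \<bar>real_of_ereal (w (pathstart \<gamma>)) - real_of_ereal (w (pathfinish \<gamma>))\<bar> \<le> line_integral \<gamma> g"
        using ug[OF \<gamma> False] ennreal_abs_diff_le_ereal_distance order.trans
        unfolding upper_gradient_inequality_def by blast
      also have "\<dots> \<le> line_integral \<gamma> h"
        unfolding li
      proof (rule nn_integral_mono)
        fix s
        have "c s \<in> \<Omega>" using c by (auto simp: test_arc_def)
        then have "g (c s) \<le> g' (c s)" using g'(2)[of "c s"] by simp
        then show "g (c s) * indicator {0..l} s \<le> h (c s) * indicator {0..l} s"
          by (auto simp: h_def indicator_def add_increasing2)
      qed
      finally show ?thesis .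
    qed
  qed
  moreover have "(\<integral>\<^sup>+ x \<in> \<Omega>. h x \<partial>M) \<le> (\<integral>\<^sup>+ x \<in> \<Omega>. g x \<partial>M) + 1"
  proof -
    have m: "g' \<in> borel_measurable M" "\<rho> \<in> borel_measurable M" using g' \<rho> by auto
    have "(\<integral>\<^sup>+ x \<in> \<Omega>. h x \<partial>M) \<le> (\<integral>\<^sup>+ x. g' x + ennreal a * \<rho> x \<partial>M)"
      by (intro nn_integral_mono) (auto simp: h_def indicator_def)
    also have "\<dots> = (\<integral>\<^sup>+ x. g' x \<partial>M) + ennreal a * (\<integral>\<^sup>+ x. \<rho> x \<partial>M)"
      using m by (simp add: nn_integral_add nn_integral_cmult)
    also have "(\<integral>\<^sup>+ x. g' x \<partial>M) = (\<integral>\<^sup>+ x \<in> \<Omega>. g x \<partial>M)" using g'(3) by (rule nn_integral_cong_AE)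
    also have "ennreal a * (\<integral>\<^sup>+ x. \<rho> x \<partial>M) \<le> 1"
      using a K by (simp add: ennreal_mult[symmetric] flip: ennreal_1)
    finally show ?thesis by (simp add: add_left_mono)
  qed
  ultimately show thesis by (rule that)
qed

text \<open>A slice changes along a curve only while |W| lies strictly between k and k + 1. The
  argument needs W to be continuous along the curve, which is known only if h has finite integral
  there; the term a * h makes the inequality trivial on all other curves. The factor 2 counts the
  two truncations in \<open>slice\<close>. The level set is only measurable for the completed
  measure, hence the Borel majorant and the description of s almost everywhere.\<close>

lemma real_upper_gradient_slice:
  fixes W :: "'a \<Rightarrow> real"
  assumes h: "real_upper_gradient \<Omega> W h" and W: "W \<in> borel_measurable M" and a: "0 < a"
  obtains s where "real_upper_gradient \<Omega> (\<lambda>x. slice k (W x)) s"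
    "AE x in M. s x = 2 * (h x * indicator {x. real k < \<bar>W x\<bar> \<and> \<bar>W x\<bar> < real k + 1} x) + ennreal a * h x"
proof -
  let ?S = "{x. real k < \<bar>W x\<bar> \<and> \<bar>W x\<bar> < real k + 1}"
  have hb: "h \<in> borel_measurable borel" using h by (simp add: real_upper_gradient_def)
  then have hM: "h \<in> borel_measurable M" by auto
  have "?S \<in> sets M"
    using W borel_measurable_less[of "\<lambda>_. real k" M "\<lambda>x. \<bar>W x\<bar>"] borel_measurable_less[of "\<lambda>x. \<bar>W x\<bar>" M "\<lambda>_. real k + 1"]
    sets.Int[of "{x. real k < \<bar>W x\<bar>}" M "{x. \<bar>W x\<bar> < real k + 1}"]
    by (simp add: Collect_conj_eq)
  then have "(\<lambda>x. h x * indicator ?S x) \<in> borel_measurable M" using hM by measurable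
  then obtain h' where h': "h' \<in> borel_measurable borel" "\<And>x. h x * indicator ?S x \<le> h' x"
    "AE x in M. h' x = h x * indicator ?S x" by (rule borel_majorant) blast
  define s where "s x = 2 * h' x + ennreal a * h x" for x
  have sm: "s \<in> borel_measurable borel" unfolding s_def[abs_def] using h' hb by measurable
  have "real_upper_gradient \<Omega> (\<lambda>x. slice k (W x)) s"
  proof (rule real_upper_gradientI[OF sm])
    fix c l assume c: "test_arc \<Omega> c l"
    have l: "0 < l" using c by (simp add: test_arc_def)
    note cm = test_arc_measurable_comp[OF c hb] test_arc_measurable_comp[OF c h'(1)]
    have split: "(\<integral>\<^sup>+ r \<in> {0..l}. s (c r) \<partial>lborel) =
        2 * (\<integral>\<^sup>+ r \<in> {0..l}. h' (c r) \<partial>lborel) + ennreal a * (\<integral>\<^sup>+ r \<in> {0..l}. h (c r) \<partial>lborel)"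
    proof -
      have "(\<integral>\<^sup>+ r \<in> {0..l}. s (c r) \<partial>lborel) =
        (\<integral>\<^sup>+ r. 2 * (h' (c r) * indicator {0..l} r) + ennreal a * (h (c r) * indicator {0..l} r) \<partial>lborel)"
        by (intro nn_integral_cong) (auto simp: s_def indicator_def)
      then show ?thesis using cm by (simp add: nn_integral_add nn_integral_cmult)
    qed
    show "ennreal \<bar>slice k (W (c 0)) - slice k (W (c l))\<bar> \<le> (\<integral>\<^sup>+ r \<in> {0..l}. s (c r) \<partial>lborel)"
    proof (cases "(\<integral>\<^sup>+ r \<in> {0..l}. h (c r) \<partial>lborel) < \<infinity>")
      case False
      then have "(\<integral>\<^sup>+ r \<in> {0..l}. h (c r) \<partial>lborel) = \<infinity>"
        by (metis infinity_ennreal_def top.not_eq_extremum)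
      then show ?thesis unfolding split using a by (simp add: ennreal_mult_top)
    next
      case True
      have bd: "ennreal \<bar>W (c x) - W (c y)\<bar> \<le> (\<integral>\<^sup>+ r \<in> {x..y}. h (c r) \<partial>lborel)" 
        if "0 \<le> x" "x \<le> y" "y \<le> l" for x y
        using test_arcD[OF c h that] .
      have cont: "continuous_on {0..l} (\<lambda>r. W (c r))"
        by (rule continuous_on_of_nn_integral_bound[OF cm(1) True bd])
      have le: "h (c r) \<le> h' (c r)" if "real k < \<bar>W (c r)\<bar>" "\<bar>W (c r)\<bar> < real k + 1" for r
        using h'(2)[of "c r"] that by simp
      have 1: "ennreal \<bar>clip (real k) (real k + 1) (W (c 0)) - clip (real k) (real k + 1) (W (c l))\<bar> \<le> (\<integral>\<^sup>+ r \<in> {0..l}. h' (c r) \<partial>lborel)"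
        by (rule clip_increment_le[OF cont _ _ bd]) (use l le in auto)
      have 2: "ennreal \<bar>clip (- (real k + 1)) (- real k) (W (c 0)) - clip (- (real k + 1)) (- real k) (W (c l))\<bar>
          \<le> (\<integral>\<^sup>+ r \<in> {0..l}. h' (c r) \<partial>lborel)"
        by (rule clip_increment_le[OF cont _ _ bd]) (use l le in auto)
      have "ennreal \<bar>slice k (W (c 0)) - slice k (W (c l))\<bar> \<le>
          ennreal \<bar>clip (real k) (real k + 1) (W (c 0)) - clip (real k) (real k + 1) (W (c l))\<bar> +
          ennreal \<bar>clip (- (real k + 1)) (- real k) (W (c 0)) - clip (- (real k + 1)) (- real k) (W (c l))\<bar>"
        unfolding ennreal_plus[OF abs_ge_zero abs_ge_zero, symmetric] slice_def
        by (intro ennreal_leI) linarith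
      also have "\<dots> \<le> 2 * (\<integral>\<^sup>+ r \<in> {0..l}. h' (c r) \<partial>lborel)"
        using add_mono[OF 1 2] by (simp add: mult_2)
      also have "\<dots> \<le> (\<integral>\<^sup>+ r \<in> {0..l}. s (c r) \<partial>lborel)" unfolding split by simp
      finally show ?thesis .
    qed
  qed
  moreover have "AE x in M. s x = 2 * (h x * indicator ?S x) + ennreal a * h x"
    using h'(3) by eventually_elim (simp add: s_def)
  ultimately show thesis by (rule that)
qed

end

section \<open>Gluing along a partition of unity\<close>

text \<open>
  The function \<open>B\<close> need not have an upper gradient: it only serves to compare neighbouring \<open>A j\<close>.
\<close>

lemma real_upper_gradient_glue:
  fixes A \<phi> :: "nat \<Rightarrow> 'a::metric_space \<Rightarrow> real" and K :: "nat \<Rightarrow> real" and B F :: "'a \<Rightarrow> real"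
  assumes U: "\<And>j. open (U j)"
    and ug: "\<And>j. real_upper_gradient \<Omega> (A j) (s j)"
    and D: "\<And>j. D j \<in> borel_measurable borel" "\<And>j x. x \<in> U j \<Longrightarrow> ennreal \<bar>A j x - B x\<bar> \<le> D j x"
    and K: "\<And>j. 0 \<le> K j"
    and \<phi>: "\<And>j x. 0 \<le> \<phi> j x" "\<And>j x y. \<bar>\<phi> j x - \<phi> j y\<bar> \<le> K j * dist x y"
    and loc: "\<And>y. y \<in> \<Omega> \<Longrightarrow> \<exists>N J. open N \<and> y \<in> N \<and> finite J \<and> card J \<le> 4 \<and> (\<forall>j\<in>J. N \<subseteq> U j) \<and>
        (\<forall>x\<in>N. (\<Sum>j\<in>J. \<phi> j x) = 1 \<and> F x = (\<Sum>j\<in>J. \<phi> j x * A j x))"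
  shows "real_upper_gradient \<Omega> F (\<lambda>x. \<Sum>j. indicator (U j) x * (3 * s j x + 5 * (ennreal (K j) * D j x)))"
    (is "real_upper_gradient \<Omega> F ?G")
proof -
  have sm [measurable]: "s j \<in> borel_measurable borel" for j using ug by (simp add: real_upper_gradient_def)
  note D(1) [measurable]
  have [measurable]: "U j \<in> sets borel" for j using U by simp
  have Gm: "?G \<in> borel_measurable borel" by measurable
  show ?thesis
  proof (rule real_upper_gradientI[OF Gm])
    fix c l assume c: "test_arc \<Omega> c l"
    note comp = test_arc_measurable_comp[OF c]
    have l: "0 < l" and cO: "\<And>r. c r \<in> \<Omega>" and c_lip: "\<And>s t. dist (c s) (c t) \<le> \<bar>s - t\<bar>"
      using c by (auto simp: test_arc_def)
    define P where "P a b \<longleftrightarrow> (0 \<le> a \<longrightarrow> b \<le> l \<longrightarrow> a \<le> b \<longrightarrow>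
      ennreal \<bar>F (c a) - F (c b)\<bar> \<le> (\<integral>\<^sup>+ r \<in> {a..b}. ?G (c r) \<partial>lborel))" for a b
    \<comment> \<open>Bisection: the estimate is additive over adjacent intervals, so it suffices to
      prove it on short intervals around each parameter.\<close>
    have "P 0 l"
    proof (rule Bolzano[of 0 l P])
      show "0 \<le> l" using l by simp
      fix x y z assume xy: "P x y" and yz: "P y z" and le: "x \<le> y" "y \<le> z"
      show "P x z"
        unfolding P_def
      proof (intro impI)
        assume "0 \<le> x" "z \<le> l" "x \<le> z"
        have "ennreal \<bar>F (c x) - F (c z)\<bar> \<le> ennreal \<bar>F (c x) - F (c y)\<bar> + ennreal \<bar>F (c y) - F (c z)\<bar>"
          unfolding ennreal_plus[OF abs_ge_zero abs_ge_zero, symmetric] by (intro ennreal_leI) linarith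
        also have "\<dots> \<le> (\<integral>\<^sup>+ r \<in> {x..y}. ?G (c r) \<partial>lborel) + (\<integral>\<^sup>+ r \<in> {y..z}. ?G (c r) \<partial>lborel)"
          using xy yz le \<open>0 \<le> x\<close> \<open>z \<le> l\<close> unfolding P_def by (intro add_mono) auto
        also have "\<dots> = (\<integral>\<^sup>+ r \<in> {x..z}. ?G (c r) \<partial>lborel)"
          by (rule nn_integral_Icc_add[OF comp[OF Gm] le])
        finally show "ennreal \<bar>F (c x) - F (c z)\<bar> \<le> (\<integral>\<^sup>+ r \<in> {x..z}. ?G (c r) \<partial>lborel)" .
      qed
    next
      fix x assume "0 \<le> x" "x \<le> l"
      obtain N J where N: "open N" "c x \<in> N" and J: "finite J" "card J \<le> 4" "\<And>j. j \<in> J \<Longrightarrow> N \<subseteq> U j"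
        and one: "\<And>z. z \<in> N \<Longrightarrow> (\<Sum>j\<in>J. \<phi> j z) = 1"
        and F: "\<And>z. z \<in> N \<Longrightarrow> F z = (\<Sum>j\<in>J. \<phi> j z * A j z)"
        using loc[OF cO[of x]] by blast
      obtain d1 where d1: "d1 > 0" "ball (c x) d1 \<subseteq> N" using N open_contains_ball by blast
      have "J \<noteq> {}" using one[OF N(2)] by auto
      then have "Max (K ` J) \<in> K ` J" using J(1) by simp
      \<comment> \<open>The reference index has the largest Lipschitz constant of the at most four.
        Hence S \<le> 4 * \<open>K m\<close>, and the error of \<open>A m\<close> can be charged to
        the term with its own factor \<open>K m\<close>.\<close>
      then obtain m where m: "m \<in> J" "\<And>j. j \<in> J \<Longrightarrow> K j \<le> K m"
        using Max_ge[of "K ` J"] J(1) by force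
      define S where "S = (\<Sum>j\<in>J. K j)"
      have S: "0 \<le> S" unfolding S_def using K by (intro sum_nonneg) auto
      \<comment> \<open>The bound \<open>d1\<close> keeps the arc in N because c is 1-Lipschitz; the
        other one yields S * \<delta> \<le> 1.\<close>
      define d where "d = min d1 (1 / (1 + S))"
      have d: "0 < d" using d1 S by (auto simp: d_def)
      have "P a b" if ab: "a \<le> x" "x \<le> b" "b - a < d" for a b
        unfolding P_def
      proof (intro impI)
        assume bounds: "0 \<le> a" "b \<le> l" "a \<le> b"
        define \<delta> where "\<delta> = b - a"
        have \<delta>: "0 \<le> \<delta>" using bounds by (simp add: \<delta>_def)
        have "S * \<delta> \<le> S * (1 / (1 + S))" using ab S by (intro mult_left_mono) (auto simp: \<delta>_def d_def)
        also have "\<dots> \<le> 1" using S by simp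
        finally have S\<delta>: "S * \<delta> \<le> 1" .
        have inN: "c r \<in> N" if "r \<in> {a..b}" for r
        proof -
          have "dist (c x) (c r) < d1" using c_lip[of x r] that ab by (auto simp: d_def)
          then show ?thesis using d1 by auto
        qed
        define I where "I j = (\<integral>\<^sup>+ r \<in> {a..b}. s j (c r) \<partial>lborel)" for j
        define E where "E j = (\<integral>\<^sup>+ r \<in> {a..b}. D j (c r) \<partial>lborel)" for j
        have sub: "ennreal \<bar>A j (c r) - A j (c t)\<bar> \<le> I j" if "a \<le> r" "r \<le> t" "t \<le> b" for j r t
          using test_arcD[OF c ug[of j], of r t] nn_integral_Icc_mono[of a r t b "\<lambda>r. s j (c r)"] that bounds
          unfolding I_def by fastforce
        \<comment> \<open>The difference at the end point c b is compared with the one at every c r,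
          passing through B there, and then integrated over r. Moving from c r to c b costs the
          increments \<open>I j\<close> and \<open>I m\<close>; the factor \<delta> on the left is
          the one that the Lipschitz bound of \<phi> will supply.\<close>
        have osc: "ennreal \<delta> * ennreal \<bar>A j (c b) - A m (c b)\<bar> \<le> ennreal \<delta> * (I j + I m) + (E j + E m)" 
          if j: "j \<in> J" for j
        proof -
          have "ennreal \<delta> * ennreal \<bar>A j (c b) - A m (c b)\<bar> = 
              (\<integral>\<^sup>+ r \<in> {a..b}. ennreal \<bar>A j (c b) - A m (c b)\<bar> \<partial>lborel)"
            using bounds by (subst nn_integral_cmult_indicator) (auto simp: \<delta>_def mult.commute)
          also have "\<dots> \<le> (\<integral>\<^sup>+ r. (I j + I m) * indicator {a..b} r +
              (D j (c r) * indicator {a..b} r + D m (c r) * indicator {a..b} r) \<partial>lborel)"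
          proof (rule nn_integral_mono)
            fix r
            show "ennreal \<bar>A j (c b) - A m (c b)\<bar> * indicator {a..b} r \<le> (I j + I m) * indicator {a..b} r +
              (D j (c r) * indicator {a..b} r + D m (c r) * indicator {a..b} r)"
            proof (cases "r \<in> {a..b}")
              case True
              then have U: "c r \<in> U j" "c r \<in> U m" using inN[OF True] J(3) j m by auto
              have "ennreal \<bar>A j (c b) - A m (c b)\<bar> \<le>
                  ennreal (\<bar>A j (c r) - A j (c b)\<bar> + \<bar>A m (c r) - A m (c b)\<bar> +
                   (\<bar>A j (c r) - B (c r)\<bar> + \<bar>A m (c r) - B (c r)\<bar>))"
                by (intro ennreal_leI) linarith
              also have "\<dots> = ennreal \<bar>A j (c r) - A j (c b)\<bar> + ennreal \<bar>A m (c r) - A m (c b)\<bar> +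
                   (ennreal \<bar>A j (c r) - B (c r)\<bar> + ennreal \<bar>A m (c r) - B (c r)\<bar>)"
                by (simp add: ennreal_plus)
              also have "\<dots> \<le> I j + I m + (D j (c r) + D m (c r))"
                using True U by (intro add_mono sub D(2)) auto
              finally show ?thesis using True by simp
            qed simp
          qed
          also have "\<dots> = ennreal \<delta> * (I j + I m) + (E j + E m)"
            using comp[OF D(1)[of j]] comp[OF D(1)[of m]] bounds
            by (simp add: nn_integral_add nn_integral_cmult_indicator E_def \<delta>_def)
               (simp add: mult.commute)
          finally show ?thesis .
        qed
        have small: "K j * \<delta> \<le> 1" if "j \<in> J" for j
        proof -
          have "K j \<le> S" unfolding S_def using that J(1) K by (intro member_le_sum) auto
          then show ?thesis using S\<delta> \<delta> by (meson mult_right_mono order.trans)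
        qed
        \<comment> \<open>The weights sum to 1 at both ends, so their increments sum to 0 and the
          common value \<open>A m (c b)\<close> may be subtracted.\<close>
        have eq: "F (c a) - F (c b) = (\<Sum>j\<in>J. \<phi> j (c a) * (A j (c a) - A j (c b))) +
            (\<Sum>j\<in>J. (\<phi> j (c a) - \<phi> j (c b)) * (A j (c b) - A m (c b)))"
        proof -
          have "c a \<in> N" "c b \<in> N" using inN bounds by auto
          then have "(\<Sum>j\<in>J. (\<phi> j (c a) - \<phi> j (c b)) * A m (c b)) = 0"
            using one by (simp add: sum_distrib_right[symmetric] sum_subtractf)
          then show ?thesis
            using F[OF \<open>c a \<in> N\<close>] F[OF \<open>c b \<in> N\<close>]
            by (simp add: right_diff_distrib left_diff_distrib sum_subtractf)
        qed
        have "\<bar>F (c a) - F (c b)\<bar> \<le> (\<Sum>j\<in>J. \<bar>\<phi> j (c a) * (A j (c a) - A j (c b))\<bar>) +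
            (\<Sum>j\<in>J. \<bar>(\<phi> j (c a) - \<phi> j (c b)) * (A j (c b) - A m (c b))\<bar>)"
          unfolding eq by (rule order.trans[OF abs_triangle_ineq add_mono[OF sum_abs sum_abs]])
        also have "\<dots> \<le> (\<Sum>j\<in>J. \<bar>A j (c a) - A j (c b)\<bar>) + (\<Sum>j\<in>J. K j * (\<delta> * \<bar>A j (c b) - A m (c b)\<bar>))"
        proof (intro add_mono sum_mono)
          fix j assume j: "j \<in> J"
          have "\<phi> j (c a) \<le> (\<Sum>i\<in>J. \<phi> i (c a))"
            by (rule member_le_sum[OF j \<phi>(1) J(1)])
          moreover have "c a \<in> N" by (rule inN) (use bounds in simp)
          ultimately have le1: "\<phi> j (c a) \<le> 1" using one[of "c a"] by linarith
          show "\<bar>\<phi> j (c a) * (A j (c a) - A j (c b))\<bar> \<le> \<bar>A j (c a) - A j (c b)\<bar>"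
            using mult_left_le_one_le[OF abs_ge_zero \<phi>(1)[of j "c a"] le1] \<phi>(1)[of j "c a"]
            by (simp add: abs_mult)
          have "\<bar>\<phi> j (c a) - \<phi> j (c b)\<bar> \<le> K j * dist (c a) (c b)" by (rule \<phi>(2))
          also have "\<dots> \<le> K j * \<delta>" using c_lip[of a b] K bounds by (intro mult_left_mono) (auto simp: \<delta>_def)
          finally show "\<bar>(\<phi> j (c a) - \<phi> j (c b)) * (A j (c b) - A m (c b))\<bar> \<le> K j * (\<delta> * \<bar>A j (c b) - A m (c b)\<bar>)"
            by (simp add: abs_mult mult.assoc[symmetric] mult_right_mono)
        qed
        finally have abs_le: "ennreal \<bar>F (c a) - F (c b)\<bar> \<le> 
            ennreal ((\<Sum>j\<in>J. \<bar>A j (c a) - A j (c b)\<bar>) + (\<Sum>j\<in>J. K j * (\<delta> * \<bar>A j (c b) - A m (c b)\<bar>)))"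
          by (rule ennreal_leI)
        have "(\<Sum>j\<in>J. ennreal (K j) * (ennreal \<delta> * (I j + I m) + (E j + E m))) =
            (\<Sum>j\<in>J. ennreal (K j * \<delta>) * I j) + ennreal (S * \<delta>) * I m + 
             ((\<Sum>j\<in>J. ennreal (K j) * E j) + ennreal S * E m)"
        proof -
          have S1: "ennreal S = (\<Sum>j\<in>J. ennreal (K j))" using K by (simp add: S_def sum_ennreal)
          have 1: "ennreal (K j * \<delta>) = ennreal (K j) * ennreal \<delta>" for j using K \<delta> by (simp add: ennreal_mult)
          have 2: "ennreal (S * \<delta>) = (\<Sum>j\<in>J. ennreal (K j)) * ennreal \<delta>"
            using S \<delta> by (simp only: ennreal_mult S1)
          show ?thesis
            unfolding 1 2 S1
            by (simp add: distrib_left sum.distrib sum_distrib_left ac_simps del: sum_ennreal)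
        qed
        \<comment> \<open>Origin of the constants 3 and 5: S * \<delta> \<le> 1 gives two copies of
          the sum of the I j, besides the one from the first sum below; the error terms appear once
          directly and four times through S \<le> 4 * \<open>K m\<close>.\<close>
        also have "\<dots> \<le> ((\<Sum>j\<in>J. I j) + (\<Sum>j\<in>J. I j)) + 
            ((\<Sum>j\<in>J. ennreal (K j) * E j) + 4 * (\<Sum>j\<in>J. ennreal (K j) * E j))"
        proof (intro add_mono order.refl)
          show "(\<Sum>j\<in>J. ennreal (K j * \<delta>) * I j) \<le> (\<Sum>j\<in>J. I j)"
          proof (rule sum_mono)
            fix j assume "j \<in> J"
            then have "ennreal (K j * \<delta>) * I j \<le> 1 * I j"
              using small by (intro mult_right_mono) (auto simp flip: ennreal_1 intro!: ennreal_leI)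
            then show "ennreal (K j * \<delta>) * I j \<le> I j" by simp
          qed
          have "ennreal (S * \<delta>) * I m \<le> 1 * I m"
            using S\<delta> by (intro mult_right_mono) (auto simp flip: ennreal_1 intro!: ennreal_leI)
          also have "\<dots> \<le> (\<Sum>j\<in>J. I j)" using J(1) m by (simp add: member_le_sum)
          finally show "ennreal (S * \<delta>) * I m \<le> (\<Sum>j\<in>J. I j)" .
          have "S \<le> real (card J) * K m" unfolding S_def using m(2) by (rule sum_bounded_above)
          also have "\<dots> \<le> 4 * K m" using J(2) K by (intro mult_right_mono) auto
          finally have "ennreal S * E m \<le> ennreal (4 * K m) * E m" by (intro mult_right_mono ennreal_leI) auto
          also have "\<dots> = 4 * (ennreal (K m) * E m)" using K by (simp add: ennreal_mult mult.assoc)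
          also have "\<dots> \<le> 4 * (\<Sum>j\<in>J. ennreal (K j) * E j)"
            using J(1) m by (intro mult_left_mono member_le_sum) auto
          finally show "ennreal S * E m \<le> 4 * (\<Sum>j\<in>J. ennreal (K j) * E j)" .
        qed
        finally have rest: "(\<Sum>j\<in>J. ennreal (K j) * (ennreal \<delta> * (I j + I m) + (E j + E m))) \<le>
            ((\<Sum>j\<in>J. I j) + (\<Sum>j\<in>J. I j)) +
            ((\<Sum>j\<in>J. ennreal (K j) * E j) + 4 * (\<Sum>j\<in>J. ennreal (K j) * E j))" .
        have "ennreal \<bar>F (c a) - F (c b)\<bar> \<le>
            ennreal ((\<Sum>j\<in>J. \<bar>A j (c a) - A j (c b)\<bar>) + (\<Sum>j\<in>J. K j * (\<delta> * \<bar>A j (c b) - A m (c b)\<bar>)))"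
          by (rule abs_le)
        also have "\<dots> = (\<Sum>j\<in>J. ennreal \<bar>A j (c a) - A j (c b)\<bar>) +
            (\<Sum>j\<in>J. ennreal (K j) * (ennreal \<delta> * ennreal \<bar>A j (c b) - A m (c b)\<bar>))"
          using K \<delta> by (simp add: ennreal_plus sum_nonneg sum_ennreal ennreal_mult[symmetric])
        also have "\<dots> \<le> (\<Sum>j\<in>J. I j) + (\<Sum>j\<in>J. ennreal (K j) * (ennreal \<delta> * (I j + I m) + (E j + E m)))"
          using bounds by (intro add_mono sum_mono sub mult_left_mono osc) auto
        also have "\<dots> \<le> (\<Sum>j\<in>J. I j) + (((\<Sum>j\<in>J. I j) + (\<Sum>j\<in>J. I j)) +
            ((\<Sum>j\<in>J. ennreal (K j) * E j) + 4 * (\<Sum>j\<in>J. ennreal (K j) * E j)))"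
          by (intro add_left_mono rest)
        also have "\<dots> =
            (\<Sum>j\<in>J. 3 * I j + 5 * (ennreal (K j) * E j))"
        proof -
          have "x + (x + x + (y + 4 * y)) = 3 * x + 5 * y" for x y :: ennreal
          proof -
            have "3 * x = x + x + x" "5 * y = y + 4 * y"
              using distrib_right[of 1 2 x] distrib_right[of 1 4 y] by (simp_all add: mult_2 add.assoc)
            then show ?thesis by (simp add: ac_simps)
          qed
          then show ?thesis by (simp add: sum.distrib flip: sum_distrib_left)
        qed
        also have "\<dots> = (\<Sum>j\<in>J. \<integral>\<^sup>+ r. 3 * (s j (c r) * indicator {a..b} r) +
            5 * (ennreal (K j) * (D j (c r) * indicator {a..b} r)) \<partial>lborel)"
          using comp[OF sm] comp[OF D(1)]
          by (intro sum.cong refl) (simp add: I_def E_def nn_integral_add nn_integral_cmult)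
        also have "\<dots> = (\<integral>\<^sup>+ r. (\<Sum>j\<in>J. 3 * (s j (c r) * indicator {a..b} r) +
            5 * (ennreal (K j) * (D j (c r) * indicator {a..b} r))) \<partial>lborel)"
          using comp[OF sm] comp[OF D(1)] by (intro nn_integral_sum[symmetric]) simp
        also have "\<dots> \<le> (\<integral>\<^sup>+ r \<in> {a..b}. ?G (c r) \<partial>lborel)"
        proof (rule nn_integral_mono)
          fix r
          show "(\<Sum>j\<in>J. 3 * (s j (c r) * indicator {a..b} r) + 5 * (ennreal (K j) * (D j (c r) * indicator {a..b} r)))
              \<le> ?G (c r) * indicator {a..b} r"
          proof (cases "r \<in> {a..b}")
            case True
            then have "(\<Sum>j\<in>J. 3 * (s j (c r) * indicator {a..b} r) + 5 * (ennreal (K j) * (D j (c r) * indicator {a..b} r)))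
              = (\<Sum>j\<in>J. indicator (U j) (c r) * (3 * s j (c r) + 5 * (ennreal (K j) * D j (c r))))"
              using J(3) inN[OF True] by (intro sum.cong) (auto simp: indicator_def)
            also have "\<dots> \<le> ?G (c r)" using J(1) by (intro sum_le_suminf) auto
            finally show ?thesis using True by simp
          qed simp
        qed
        finally show "ennreal \<bar>F (c a) - F (c b)\<bar> \<le> (\<integral>\<^sup>+ r \<in> {a..b}. ?G (c r) \<partial>lborel)" .
      qed
      then show "\<exists>d>0. \<forall>a b. a \<le> x \<and> x \<le> b \<and> b - a < d \<longrightarrow> P a b" using d by blast
    qed
    then show "ennreal \<bar>F (c 0) - F (c l)\<bar> \<le> (\<integral>\<^sup>+ r \<in> {0..l}. ?G (c r) \<partial>lborel)"
      using l by (simp add: P_def)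
  qed
qed

section \<open>Slices and their sums\<close>

lemma clip_lipschitz: "\<bar>clip a b x - clip a b y\<bar> \<le> \<bar>x - y\<bar>"
  by (auto simp: clip_def)

lemma slice_lipschitz: "\<bar>slice k x - slice k y\<bar> \<le> 2 * \<bar>x - y\<bar>"
  using clip_lipschitz[of "real k" "real k + 1" x y] clip_lipschitz[of "- (real k + 1)" "- real k" x y]
    abs_diff_triangle_ineq[of "clip (real k) (real k + 1) x" "clip (- (real k + 1)) (- real k) x"
      "clip (real k) (real k + 1) y" "clip (- (real k + 1)) (- real k) y"]
  unfolding slice_def by simp

lemma slice_diff_le: "\<bar>slice k x - slice k y\<bar> \<le> 2"
  unfolding slice_def clip_def by (auto simp: max_def min_def)

lemma sum_slice: "(\<Sum>k<n. slice k x) = clip (- real n) (real n) x"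
  by (induction n) (auto simp: slice_def clip_def max_def min_def)

lemma abs_slice: "\<bar>slice k x\<bar> = slice k \<bar>x\<bar>"
  by (auto simp: slice_def clip_def max_def min_def abs_if)

lemma slice_sums: "(\<lambda>k. slice k x) sums x"
proof -
  have "\<forall>\<^sub>F n in sequentially. (\<Sum>k<n. slice k x) = x"
    using eventually_ge_at_top[of "nat \<lceil>\<bar>x\<bar>\<rceil>"]
  proof eventually_elim
    case (elim n)
    then have "\<bar>x\<bar> \<le> real n" by linarith
    then show ?case by (auto simp: sum_slice clip_def)
  qed
  then show ?thesis unfolding sums_def by (rule tendsto_eventually)
qed

text \<open>All slices of x have the sign of x, so nothing is lost by taking absolute
  values.\<close>

lemma suminf_ennreal_abs_slice: "(\<Sum>k. ennreal \<bar>slice k x\<bar>) = ennreal \<bar>x\<bar>"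
  using slice_sums[of "\<bar>x\<bar>"] by (intro suminf_ennreal_eq) (auto simp flip: abs_slice)

lemma slice_measurable [measurable]: "slice k \<in> borel_measurable borel"
  unfolding slice_def[abs_def] clip_def by measurable

text \<open>This replaces Jensen's inequality: some term satisfies \<open>t \<le> 2 ^ (k + 2) * b k\<close>.\<close>

lemma pigeonhole_powr:
  fixes b :: "nat \<Rightarrow> real"
  assumes b: "\<And>k. 0 \<le> b k" "\<And>k. b k \<le> 2" and q: "1 \<le> q" and t: "0 \<le> t" "ennreal t \<le> (\<Sum>k. ennreal (b k))"
  shows "ennreal (t powr q) \<le> (\<Sum>k. ennreal (2 powr ((real k + 3) * q)) * ennreal (b k))"
proof -
  have "\<exists>k. t \<le> 2 ^ (k + 2) * b k"
  proof (rule ccontr)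
    assume "\<not> ?thesis"
    \<comment> \<open>These bounds form a geometric series with sum t / 2, which is too small unless
      t = 0; the strict bound at k = 0 excludes that case.\<close>
    then have less: "b k < t / 4 * (1 / 2) ^ k" for k by (auto simp: not_le field_simps power_add power_one_over)
    have "(\<lambda>k. t / 4 * (1 / 2) ^ k) sums (t / 4 * (1 / (1 - 1 / 2)))"
      by (intro sums_mult geometric_sums) auto
    then have "(\<Sum>k. ennreal (t / 4 * (1 / 2) ^ k)) = ennreal (t / 2)"
      using t by (intro suminf_ennreal_eq) auto
    moreover have "(\<Sum>k. ennreal (b k)) \<le> (\<Sum>k. ennreal (t / 4 * (1 / 2) ^ k))"
      using less by (intro suminf_le ennreal_leI less_imp_le) auto
    ultimately have "ennreal t \<le> ennreal (t / 2)" using t(2) by (metis order.trans)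
    moreover have "0 \<le> t / 2" using t by simp
    ultimately have "t \<le> t / 2" using ennreal_le_iff by blast
    then have "t = 0" using t by simp
    then show False using less[of 0] b(1)[of 0] by simp
  qed
  then obtain k where k: "t \<le> 2 ^ (k + 2) * b k" by blast
  \<comment> \<open>Normalising by the bound 2 gives a number at most 1, whose q-th power is at most
    itself. This costs 2 powr q and turns the exponent k + 2 into k + 3.\<close>
  have "b k powr q = (2 * (b k / 2)) powr q" by simp
  also have "\<dots> = 2 powr q * (b k / 2) powr q" using b(1)[of k] by (subst powr_mult) auto
  also have "\<dots> \<le> 2 powr q * (b k / 2) powr 1"
    using b[of k] q by (intro mult_left_mono powr_mono') auto
  also have "\<dots> \<le> 2 powr q * b k" using b(1)[of k] by (intro mult_left_mono) (auto simp: powr_one')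
  finally have bq: "b k powr q \<le> 2 powr q * b k" .
  have "t powr q \<le> (2 ^ (k + 2) * b k) powr q" using k t q by (intro powr_mono2) auto
  also have "\<dots> = (2 powr (real k + 2)) powr q * b k powr q"
    using b(1)[of k] by (subst powr_mult) (auto simp: powr_realpow[symmetric] powr_add mult.commute)
  also have "\<dots> \<le> (2 powr (real k + 2)) powr q * (2 powr q * b k)" by (intro mult_left_mono bq) auto
  also have "\<dots> = 2 powr ((real k + 3) * q) * b k"
    by (simp add: powr_powr powr_add[symmetric] mult.assoc[symmetric] algebra_simps)
  finally have "ennreal (t powr q) \<le> ennreal (2 powr ((real k + 3) * q)) * ennreal (b k)"
    using b(1)[of k] by (simp add: ennreal_mult[symmetric] ennreal_leI)
  also have "\<dots> \<le> (\<Sum>k. ennreal (2 powr ((real k + 3) * q)) * ennreal (b k))"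
    using sum_le_suminf[of "\<lambda>k. ennreal (2 powr ((real k + 3) * q)) * ennreal (b k)" "{k}"] by simp
  finally show ?thesis .
qed

section \<open>Sums of limits inferior and series of functions\<close>

text \<open>Fatou's lemma for the counting measure.\<close>

lemma suminf_liminf_le:
  fixes f :: "nat \<Rightarrow> nat \<Rightarrow> ennreal"
  shows "(\<Sum>k. liminf (\<lambda>i. f i k)) \<le> liminf (\<lambda>i. \<Sum>k. f i k)"
  using nn_integral_liminf[of "\<lambda>i. f i" "count_space UNIV"]
  by (simp add: nn_integral_count_space_nat)

lemma ennreal_abs_suminf_le:
  fixes f :: "nat \<Rightarrow> real"
  shows "ennreal \<bar>\<Sum>k. f k\<bar> \<le> (\<Sum>k. ennreal \<bar>f k\<bar>)"
proof (cases "(\<Sum>k. ennreal \<bar>f k\<bar>) = \<infinity>")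
  case False
  then have s: "summable (\<lambda>k. \<bar>f k\<bar>)" by (intro summable_suminf_not_top) auto
  then have "ennreal \<bar>\<Sum>k. f k\<bar> \<le> ennreal (\<Sum>k. \<bar>f k\<bar>)" by (intro ennreal_leI summable_rabs)
  also have "\<dots> = (\<Sum>k. ennreal \<bar>f k\<bar>)" using s by (simp add: suminf_ennreal2)
  finally show ?thesis .
qed simp

text \<open>
  Adding \<open>S\<close> takes care of the curves on which the series diverges everywhere.
\<close>

lemma real_upper_gradient_suminf:
  fixes F :: "nat \<Rightarrow> 'a::metric_space \<Rightarrow> real"
  assumes ug: "\<And>k. real_upper_gradient \<Omega> (F k) (G k)"
    and S: "S \<in> borel_measurable borel" "\<And>x. x \<in> \<Omega> \<Longrightarrow> (\<Sum>k. ennreal \<bar>F k x\<bar>) \<le> S x"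
  shows "real_upper_gradient \<Omega> (\<lambda>x. \<Sum>k. F k x) (\<lambda>x. S x + (\<Sum>k. G k x))" (is "real_upper_gradient \<Omega> _ ?G")
proof -
  have Gk [measurable]: "G k \<in> borel_measurable borel" for k using ug by (simp add: real_upper_gradient_def)
  note S(1) [measurable]
  have Gm: "?G \<in> borel_measurable borel" by measurable
  show ?thesis
  proof (rule real_upper_gradientI[OF Gm])
    fix c l assume c: "test_arc \<Omega> c l"
    note comp = test_arc_measurable_comp[OF c]
    have l: "0 < l" and cO: "c r \<in> \<Omega>" for r using c by (auto simp: test_arc_def)
    let ?I = "\<lambda>g. \<integral>\<^sup>+ r \<in> {0..l}. g (c r) \<partial>lborel"
    have split: "?I ?G = ?I S + (\<Sum>k. ?I (G k))"
    proof -
      have "?I ?G = (\<integral>\<^sup>+ r. S (c r) * indicator {0..l} r + (\<Sum>k. G k (c r) * indicator {0..l} r) \<partial>lborel)"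
        by (intro nn_integral_cong) (auto simp: indicator_def)
      also have "\<dots> = ?I S + (\<integral>\<^sup>+ r. (\<Sum>k. G k (c r) * indicator {0..l} r) \<partial>lborel)"
        using comp[OF S(1)] comp[OF Gk] by (intro nn_integral_add) auto
      also have "(\<integral>\<^sup>+ r. (\<Sum>k. G k (c r) * indicator {0..l} r) \<partial>lborel) = (\<Sum>k. ?I (G k))"
        using comp[OF Gk] by (intro nn_integral_suminf) auto
      finally show ?thesis .
    qed
    show "ennreal \<bar>(\<Sum>k. F k (c 0)) - (\<Sum>k. F k (c l))\<bar> \<le> ?I ?G"
    proof (cases "?I ?G = \<infinity>")
      case False
      then have fin: "?I S \<noteq> \<infinity>" "(\<Sum>k. ?I (G k)) \<noteq> \<infinity>" unfolding split by auto
      \<comment> \<open>A function equal to \<infinity> on an interval of positive length has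
        infinite integral, so the series converges absolutely somewhere on the arc.\<close>
      have "\<exists>r\<in>{0..l}. S (c r) \<noteq> \<infinity>"
      proof (rule ccontr)
        assume "\<not> ?thesis"
        then have "?I S = (\<integral>\<^sup>+ r. \<infinity> * indicator {0..l} r \<partial>lborel)"
          by (intro nn_integral_cong) (auto simp: indicator_def)
        also have "\<dots> = \<infinity> * emeasure lborel {0..l}" by (subst nn_integral_cmult_indicator) auto
        also have "\<dots> = \<infinity>" using l by (simp add: ennreal_top_mult)
        finally show False using fin by simp
      qed
      then obtain r0 where r0: "r0 \<in> {0..l}" "S (c r0) \<noteq> \<infinity>" by blast
      have osc: "ennreal \<bar>F k (c r) - F k (c t)\<bar> \<le> ?I (G k)" if "0 \<le> r" "r \<le> t" "t \<le> l" for k r t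
        using test_arcD[OF c ug[of k] that] nn_integral_Icc_mono[of 0 r t l "\<lambda>r. G k (c r)"] that
        by (meson order.trans)
      \<comment> \<open>Absolute convergence spreads from \<open>r0\<close> along the whole arc: the
        k-th term changes by at most the k-th integral, and these are summable.\<close>
      have sm: "summable (\<lambda>k. \<bar>F k (c r)\<bar>)" if r: "r \<in> {0..l}" for r
      proof -
        have "(\<Sum>k. ennreal \<bar>F k (c r)\<bar>) \<le> (\<Sum>k. ennreal \<bar>F k (c r0)\<bar> + ?I (G k))"
        proof (intro suminf_le allI)
          fix k
          have "ennreal \<bar>F k (c r)\<bar> \<le> ennreal (\<bar>F k (c r0)\<bar> + \<bar>F k (c r) - F k (c r0)\<bar>)"
            by (intro ennreal_leI) linarith
          also have "\<dots> = ennreal \<bar>F k (c r0)\<bar> + ennreal \<bar>F k (c r) - F k (c r0)\<bar>" by simp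
          also have "ennreal \<bar>F k (c r) - F k (c r0)\<bar> \<le> ?I (G k)"
            using osc[of r r0 k] osc[of r0 r k] r r0(1) by (cases "r \<le> r0") (auto simp: abs_minus_commute)
          finally show "ennreal \<bar>F k (c r)\<bar> \<le> ennreal \<bar>F k (c r0)\<bar> + ?I (G k)" by (simp add: add_left_mono)
        qed auto
        also have "\<dots> = (\<Sum>k. ennreal \<bar>F k (c r0)\<bar>) + (\<Sum>k. ?I (G k))"
          by (intro suminf_add[symmetric]) auto
        also have "\<dots> < \<infinity>"
          using S(2)[OF cO[of r0]] r0(2) fin(2) by (auto simp: top.not_eq_extremum intro: le_less_trans)
        finally show ?thesis by (intro summable_suminf_not_top) auto
      qed
      have "(\<Sum>k. F k (c 0)) - (\<Sum>k. F k (c l)) = (\<Sum>k. F k (c 0) - F k (c l))"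
        using sm[of 0] sm[of l] l by (intro suminf_diff) (auto intro: summable_rabs_cancel)
      then have "ennreal \<bar>(\<Sum>k. F k (c 0)) - (\<Sum>k. F k (c l))\<bar> \<le> (\<Sum>k. ennreal \<bar>F k (c 0) - F k (c l)\<bar>)"
        using ennreal_abs_suminf_le by simp
      also have "\<dots> \<le> (\<Sum>k. ?I (G k))" using osc l by (intro suminf_le) auto
      also have "\<dots> \<le> ?I ?G" unfolding split by simp
      finally show ?thesis .
    qed simp
  qed
qed

section \<open>A Whitney type partition of unity\<close>

context doubling_space
begin

text \<open>The layers are dyadic level sets of the exhaustion function \<rho>. The cut-off \<eta> j
  rises from 0 at \<rho> = 1 / 2 ^ j to 1 at \<rho> = 2 / 2 ^ j, and the differences of consecutive
  cut-offs telescope to 1 because \<eta> 0 vanishes (\<rho> \<le> 1).\<close>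

lemma whitney_partition:
  fixes \<Omega> :: "'a set"
  assumes "open \<Omega>"
  obtains U :: "nat \<Rightarrow> 'a set" and \<phi> :: "nat \<Rightarrow> 'a \<Rightarrow> real" where
    "\<And>j. open (U j)" "\<And>j. U j \<Subset> \<Omega>" "\<And>x. finite {j. x \<in> U j}" "\<And>x. card {j. x \<in> U j} \<le> 4"
    "\<And>j x y. y \<in> U j \<Longrightarrow> x \<notin> \<Omega> \<Longrightarrow> 1 / 2 ^ (j + 2) < dist x y"
    "\<And>j x. 0 \<le> \<phi> j x" "\<And>j x y. \<bar>\<phi> j x - \<phi> j y\<bar> \<le> 2 ^ (j + 2) * dist x y"
    "\<And>j x. x \<notin> U j \<Longrightarrow> \<phi> j x = 0"
    "\<And>y. y \<in> \<Omega> \<Longrightarrow> \<exists>N J. open N \<and> y \<in> N \<and> finite J \<and> card J \<le> 4 \<and> (\<forall>j\<in>J. N \<subseteq> U j) \<and>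
        (\<forall>x\<in>N. (\<Sum>j\<in>J. \<phi> j x) = 1 \<and> (\<forall>j. j \<notin> J \<longrightarrow> \<phi> j x = 0))"
proof -
  obtain \<rho> :: "'a \<Rightarrow> real" where lip: "\<And>x y. \<bar>\<rho> x - \<rho> y\<bar> \<le> dist x y" and \<rho>: "\<And>x. 0 \<le> \<rho> x" "\<And>x. \<rho> x \<le> 1"
    "\<And>x. 0 < \<rho> x \<longleftrightarrow> x \<in> \<Omega>" "\<And>s. 0 < s \<Longrightarrow> compact {x. s \<le> \<rho> x}"
    by (rule exhaustion_function[OF assms]) blast
  have cont: "continuous_on UNIV \<rho>"
    unfolding continuous_on_iff dist_real_def using lip by (meson UNIV_I order.strict_trans1)
  \<comment> \<open>\<phi> j is nonzero only for 1 / 2 ^ (j + 1) < \<rho> < 2 / 2 ^ j; the layer is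
    wider by a factor 2 on either side, which leaves room for a common neighbourhood N.\<close>
  define U where "U j = {x. 1 / 2 ^ (j + 2) < \<rho> x \<and> \<rho> x < 4 / 2 ^ j}" for j :: nat
  define \<eta> where "\<eta> j x = clip 0 1 (2 ^ j * \<rho> x - 1)" for j :: nat and x
  define \<phi> where "\<phi> j x = \<eta> (Suc j) x - \<eta> j x" for j x
  have openI: "open {x. a < \<rho> x \<and> \<rho> x < b}" for a b
    using open_Collect_conj[OF open_Collect_less[OF continuous_on_const cont] open_Collect_less[OF cont continuous_on_const]] .
  have U: "open (U j)" for j unfolding U_def by (rule openI)
  have cptU: "U j \<Subset> \<Omega>" for j
  proof -
    let ?K = "{x. 1 / 2 ^ (j + 2) \<le> \<rho> x}"
    have K: "compact ?K" by (rule \<rho>(4)) simp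
    have "closure (U j) \<subseteq> ?K"
      using compact_imp_closed[OF K] by (intro closure_minimal) (auto simp: U_def)
    moreover have "?K \<subseteq> \<Omega>"
    proof
      fix x assume "x \<in> ?K"
      moreover have "0 < 1 / (2 ^ (j + 2) :: real)" by simp
      ultimately have "0 < \<rho> x" by (metis (mono_tags) mem_Collect_eq order.strict_trans2)
      then show "x \<in> \<Omega>" using \<rho>(3) by simp
    qed
    moreover have "compact (?K \<inter> closure (U j))" using K by (rule compact_Int_closed) simp
    ultimately show ?thesis unfolding compactly_inside_def by (simp add: Int_absorb1)
  qed
  \<comment> \<open>Hence the layers through one point have indices among i, ..., i + 3, where i is
    the least one: the overlap is at most 4.\<close>
  have near: "j < i + 4" if "x \<in> U i" "x \<in> U j" for x i j
  proof -
    have "1 / 2 ^ (i + 2) < (4 :: real) / 2 ^ j" using that by (auto simp: U_def)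
    then have "(2 :: real) ^ j < 2 ^ (i + 4)" by (simp add: field_simps power_add)
    then show ?thesis by simp
  qed
  have overlap: "finite {j. x \<in> U j} \<and> card {j. x \<in> U j} \<le> 4" for x
  proof (cases "{j. x \<in> U j} = {}")
    case True
    then show ?thesis by simp
  next
    case False
    then obtain i where i: "x \<in> U i" "\<And>j. x \<in> U j \<Longrightarrow> i \<le> j"
      by (metis (mono_tags) LeastI_ex Least_le empty_Collect_eq)
    have "{j. x \<in> U j} \<subseteq> {i..<i + 4}" using near[OF i(1)] i(2) by auto
    then show ?thesis using card_mono[of "{i..<i + 4}" "{j. x \<in> U j}"] finite_subset by fastforce
  qed
  have \<eta>mono: "\<eta> j x \<le> \<eta> (Suc j) x" for j x
  proof -
    have le: "2 ^ j * \<rho> x \<le> 2 ^ Suc j * \<rho> x" using \<rho>(1)[of x] by (intro mult_right_mono) auto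
    show ?thesis
      unfolding \<eta>_def clip_def by (intro max.mono min.mono order.refl diff_right_mono le)
  qed
  have \<eta>lip: "\<bar>\<eta> j x - \<eta> j y\<bar> \<le> 2 ^ j * dist x y" for j x y
  proof -
    have "\<bar>\<eta> j x - \<eta> j y\<bar> \<le> \<bar>(2 ^ j * \<rho> x - 1) - (2 ^ j * \<rho> y - 1)\<bar>" unfolding \<eta>_def by (rule clip_lipschitz)
    also have "\<dots> = 2 ^ j * \<bar>\<rho> x - \<rho> y\<bar>" by (simp add: abs_mult flip: right_diff_distrib)
    also have "\<dots> \<le> 2 ^ j * dist x y" using lip by (intro mult_left_mono) auto
    finally show ?thesis .
  qed
  have \<phi>lip: "\<bar>\<phi> j x - \<phi> j y\<bar> \<le> 2 ^ (j + 2) * dist x y" for j x y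
  proof -
    have "\<bar>\<phi> j x - \<phi> j y\<bar> \<le> 2 ^ Suc j * dist x y + 2 ^ j * dist x y"
      using \<eta>lip[of "Suc j" x y] \<eta>lip[of j x y] unfolding \<phi>_def by linarith
    also have "\<dots> \<le> 2 ^ (j + 2) * dist x y" by (simp add: power_add)
    finally show ?thesis .
  qed
  have supp: "1 / 2 ^ (j + 1) < \<rho> x \<and> \<rho> x < 2 / 2 ^ j" if "\<phi> j x \<noteq> 0" for j x
  proof (rule ccontr)
    assume "\<not> ?thesis"
    then consider "2 ^ Suc j * \<rho> x \<le> 1" | "2 \<le> 2 ^ j * \<rho> x" by (auto simp: field_simps not_less)
    then have "\<phi> j x = 0"
    proof cases
      case 1
      then show ?thesis using \<rho>(1)[of x] by (auto simp: \<phi>_def \<eta>_def clip_def)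
    next
      case 2
      then show ?thesis by (auto simp: \<phi>_def \<eta>_def clip_def)
    qed
    with that show False by simp
  qed
  have loc: "\<exists>N J. open N \<and> y \<in> N \<and> finite J \<and> card J \<le> 4 \<and> (\<forall>j\<in>J. N \<subseteq> U j) \<and>
        (\<forall>x\<in>N. (\<Sum>j\<in>J. \<phi> j x) = 1 \<and> (\<forall>j. j \<notin> J \<longrightarrow> \<phi> j x = 0))" if y: "y \<in> \<Omega>" for y
  proof -
    define r where "r = \<rho> y"
    have r: "0 < r" using y \<rho>(3) by (simp add: r_def)
    \<comment> \<open>Values of \<rho> on N differ by a factor below 25 / 16 < 2, so a layer whose
      \<phi> j is nonzero somewhere on N contains all of N.\<close>
    define N where "N = {x. 4 / 5 * r < \<rho> x \<and> \<rho> x < 5 / 4 * r}"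
    define J where "J = {j. N \<subseteq> U j}"
    have yN: "y \<in> N" using r by (auto simp: N_def r_def)
    have JU: "J \<subseteq> {j. y \<in> U j}" using yN by (auto simp: J_def)
    then have J: "finite J" "card J \<le> 4"
      using overlap[of y] card_mono[of "{j. y \<in> U j}" J] finite_subset by (blast, fastforce)
    have zero: "\<phi> j x = 0" if x: "x \<in> N" and j: "j \<notin> J" for j x
    proof (rule ccontr)
      assume "\<phi> j x \<noteq> 0"
      then have s: "1 / 2 ^ (j + 1) < \<rho> x" "\<rho> x < 2 / 2 ^ j" using supp by auto
      have "N \<subseteq> U j"
      proof
        fix z assume z: "z \<in> N"
        have "1 / 2 ^ (j + 2) = 1 / 2 ^ (j + 1) / (2 :: real)" by (simp add: power_add)
        then have "1 / 2 ^ (j + 2) < \<rho> z" using s(1) x z r unfolding N_def by simp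
        moreover have "4 / 2 ^ j = 2 * (2 / (2 :: real) ^ j)" by simp
        then have "\<rho> z < 4 / 2 ^ j" using s(2) x z r unfolding N_def by simp
        ultimately show "z \<in> U j" by (simp add: U_def)
      qed
      with j show False by (simp add: J_def)
    qed
    have one: "(\<Sum>j\<in>J. \<phi> j x) = 1" if x: "x \<in> N" for x
    proof -
      have \<rho>x: "0 < \<rho> x" using x r by (auto simp: N_def)
      obtain n0 where n0: "2 / \<rho> x < 2 ^ n0" using real_arch_pow[of 2 "2 / \<rho> x"] by auto
      obtain n1 where n1: "J \<subseteq> {..<n1}" using J(1) finite_nat_bounded by blast
      \<comment> \<open>n is beyond all of J and so large that 2 ^ n * \<rho> x \<ge> 2, whence
        \<eta> n x = 1 in the telescoping sum.\<close>
      define n where "n = max n0 n1"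
      have "(2 :: real) ^ n0 \<le> 2 ^ n" by (simp add: n_def)
      then have "2 / \<rho> x < 2 ^ n" using n0 by linarith
      then have "2 \<le> 2 ^ n * \<rho> x" using \<rho>x by (simp add: field_simps)
      then have "\<eta> n x = 1" by (simp add: \<eta>_def clip_def)
      moreover have "\<eta> 0 x = 0" using \<rho>(2)[of x] by (simp add: \<eta>_def clip_def)
      moreover have "(\<Sum>j<n. \<phi> j x) = \<eta> n x - \<eta> 0 x"
        unfolding \<phi>_def by (rule sum_lessThan_telescope)
      moreover have "(\<Sum>j\<in>J. \<phi> j x) = (\<Sum>j<n. \<phi> j x)"
        using n1 zero[OF x] by (intro sum.mono_neutral_left) (auto simp: n_def)
      ultimately show ?thesis by simp
    qed
    have "open N" unfolding N_def by (rule openI)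
    then show ?thesis
      using yN J one zero by (intro exI[of _ N] exI[of _ J]) (auto simp: J_def)
  qed
  have far: "1 / 2 ^ (j + 2) < dist x y" if "y \<in> U j" "x \<notin> \<Omega>" for j x y
  proof -
    have "\<rho> x = 0" using that(2) \<rho>(1)[of x] \<rho>(3)[of x] by auto
    then have "\<rho> y \<le> dist x y" using lip[of x y] \<rho>(1)[of y] by simp
    then show ?thesis using that(1) by (auto simp: U_def)
  qed
  have out: "\<phi> j x = 0" if "x \<notin> U j" for j x
  proof (rule ccontr)
    assume "\<phi> j x \<noteq> 0"
    then have s: "1 / 2 ^ (j + 1) < \<rho> x" "\<rho> x < 2 / 2 ^ j" using supp by auto
    have "1 / 2 ^ (j + 2) < 1 / (2 :: real) ^ (j + 1)" "2 / (2 :: real) ^ j < 4 / 2 ^ j"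
      by (simp_all add: field_simps)
    with s have "x \<in> U j" by (simp add: U_def)
    with that show False by simp
  qed
  show thesis
    by (rule that[of U \<phi>]) (use U cptU overlap far \<phi>lip out loc \<eta>mono in \<open>auto simp: \<phi>_def\<close>)
qed

end

section \<open>Approximation up to the boundary\<close>

lemma suminf_half_powers: "(\<Sum>k. ennreal ((1 / 2) ^ k)) = 2"
proof -
  have "(\<lambda>k. (1 / 2 :: real) ^ k) sums (1 / (1 - 1 / 2))" by (intro geometric_sums) auto
  then have "(\<Sum>k. ennreal ((1 / 2) ^ k)) = ennreal 2" by (intro suminf_ennreal_eq) auto
  then show ?thesis by simp
qed

lemma suminf_mult_ennreal_prod:
  fixes f g :: "nat \<Rightarrow> ennreal"
  shows "(\<Sum>k. \<Sum>j. f k * g j) = (\<Sum>k. f k) * (\<Sum>j. g j)"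
  by (simp add: ennreal_suminf_cmult ennreal_suminf_multc)

text \<open>The open intervals between consecutive integers are disjoint. This is what keeps the
  energies of all slices together comparable to the energy of the whole function.\<close>

lemma suminf_indicator_slices_le:
  "(\<Sum>k. indicator {x. real k < \<bar>f x\<bar> \<and> \<bar>f x\<bar> < real k + 1} x :: ennreal) \<le> 1"
proof (cases "\<exists>k::nat. real k < \<bar>f x\<bar> \<and> \<bar>f x\<bar> < real k + 1")
  case True
  then obtain n :: nat where n: "real n < \<bar>f x\<bar>" "\<bar>f x\<bar> < real n + 1" by blast
  have "k = n" if "real k < \<bar>f x\<bar>" "\<bar>f x\<bar> < real k + 1" for k :: nat
    using that n by linarith
  then have "(\<Sum>k. indicator {x. real k < \<bar>f x\<bar> \<and> \<bar>f x\<bar> < real k + 1} x :: ennreal) =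
      (\<Sum>k\<in>{n}. indicator {x. real k < \<bar>f x\<bar> \<and> \<bar>f x\<bar> < real k + 1} x)"
    by (intro suminf_finite) (auto simp: indicator_def)
  also have "\<dots> = indicator {x. real n < \<bar>f x\<bar> \<and> \<bar>f x\<bar> < real n + 1} x"
    by (simp only: sum.insert finite.emptyI empty_iff not_False_eq_True sum.empty add_0_right)
  also have "\<dots> \<le> 1" by (simp add: indicator_def)
  finally show ?thesis .
next
  case False
  then have "(indicator {x. real k < \<bar>f x\<bar> \<and> \<bar>f x\<bar> < real k + 1} x :: ennreal) = 0" for k
    by (auto simp: indicator_def)
  then show ?thesis by simp
qed

context doubling_space
begin

lemma suminf_nn_integral_overlap_le:
  assumes U: "\<And>j. U j \<in> sets M" "\<And>j. U j \<subseteq> \<Omega>" "\<And>x. finite {j. x \<in> U j}" "\<And>x. card {j. x \<in> U j} \<le> 4"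
    and \<Omega>: "\<Omega> \<in> sets M" and f: "f \<in> borel_measurable M"
  shows "(\<Sum>j::nat. \<integral>\<^sup>+ x \<in> U j. f x \<partial>M) \<le> 4 * (\<integral>\<^sup>+ x \<in> \<Omega>. f x \<partial>M)"
proof -
  have ind: "(\<Sum>j. indicator (U j) x :: ennreal) \<le> 4 * indicator \<Omega> x" for x
  proof -
    have "(\<Sum>j. indicator (U j) x :: ennreal) = (\<Sum>j\<in>{j. x \<in> U j}. indicator (U j) x)"
      using U(3) by (intro suminf_finite) auto
    also have "\<dots> = of_nat (card {j. x \<in> U j})" by simp
    finally have eq: "(\<Sum>j. indicator (U j) x :: ennreal) = of_nat (card {j. x \<in> U j})" .
    show ?thesis
    proof (cases "x \<in> \<Omega>")
      case True
      have "(of_nat (card {j. x \<in> U j}) :: ennreal) \<le> of_nat 4" using U(4)[of x] by (intro of_nat_mono)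
      then show ?thesis unfolding eq using True by simp
    next
      case False
      then have "{j. x \<in> U j} = {}" using U(2) by auto
      then show ?thesis unfolding eq by simp
    qed
  qed
  have "(\<Sum>j. \<integral>\<^sup>+ x \<in> U j. f x \<partial>M) = (\<integral>\<^sup>+ x. (\<Sum>j. f x * indicator (U j) x) \<partial>M)"
    using U(1) f by (intro nn_integral_suminf[symmetric]) auto
  also have "\<dots> \<le> (\<integral>\<^sup>+ x. 4 * (f x * indicator \<Omega> x) \<partial>M)"
  proof (intro nn_integral_mono)
    fix x
    have "(\<Sum>j. f x * indicator (U j) x) \<le> f x * (4 * indicator \<Omega> x)"
      unfolding ennreal_suminf_cmult by (intro mult_left_mono ind) auto
    then show "(\<Sum>j. f x * indicator (U j) x) \<le> 4 * (f x * indicator \<Omega> x)" by (simp add: ac_simps)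
  qed
  also have "\<dots> = 4 * (\<integral>\<^sup>+ x \<in> \<Omega>. f x \<partial>M)" using f \<Omega> by (intro nn_integral_cmult) auto
  finally show ?thesis .
qed

section \<open>Construction of the glued function\<close>

text \<open>The tolerances \<delta> stay free here, to be fixed later by the geometry of the
  boundary. In the last clause only the layers that meet A are charged, because the pointwise error
  at x involves only the layers containing x.\<close>

lemma whitney_approximation:
  fixes W :: "nat \<Rightarrow> 'a \<Rightarrow> real" and u :: "'a \<Rightarrow> real" and \<delta> :: "nat \<Rightarrow> real" and C q :: real
    and U :: "nat \<Rightarrow> 'a set" and \<phi> :: "nat \<Rightarrow> 'a \<Rightarrow> real"
  assumes \<Omega>: "open \<Omega>" and W [measurable]: "\<And>i. W i \<in> borel_measurable M" and u [measurable]: "u \<in> borel_measurable M"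
    and h: "\<And>i. real_upper_gradient \<Omega> (W i) (h i)" "\<And>i. (\<integral>\<^sup>+ x \<in> \<Omega>. h i x \<partial>M) \<le> ennreal C"
    and ui: "(\<integral>\<^sup>+ x \<in> \<Omega>. ennreal \<bar>u x\<bar> \<partial>M) < \<infinity>"
    and conv: "\<And>j. (\<lambda>i. \<integral>\<^sup>+ x \<in> U j. ennreal \<bar>W i x - u x\<bar> \<partial>M) \<longlonglongrightarrow> 0"
    and q: "1 \<le> q" and \<delta>: "\<And>j. 0 < \<delta> j"
    and U: "\<And>j. open (U j)" "\<And>j. U j \<subseteq> \<Omega>" "\<And>x. finite {j. x \<in> U j}" "\<And>x. card {j. x \<in> U j} \<le> 4"
    and \<phi>: "\<And>j x. 0 \<le> \<phi> j x" "\<And>j x y. \<bar>\<phi> j x - \<phi> j y\<bar> \<le> 2 ^ (j + 2) * dist x y"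
      "\<And>j x. x \<notin> U j \<Longrightarrow> \<phi> j x = 0"
    and loc: "\<And>y. y \<in> \<Omega> \<Longrightarrow> \<exists>N J. open N \<and> y \<in> N \<and> finite J \<and> card J \<le> 4 \<and> (\<forall>j\<in>J. N \<subseteq> U j) \<and>
        (\<forall>x\<in>N. (\<Sum>j\<in>J. \<phi> j x) = 1 \<and> (\<forall>j. j \<notin> J \<longrightarrow> \<phi> j x = 0))"
  obtains v g where "v \<in> borel_measurable M" "real_upper_gradient \<Omega> v g" "(\<integral>\<^sup>+ x \<in> \<Omega>. g x \<partial>M) < \<infinity>"
    "(\<integral>\<^sup>+ x \<in> \<Omega>. ennreal \<bar>v x\<bar> \<partial>M) < \<infinity>"
    "\<And>A. A \<in> sets M \<Longrightarrow> A \<subseteq> \<Omega> \<Longrightarrow> (\<integral>\<^sup>+ x \<in> A. ennreal (\<bar>v x - u x\<bar> powr q) \<partial>M)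
        \<le> (\<Sum>j. if A \<inter> U j = {} then 0 else ennreal (\<delta> j))"
proof -
  have \<Omega>M [measurable]: "\<Omega> \<in> sets M" and UM [measurable]: "U j \<in> sets M" for j using \<Omega> U(1) by auto
  have hb: "h i \<in> borel_measurable borel" for i using h(1) by (simp add: real_upper_gradient_def)
  then have hM [measurable]: "h i \<in> borel_measurable M" for i by auto
  have \<phi>M [measurable]: "\<phi> j \<in> borel_measurable M" for j
  proof -
    have "(2 ^ (j + 2))-lipschitz_on UNIV (\<phi> j)"
      using \<phi>(2) by (intro lipschitz_onI) (auto simp: dist_real_def)
    then have "\<phi> j \<in> borel_measurable borel"
      by (intro borel_measurable_continuous_onI lipschitz_on_continuous_on)
    then show ?thesis by auto
  qed
  define Q where "Q i k = {x. real k < \<bar>W i x\<bar> \<and> \<bar>W i x\<bar> < real k + 1}" for i k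
  have "\<forall>i k. \<exists>s. real_upper_gradient \<Omega> (\<lambda>x. slice k (W i x)) s \<and>
      (AE x in M. s x = 2 * (h i x * indicator (Q i k) x) + ennreal ((1 / 2) ^ k) * h i x)"
  proof (intro allI)
    fix i k
    obtain s where "real_upper_gradient \<Omega> (\<lambda>x. slice k (W i x)) s"
      "AE x in M. s x = 2 * (h i x * indicator (Q i k) x) + ennreal ((1 / 2) ^ k) * h i x"
      unfolding Q_def by (rule real_upper_gradient_slice[OF h(1)[of i] W[of i], of "(1 / 2) ^ k" k]) auto
    then show "\<exists>s. real_upper_gradient \<Omega> (\<lambda>x. slice k (W i x)) s \<and>
      (AE x in M. s x = 2 * (h i x * indicator (Q i k) x) + ennreal ((1 / 2) ^ k) * h i x)" by blast
  qed
  then obtain S where S: "\<And>i k. real_upper_gradient \<Omega> (\<lambda>x. slice k (W i x)) (S i k)"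
    "\<And>i k. AE x in M. S i k x = 2 * (h i x * indicator (Q i k) x) + ennreal ((1 / 2) ^ k) * h i x"
    by metis
  have SM [measurable]: "S i k \<in> borel_measurable M" for i k
    using S(1)[of k i] by (auto simp: real_upper_gradient_def)
  \<comment> \<open>At each point at most one slice is active, contributing 2 * h, and the extra
    terms with weights 1 / 2 ^ k add another 2 * h.\<close>
  have Ssum: "(\<integral>\<^sup>+ x \<in> \<Omega>. (\<Sum>k. S i k x) \<partial>M) \<le> ennreal (4 * C)" for i
  proof -
    have "AE x in M. \<forall>k. S i k x = 2 * (h i x * indicator (Q i k) x) + ennreal ((1 / 2) ^ k) * h i x"
      using S(2) by (simp add: AE_all_countable)
    then have "AE x in M. (\<Sum>k. S i k x) * indicator \<Omega> x \<le> 4 * (h i x * indicator \<Omega> x)"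
    proof eventually_elim
      case (elim x)
      have "(\<Sum>k. S i k x) = (\<Sum>k. 2 * (h i x * indicator (Q i k) x) + ennreal ((1 / 2) ^ k) * h i x)"
        using elim by simp
      also have "\<dots> = 2 * (h i x * (\<Sum>k. indicator (Q i k) x)) + (\<Sum>k. ennreal ((1 / 2) ^ k)) * h i x"
        by (subst suminf_add[symmetric]) (auto simp: ennreal_suminf_cmult ennreal_suminf_multc)
      also have "\<dots> \<le> 2 * (h i x * 1) + 2 * h i x"
        unfolding suminf_half_powers Q_def
        by (intro add_mono mult_left_mono suminf_indicator_slices_le order.refl) auto
      also have "\<dots> = 4 * h i x" by (simp add: distrib_right[symmetric])
      finally show ?case by (simp add: indicator_def)
    qed
    then have "(\<integral>\<^sup>+ x \<in> \<Omega>. (\<Sum>k. S i k x) \<partial>M) \<le> (\<integral>\<^sup>+ x. 4 * (h i x * indicator \<Omega> x) \<partial>M)"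
      by (rule nn_integral_mono_AE)
    also have "\<dots> = 4 * (\<integral>\<^sup>+ x \<in> \<Omega>. h i x \<partial>M)" by (intro nn_integral_cmult) measurable
    also have "\<dots> \<le> 4 * ennreal C" by (intro mult_left_mono h(2)) auto
    finally show ?thesis by (simp add: ennreal_mult')
  qed
  define T where "T i k j = (\<integral>\<^sup>+ x \<in> U j. S i k x \<partial>M)" for i k j
  have Tsum: "(\<Sum>k. \<Sum>j. T i k j) \<le> 4 * ennreal (4 * C)" for i
  proof -
    have "(\<Sum>k. \<Sum>j. T i k j) \<le> (\<Sum>k. 4 * (\<integral>\<^sup>+ x \<in> \<Omega>. S i k x \<partial>M))"
      unfolding T_def
      by (intro suminf_le allI suminf_nn_integral_overlap_le[OF UM U(2-4) \<Omega>M]) auto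
    also have "\<dots> = 4 * (\<integral>\<^sup>+ x. (\<Sum>k. S i k x * indicator \<Omega> x) \<partial>M)"
      unfolding ennreal_suminf_cmult by (subst nn_integral_suminf) auto
    also have "\<dots> = 4 * (\<integral>\<^sup>+ x \<in> \<Omega>. (\<Sum>k. S i k x) \<partial>M)"
      by (simp add: ennreal_suminf_multc)
    also have "\<dots> \<le> 4 * ennreal (4 * C)" by (intro mult_left_mono Ssum) auto
    finally show ?thesis .
  qed
  \<comment> \<open>Different pairs need not approach their limit inferior along a common
    subsequence, hence an index for each pair; the sum of the limits is finite by applying Fatou
    over j and then over k.\<close>
  define a where "a k j = liminf (\<lambda>i. T i k j)" for k j
  have asum: "(\<Sum>k. \<Sum>j. a k j) \<le> 4 * ennreal (4 * C)"
  proof -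
    have "(\<Sum>k. \<Sum>j. a k j) \<le> (\<Sum>k. liminf (\<lambda>i. \<Sum>j. T i k j))"
      unfolding a_def by (intro suminf_le allI suminf_liminf_le) auto
    also have "\<dots> \<le> liminf (\<lambda>i. \<Sum>k. \<Sum>j. T i k j)" by (rule suminf_liminf_le)
    also have "\<dots> \<le> liminf (\<lambda>i. 4 * ennreal (4 * C))" by (intro Liminf_mono) (simp add: Tsum)
    finally show ?thesis by (simp add: Liminf_const)
  qed
  have afin: "a k j < \<infinity>" for k j
  proof -
    have "a k j \<le> (\<Sum>j. a k j)" using sum_le_suminf[of "a k" "{j}"] by simp
    also have "\<dots> \<le> (\<Sum>k. \<Sum>j. a k j)" using sum_le_suminf[of "\<lambda>k. \<Sum>j. a k j" "{k}"] by simp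
    also have "\<dots> < \<infinity>" using asum by (rule le_less_trans) (simp add: ennreal_mult_less_top)
    finally show ?thesis .
  qed
  define c where "c k = 2 powr ((real k + 3) * q)" for k
  have c: "0 < c k" for k by (simp add: c_def)
  \<comment> \<open>The first bound serves the energy: 1 / 4 ^ j absorbs the Lipschitz constant 2 ^
    (j + 2) of \<phi> j and still leaves a summable 1 / 2 ^ j. The second serves the q-th power with
    its weight c k; of the 4 there, one factor 2 pays for the Lipschitz constant of
    \<open>slice\<close>, the other makes the weights over k sum to 1.\<close>
  define \<epsilon> where "\<epsilon> k j = min ((1 / 4) ^ j * (1 / 2) ^ k) (\<delta> j * (1 / 2) ^ k / (4 * c k))" for k j
  have \<epsilon>: "0 < \<epsilon> k j" "\<epsilon> k j \<le> (1 / 4) ^ j * (1 / 2) ^ k" "c k * (2 * \<epsilon> k j) \<le> \<delta> j * (1 / 2) ^ k / 2" for k j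
  proof -
    show "0 < \<epsilon> k j" "\<epsilon> k j \<le> (1 / 4) ^ j * (1 / 2) ^ k" using \<delta>[of j] c[of k] by (auto simp: \<epsilon>_def)
    have "c k * (2 * \<epsilon> k j) \<le> c k * (2 * (\<delta> j * (1 / 2) ^ k / (4 * c k)))"
      using c[of k] by (intro mult_left_mono) (auto simp: \<epsilon>_def)
    also have "\<dots> = \<delta> j * (1 / 2) ^ k / 2" using c[of k] by simp
    finally show "c k * (2 * \<epsilon> k j) \<le> \<delta> j * (1 / 2) ^ k / 2" .
  qed
  have "\<forall>k j. \<exists>i. T i k j \<le> a k j + ennreal ((1 / 2) ^ k * (1 / 2) ^ j) \<and>
      (\<integral>\<^sup>+ x \<in> U j. ennreal \<bar>W i x - u x\<bar> \<partial>M) \<le> ennreal (\<epsilon> k j)"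
  proof (intro allI, rule ccontr)
    fix k j
    let ?t = "ennreal ((1 / 2) ^ k * (1 / 2) ^ j)"
    assume no: "\<not> (\<exists>i. T i k j \<le> a k j + ?t \<and> (\<integral>\<^sup>+ x \<in> U j. ennreal \<bar>W i x - u x\<bar> \<partial>M) \<le> ennreal (\<epsilon> k j))"
    have "\<forall>\<^sub>F i in sequentially. (\<integral>\<^sup>+ x \<in> U j. ennreal \<bar>W i x - u x\<bar> \<partial>M) < ennreal (\<epsilon> k j)"
      using conv[of j] \<epsilon>(1)[of k j] by (intro order_tendstoD) auto
    \<comment> \<open>Without a good index, the energies would eventually exceed their finite limit
      inferior by a fixed positive amount.\<close>
    then have "\<forall>\<^sub>F i in sequentially. a k j + ?t \<le> T i k j"
    proof eventually_elim
      case (elim i)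
      then show ?case using no by (meson less_imp_le linear)
    qed
    then have "a k j + ?t \<le> a k j" unfolding a_def by (rule Liminf_bounded)
    moreover have "a k j < a k j + ?t" using afin[of k j]
      by (cases "a k j") (auto simp: ennreal_less_iff simp flip: ennreal_plus)
    ultimately show False by simp
  qed
  then obtain \<iota> where \<iota>: "\<And>k j. T (\<iota> k j) k j \<le> a k j + ennreal ((1 / 2) ^ k * (1 / 2) ^ j)"
    "\<And>k j. (\<integral>\<^sup>+ x \<in> U j. ennreal \<bar>W (\<iota> k j) x - u x\<bar> \<partial>M) \<le> ennreal (\<epsilon> k j)" by metis
  define A where "A k j x = slice k (W (\<iota> k j) x)" for k j x
  have AM [measurable]: "A k j \<in> borel_measurable M" for k j unfolding A_def[abs_def] by measurable
  \<comment> \<open>The gluing lemma needs Borel bounds for the errors at every point, while the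
    slices are measurable only for the completed measure.\<close>
  have ex_D: "\<forall>k j. \<exists>g. g \<in> borel_measurable borel \<and> (\<forall>x. ennreal \<bar>A k j x - slice k (u x)\<bar> \<le> g x) \<and>
      (AE x in M. g x = ennreal \<bar>A k j x - slice k (u x)\<bar>)"
  proof (intro allI)
    fix k j
    have "(\<lambda>x. ennreal \<bar>A k j x - slice k (u x)\<bar>) \<in> borel_measurable M" by measurable
    then obtain g where "g \<in> borel_measurable borel" "\<And>x. ennreal \<bar>A k j x - slice k (u x)\<bar> \<le> g x"
      "AE x in M. g x = ennreal \<bar>A k j x - slice k (u x)\<bar>" by (rule borel_majorant) blast
    then show "\<exists>g. g \<in> borel_measurable borel \<and> (\<forall>x. ennreal \<bar>A k j x - slice k (u x)\<bar> \<le> g x) \<and>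
      (AE x in M. g x = ennreal \<bar>A k j x - slice k (u x)\<bar>)" by blast
  qed
  obtain D where D': "\<forall>k j. D k j \<in> borel_measurable borel \<and> (\<forall>x. ennreal \<bar>A k j x - slice k (u x)\<bar> \<le> D k j x) \<and>
      (AE x in M. D k j x = ennreal \<bar>A k j x - slice k (u x)\<bar>)"
    using ex_D[unfolded choice_iff] by (elim exE)
  have D: "\<And>k j. D k j \<in> borel_measurable borel"
    "\<And>k j x. ennreal \<bar>A k j x - slice k (u x)\<bar> \<le> D k j x"
    "\<And>k j. AE x in M. D k j x = ennreal \<bar>A k j x - slice k (u x)\<bar>"
    using D' by simp_all
  have DM [measurable]: "D k j \<in> borel_measurable M" for k j using D(1) by auto
  have Dint: "(\<integral>\<^sup>+ x \<in> U j. D k j x \<partial>M) \<le> ennreal (2 * \<epsilon> k j)" for k j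
  proof -
    have "(\<integral>\<^sup>+ x \<in> U j. D k j x \<partial>M) \<le> (\<integral>\<^sup>+ x. 2 * (ennreal \<bar>W (\<iota> k j) x - u x\<bar> * indicator (U j) x) \<partial>M)"
    proof (rule nn_integral_mono_AE)
      show "AE x in M. D k j x * indicator (U j) x \<le> 2 * (ennreal \<bar>W (\<iota> k j) x - u x\<bar> * indicator (U j) x)"
        using D(3)[of k j]
      proof eventually_elim
        case (elim x)
        have "ennreal \<bar>A k j x - slice k (u x)\<bar> \<le> ennreal (2 * \<bar>W (\<iota> k j) x - u x\<bar>)"
          unfolding A_def by (intro ennreal_leI slice_lipschitz)
        then show ?case using elim by (auto simp: indicator_def ennreal_mult')
      qed
    qed
    also have "\<dots> = 2 * (\<integral>\<^sup>+ x \<in> U j. ennreal \<bar>W (\<iota> k j) x - u x\<bar> \<partial>M)"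
      by (intro nn_integral_cmult) measurable
    also have "\<dots> \<le> 2 * ennreal (\<epsilon> k j)" by (intro mult_left_mono \<iota>(2)) auto
    finally show ?thesis using \<epsilon>(1)[of k j] by (simp add: ennreal_mult')
  qed
  define F where "F k x = (\<Sum>j. \<phi> j x * A k j x)" for k x
  have FM [measurable]: "F k \<in> borel_measurable M" for k unfolding F_def[abs_def] by measurable
  have Fsum: "F k x = (\<Sum>j\<in>J. \<phi> j x * A k j x)" if "finite J" "\<forall>j. j \<notin> J \<longrightarrow> \<phi> j x = 0" for k x J
    unfolding F_def using that by (intro suminf_finite) auto
  define G where "G k x = (\<Sum>j. indicator (U j) x * (3 * S (\<iota> k j) k x + 5 * (ennreal (2 ^ (j + 2)) * D k j x)))" for k x
  have ugF: "real_upper_gradient \<Omega> (F k) (G k)" for k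
    unfolding G_def[abs_def]
  proof (rule real_upper_gradient_glue[where A = "A k" and B = "\<lambda>x. slice k (u x)" and \<phi> = \<phi>])
    show "real_upper_gradient \<Omega> (A k j) (S (\<iota> k j) k)" for j unfolding A_def[abs_def] by (rule S(1))
    fix y assume "y \<in> \<Omega>"
    from loc[OF this] Fsum show "\<exists>N J. open N \<and> y \<in> N \<and> finite J \<and> card J \<le> 4 \<and> (\<forall>j\<in>J. N \<subseteq> U j) \<and>
        (\<forall>x\<in>N. (\<Sum>j\<in>J. \<phi> j x) = 1 \<and> F k x = (\<Sum>j\<in>J. \<phi> j x * A k j x))" by meson
  qed (use U \<phi> D in auto)
  define e where "e k x = (\<Sum>j. D k j x * indicator (U j) x)" for k x
  have eM [measurable]: "e k \<in> borel_measurable M" for k unfolding e_def[abs_def] by measurable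
  \<comment> \<open>F k - \<open>slice k\<close> u is a convex combination of the errors on the
    layers through x. Hence it is bounded by their sum \<open>e k\<close> and also by 2, the bound
    that \<open>pigeonhole_powr\<close> asks for.\<close>
  have Fe: "ennreal \<bar>F k x - slice k (u x)\<bar> \<le> e k x \<and> \<bar>F k x - slice k (u x)\<bar> \<le> 2" if "x \<in> \<Omega>" for k x
  proof -
    obtain J where J: "finite J" "(\<Sum>j\<in>J. \<phi> j x) = 1" "\<forall>j. j \<notin> J \<longrightarrow> \<phi> j x = 0" using loc[OF \<open>x \<in> \<Omega>\<close>] by blast
    have "F k x - slice k (u x) = (\<Sum>j\<in>J. \<phi> j x * A k j x) - (\<Sum>j\<in>J. \<phi> j x) * slice k (u x)"
      by (simp add: J(2) Fsum[OF J(1,3)])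
    also have "\<dots> = (\<Sum>j\<in>J. \<phi> j x * (A k j x - slice k (u x)))"
      by (simp add: sum_distrib_right right_diff_distrib sum_subtractf)
    finally have eq: "F k x - slice k (u x) = (\<Sum>j\<in>J. \<phi> j x * (A k j x - slice k (u x)))" .
    have bd: "\<bar>F k x - slice k (u x)\<bar> \<le> (\<Sum>j\<in>J. \<phi> j x * \<bar>A k j x - slice k (u x)\<bar>)"
      unfolding eq by (rule order.trans[OF sum_abs]) (simp add: abs_mult \<phi>(1))
    also have "\<dots> \<le> (\<Sum>j\<in>J. \<phi> j x * 2)"
      unfolding A_def by (intro sum_mono mult_left_mono slice_diff_le \<phi>(1))
    also have "\<dots> = 2" by (simp add: sum_distrib_right[symmetric] J(2))
    finally have 2: "\<bar>F k x - slice k (u x)\<bar> \<le> 2" .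
    have "ennreal \<bar>F k x - slice k (u x)\<bar> \<le> ennreal (\<Sum>j\<in>J. \<phi> j x * \<bar>A k j x - slice k (u x)\<bar>)"
      using bd by (rule ennreal_leI)
    also have "\<dots> = (\<Sum>j\<in>J. ennreal (\<phi> j x) * ennreal \<bar>A k j x - slice k (u x)\<bar>)"
      using \<phi>(1) by (simp add: ennreal_mult[symmetric] sum_ennreal)
    also have "\<dots> \<le> (\<Sum>j\<in>J. D k j x * indicator (U j) x)"
    proof (rule sum_mono)
      fix j assume j: "j \<in> J"
      show "ennreal (\<phi> j x) * ennreal \<bar>A k j x - slice k (u x)\<bar> \<le> D k j x * indicator (U j) x"
      proof (cases "x \<in> U j")
        case True
        have "\<phi> j x \<le> (\<Sum>i\<in>J. \<phi> i x)" by (rule member_le_sum[OF j \<phi>(1) J(1)])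
        then have "\<phi> j x \<le> 1" using J(2) by simp
        then have "ennreal (\<phi> j x) * ennreal \<bar>A k j x - slice k (u x)\<bar> \<le> 1 * D k j x"
          by (intro mult_mono D(2)) (auto simp flip: ennreal_1 intro!: ennreal_leI)
        then show ?thesis using True by simp
      qed (simp add: \<phi>(3))
    qed
    also have "\<dots> \<le> e k x" unfolding e_def using J(1) by (intro sum_le_suminf) auto
    finally show ?thesis using 2 by simp
  qed
  have eint: "(\<integral>\<^sup>+ x \<in> B. e k x \<partial>M) \<le> (\<Sum>j. if B \<inter> U j = {} then 0 else ennreal (2 * \<epsilon> k j))"
    if B [measurable]: "B \<in> sets M" for B k
  proof -
    have "(\<integral>\<^sup>+ x \<in> B. e k x \<partial>M) = (\<integral>\<^sup>+ x. (\<Sum>j. D k j x * indicator (U j) x * indicator B x) \<partial>M)"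
      unfolding e_def by (simp add: ennreal_suminf_multc)
    also have "\<dots> = (\<Sum>j. \<integral>\<^sup>+ x. D k j x * indicator (U j) x * indicator B x \<partial>M)"
      by (intro nn_integral_suminf) measurable
    also have "\<dots> \<le> (\<Sum>j. if B \<inter> U j = {} then 0 else ennreal (2 * \<epsilon> k j))"
    proof (intro suminf_le allI)
      fix j
      show "(\<integral>\<^sup>+ x. D k j x * indicator (U j) x * indicator B x \<partial>M) \<le> (if B \<inter> U j = {} then 0 else ennreal (2 * \<epsilon> k j))"
      proof (cases "B \<inter> U j = {}")
        case True
        then have "(\<integral>\<^sup>+ x. D k j x * indicator (U j) x * indicator B x \<partial>M) = (\<integral>\<^sup>+ x. 0 \<partial>M)"
          by (intro nn_integral_cong) (auto simp: indicator_def)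
        then show ?thesis by simp
      next
        case False
        have "(\<integral>\<^sup>+ x. D k j x * indicator (U j) x * indicator B x \<partial>M) \<le> (\<integral>\<^sup>+ x \<in> U j. D k j x \<partial>M)"
          by (intro nn_integral_mono) (auto simp: indicator_def)
        also have "\<dots> \<le> ennreal (2 * \<epsilon> k j)" by (rule Dint)
        finally show ?thesis using False by (simp only: if_False)
      qed
    qed auto
    finally show ?thesis .
  qed
  have \<epsilon>2: "2 ^ j * \<epsilon> k j \<le> (1 / 2) ^ k * (1 / 2) ^ j" for k j
  proof -
    have "2 ^ j * \<epsilon> k j \<le> 2 ^ j * ((1 / 4) ^ j * (1 / 2) ^ k)" by (intro mult_left_mono \<epsilon>(2)) auto
    also have "\<dots> = (2 * (1 / 4)) ^ j * (1 / 2) ^ k" by (simp only: power_mult_distrib mult.assoc)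
    finally show ?thesis by (simp add: mult.commute)
  qed
  have geo: "(\<Sum>k. \<Sum>j. ennreal ((1 / 2) ^ k * (1 / 2) ^ j)) = 4"
  proof -
    have "(\<Sum>k. \<Sum>j. ennreal ((1 / 2) ^ k * (1 / 2) ^ j)) = (\<Sum>k. \<Sum>j. ennreal ((1 / 2) ^ k) * ennreal ((1 / 2) ^ j))"
      by (simp add: ennreal_mult)
    then show ?thesis unfolding suminf_mult_ennreal_prod suminf_half_powers by simp
  qed
  have GM [measurable]: "G k \<in> borel_measurable M" for k
    using ugF[of k] by (auto simp: real_upper_gradient_def)
  have Gint: "(\<integral>\<^sup>+ x. (\<Sum>k. G k x) \<partial>M) < \<infinity>"
  proof -
    \<comment> \<open>43 = 3 + 40: three times the slack in the choice of the index, and 5 * 2 ^ (j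
      + 2) = 20 * 2 ^ j times the error 2 * \<epsilon> k j.\<close>
    have G1: "(\<integral>\<^sup>+ x. G k x \<partial>M) \<le> (\<Sum>j. 3 * a k j + 43 * ennreal ((1 / 2) ^ k * (1 / 2) ^ j))" for k
    proof -
      have "(\<integral>\<^sup>+ x. G k x \<partial>M) = (\<Sum>j. \<integral>\<^sup>+ x. indicator (U j) x * (3 * S (\<iota> k j) k x + 5 * (ennreal (2 ^ (j + 2)) * D k j x)) \<partial>M)"
        unfolding G_def by (intro nn_integral_suminf) measurable
      also have "\<dots> \<le> (\<Sum>j. 3 * a k j + 43 * ennreal ((1 / 2) ^ k * (1 / 2) ^ j))"
      proof (intro suminf_le allI)
        fix j
        let ?t = "ennreal ((1 / 2) ^ k * (1 / 2) ^ j)"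
        have "(\<integral>\<^sup>+ x. indicator (U j) x * (3 * S (\<iota> k j) k x + 5 * (ennreal (2 ^ (j + 2)) * D k j x)) \<partial>M) =
          (\<integral>\<^sup>+ x. 3 * (S (\<iota> k j) k x * indicator (U j) x) + ennreal (20 * 2 ^ j) * (D k j x * indicator (U j) x) \<partial>M)"
        proof (rule nn_integral_cong)
          fix x
          have "20 * 2 ^ j = 5 * (2 :: real) ^ (j + 2)" by (simp add: power_add)
          then have "ennreal (20 * 2 ^ j) = 5 * ennreal (2 ^ (j + 2))" by (simp only: ennreal_mult' ennreal_numeral zero_le_numeral)
          then show "indicator (U j) x * (3 * S (\<iota> k j) k x + 5 * (ennreal (2 ^ (j + 2)) * D k j x)) =
              3 * (S (\<iota> k j) k x * indicator (U j) x) + ennreal (20 * 2 ^ j) * (D k j x * indicator (U j) x)"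
            by (cases "x \<in> U j") (simp_all only: indicator_simps not_False_eq_True mult_1_left mult_1_right mult.assoc mult_zero_left mult_zero_right add_0_right)
        qed
        also have "\<dots> = 3 * T (\<iota> k j) k j + ennreal (20 * 2 ^ j) * (\<integral>\<^sup>+ x \<in> U j. D k j x \<partial>M)"
          unfolding T_def by (simp add: nn_integral_add nn_integral_cmult)
        also have "\<dots> \<le> 3 * (a k j + ?t) + ennreal (20 * 2 ^ j) * ennreal (2 * \<epsilon> k j)"
          by (intro add_mono mult_left_mono \<iota>(1) Dint) auto
        also have "ennreal (20 * 2 ^ j) * ennreal (2 * \<epsilon> k j) = ennreal (40 * (2 ^ j * \<epsilon> k j))"
          using \<epsilon>(1)[of k j] by (simp add: ennreal_mult[symmetric] mult.assoc mult.left_commute)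
        also have "3 * (a k j + ?t) + ennreal (40 * (2 ^ j * \<epsilon> k j)) \<le> 3 * (a k j + ?t) + ennreal (40 * ((1 / 2) ^ k * (1 / 2) ^ j))"
          by (intro add_left_mono ennreal_leI mult_left_mono \<epsilon>2) auto
        also have "\<dots> = 3 * (a k j + ?t) + 40 * ?t" by (simp add: ennreal_mult')
        also have "\<dots> = 3 * a k j + (3 * ?t + 40 * ?t)" by (simp add: distrib_left add.assoc)
        also have "3 * ?t + 40 * ?t = 43 * ?t" by (simp flip: distrib_right)
        finally show "(\<integral>\<^sup>+ x. indicator (U j) x * (3 * S (\<iota> k j) k x + 5 * (ennreal (2 ^ (j + 2)) * D k j x)) \<partial>M)
            \<le> 3 * a k j + 43 * ?t" .
      qed auto
      finally show ?thesis .
    qed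
    have "(\<integral>\<^sup>+ x. (\<Sum>k. G k x) \<partial>M) = (\<Sum>k. \<integral>\<^sup>+ x. G k x \<partial>M)" by (intro nn_integral_suminf) measurable
    also have "\<dots> \<le> (\<Sum>k. \<Sum>j. 3 * a k j + 43 * ennreal ((1 / 2) ^ k * (1 / 2) ^ j))"
      by (intro suminf_le allI G1) auto
    also have "\<dots> = 3 * (\<Sum>k. \<Sum>j. a k j) + 43 * (\<Sum>k. \<Sum>j. ennreal ((1 / 2) ^ k * (1 / 2) ^ j))"
      by (simp add: suminf_add[symmetric] ennreal_suminf_cmult)
    also have "\<dots> \<le> 3 * (4 * ennreal (4 * C)) + 43 * 4"
      unfolding geo by (intro add_mono mult_left_mono asum) auto
    also have "\<dots> < \<infinity>" by (simp add: ennreal_mult_less_top)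
    finally show ?thesis .
  qed
  \<comment> \<open>This sum is at most |u| plus the sum of the errors \<open>e k\<close>, hence
    integrable on \<Omega>. A Borel majorant of it is the extra term in
    \<open>real_upper_gradient_suminf\<close>, and its finiteness almost everywhere gives absolute
    convergence there.\<close>
  define S0 where "S0 x = (\<Sum>k. ennreal \<bar>F k x\<bar>)" for x
  have S0M [measurable]: "S0 \<in> borel_measurable M" unfolding S0_def[abs_def] by measurable
  have S0int: "(\<integral>\<^sup>+ x \<in> \<Omega>. S0 x \<partial>M) < \<infinity>"
  proof -
    have "(\<integral>\<^sup>+ x \<in> \<Omega>. S0 x \<partial>M) \<le> (\<integral>\<^sup>+ x. ennreal \<bar>u x\<bar> * indicator \<Omega> x + (\<Sum>k. e k x * indicator \<Omega> x) \<partial>M)"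
    proof (rule nn_integral_mono)
      fix x
      show "S0 x * indicator \<Omega> x \<le> ennreal \<bar>u x\<bar> * indicator \<Omega> x + (\<Sum>k. e k x * indicator \<Omega> x)"
      proof (cases "x \<in> \<Omega>")
        case True
        have "S0 x \<le> (\<Sum>k. ennreal \<bar>slice k (u x)\<bar> + e k x)"
          unfolding S0_def
        proof (intro suminf_le allI)
          fix k
          have "ennreal \<bar>F k x\<bar> \<le> ennreal (\<bar>slice k (u x)\<bar> + \<bar>F k x - slice k (u x)\<bar>)"
            by (intro ennreal_leI) linarith
          also have "\<dots> = ennreal \<bar>slice k (u x)\<bar> + ennreal \<bar>F k x - slice k (u x)\<bar>" by simp
          also have "\<dots> \<le> ennreal \<bar>slice k (u x)\<bar> + e k x" using Fe[OF True] by (intro add_left_mono) auto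
          finally show "ennreal \<bar>F k x\<bar> \<le> ennreal \<bar>slice k (u x)\<bar> + e k x" .
        qed auto
        also have "\<dots> = ennreal \<bar>u x\<bar> + (\<Sum>k. e k x)"
          by (simp add: suminf_add[symmetric] suminf_ennreal_abs_slice)
        finally show ?thesis using True by simp
      qed simp
    qed
    also have "\<dots> = (\<integral>\<^sup>+ x \<in> \<Omega>. ennreal \<bar>u x\<bar> \<partial>M) + (\<Sum>k. \<integral>\<^sup>+ x \<in> \<Omega>. e k x \<partial>M)"
    proof -
      have "(\<integral>\<^sup>+ x. (\<Sum>k. e k x * indicator \<Omega> x) \<partial>M) = (\<Sum>k. \<integral>\<^sup>+ x \<in> \<Omega>. e k x \<partial>M)"
        by (intro nn_integral_suminf) measurable
      then show ?thesis by (subst nn_integral_add) simp_all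
    qed
    also have "\<dots> \<le> (\<integral>\<^sup>+ x \<in> \<Omega>. ennreal \<bar>u x\<bar> \<partial>M) + (\<Sum>k. \<Sum>j. 2 * ennreal ((1 / 2) ^ k * (1 / 2) ^ j))"
    proof (intro add_left_mono suminf_le allI)
      fix k
      have "(\<integral>\<^sup>+ x \<in> \<Omega>. e k x \<partial>M) \<le> (\<Sum>j. if \<Omega> \<inter> U j = {} then 0 else ennreal (2 * \<epsilon> k j))" by (rule eint) simp
      also have "\<dots> \<le> (\<Sum>j. 2 * ennreal ((1 / 2) ^ k * (1 / 2) ^ j))"
      proof (intro suminf_le allI)
        fix j
        have "1 * \<epsilon> k j \<le> 2 ^ j * \<epsilon> k j" using \<epsilon>(1)[of k j] by (intro mult_right_mono) auto
        then have "2 * \<epsilon> k j \<le> 2 * ((1 / 2) ^ k * (1 / 2) ^ j)" using \<epsilon>2[of j k] by simp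
        then have "ennreal (2 * \<epsilon> k j) \<le> 2 * ennreal ((1 / 2) ^ k * (1 / 2) ^ j)"
          by (metis ennreal_leI ennreal_mult' ennreal_numeral zero_le_numeral)
        then show "(if \<Omega> \<inter> U j = {} then 0 else ennreal (2 * \<epsilon> k j)) \<le> 2 * ennreal ((1 / 2) ^ k * (1 / 2) ^ j)" by auto
      qed auto
      finally show "(\<integral>\<^sup>+ x \<in> \<Omega>. e k x \<partial>M) \<le> (\<Sum>j. 2 * ennreal ((1 / 2) ^ k * (1 / 2) ^ j))" .
    qed auto
    also have "\<dots> = (\<integral>\<^sup>+ x \<in> \<Omega>. ennreal \<bar>u x\<bar> \<partial>M) + 2 * 4"
      by (simp only: ennreal_suminf_cmult geo)
    also have "\<dots> < \<infinity>" using ui by simp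
    finally show ?thesis .
  qed
  have "(\<lambda>x. S0 x * indicator \<Omega> x) \<in> borel_measurable M" by measurable
  then obtain S' where S': "S' \<in> borel_measurable borel" "\<And>x. S0 x * indicator \<Omega> x \<le> S' x"
    "AE x in M. S' x = S0 x * indicator \<Omega> x" by (rule borel_majorant) blast
  have S'M [measurable]: "S' \<in> borel_measurable M" using S'(1) by auto
  \<comment> \<open>Where the series diverges this is the default value of \<open>suminf\<close>; on
    \<Omega> such points have S0 = \<infinity>, so they form a null set.\<close>
  define V where "V x = (\<Sum>k. F k x)" for x
  have VM: "V \<in> borel_measurable M" unfolding V_def[abs_def] by measurable
  have ugV: "real_upper_gradient \<Omega> V (\<lambda>x. S' x + (\<Sum>k. G k x))"
    unfolding V_def[abs_def]
  proof (rule real_upper_gradient_suminf[OF ugF S'(1)])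
    fix x assume "x \<in> \<Omega>"
    then show "(\<Sum>k. ennreal \<bar>F k x\<bar>) \<le> S' x" using S'(2)[of x] by (simp add: S0_def)
  qed
  have gint: "(\<integral>\<^sup>+ x \<in> \<Omega>. S' x + (\<Sum>k. G k x) \<partial>M) < \<infinity>"
  proof -
    have "(\<integral>\<^sup>+ x \<in> \<Omega>. S' x + (\<Sum>k. G k x) \<partial>M) \<le> (\<integral>\<^sup>+ x. S' x + (\<Sum>k. G k x) \<partial>M)"
      by (intro nn_integral_mono) (auto simp: indicator_def)
    also have "\<dots> = (\<integral>\<^sup>+ x. S' x \<partial>M) + (\<integral>\<^sup>+ x. (\<Sum>k. G k x) \<partial>M)" by (intro nn_integral_add) measurable
    also have "(\<integral>\<^sup>+ x. S' x \<partial>M) = (\<integral>\<^sup>+ x \<in> \<Omega>. S0 x \<partial>M)" using S'(3) by (rule nn_integral_cong_AE)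
    finally show ?thesis using S0int Gint by (auto intro: le_less_trans)
  qed
  have Vint: "(\<integral>\<^sup>+ x \<in> \<Omega>. ennreal \<bar>V x\<bar> \<partial>M) < \<infinity>"
  proof -
    have "(\<integral>\<^sup>+ x \<in> \<Omega>. ennreal \<bar>V x\<bar> \<partial>M) \<le> (\<integral>\<^sup>+ x \<in> \<Omega>. S0 x \<partial>M)"
      unfolding V_def S0_def by (intro nn_integral_mono mult_right_mono ennreal_abs_suminf_le) auto
    then show ?thesis using S0int by (rule le_less_trans)
  qed
  have fin: "AE x in M. x \<in> \<Omega> \<longrightarrow> S0 x < \<infinity>"
  proof -
    have "AE x in M. S0 x * indicator \<Omega> x \<noteq> \<infinity>" using S0int by (intro nn_integral_noteq_infinite) auto
    then show ?thesis by eventually_elim (auto simp: indicator_def top.not_eq_extremum)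
  qed
  have Vq: "(\<integral>\<^sup>+ x \<in> B. ennreal (\<bar>V x - u x\<bar> powr q) \<partial>M) \<le> (\<Sum>j. if B \<inter> U j = {} then 0 else ennreal (\<delta> j))"
    if B [measurable]: "B \<in> sets M" and BO: "B \<subseteq> \<Omega>" for B
  proof -
    have "(\<integral>\<^sup>+ x \<in> B. ennreal (\<bar>V x - u x\<bar> powr q) \<partial>M) \<le> (\<integral>\<^sup>+ x. (\<Sum>k. ennreal (c k) * (e k x * indicator B x)) \<partial>M)"
    proof (rule nn_integral_mono_AE)
      show "AE x in M. ennreal (\<bar>V x - u x\<bar> powr q) * indicator B x \<le> (\<Sum>k. ennreal (c k) * (e k x * indicator B x))"
        using fin
      proof eventually_elim
        case (elim x)
        show ?case
        proof (cases "x \<in> B")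
          case True
          then have x: "x \<in> \<Omega>" using BO by auto
          then have "S0 x \<noteq> \<infinity>" using elim by auto
          then have "summable (\<lambda>k. \<bar>F k x\<bar>)"
            unfolding S0_def by (intro summable_suminf_not_top) simp_all
          then have "summable (\<lambda>k. F k x)" by (rule summable_rabs_cancel)
          from suminf_diff[OF this sums_summable[OF slice_sums[of "u x"]]]
          have "V x - u x = (\<Sum>k. F k x - slice k (u x))"
            unfolding V_def sums_unique[OF slice_sums[of "u x"], symmetric] .
          then have "ennreal \<bar>V x - u x\<bar> \<le> (\<Sum>k. ennreal \<bar>F k x - slice k (u x)\<bar>)"
            by (simp only: ennreal_abs_suminf_le)
          \<comment> \<open>The q-th power of the full difference is reduced to first powers of the
            slice errors, which are controlled in L^1.\<close>
          then have "ennreal (\<bar>V x - u x\<bar> powr q) \<le> (\<Sum>k. ennreal (c k) * ennreal \<bar>F k x - slice k (u x)\<bar>)"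
            unfolding c_def using Fe[OF x] q by (intro pigeonhole_powr) auto
          also have "\<dots> \<le> (\<Sum>k. ennreal (c k) * e k x)"
            using Fe[OF x] by (intro suminf_le allI mult_left_mono) auto
          finally show ?thesis using True by simp
        qed simp
      qed
    qed
    also have "\<dots> = (\<Sum>k. ennreal (c k) * (\<integral>\<^sup>+ x \<in> B. e k x \<partial>M))"
    proof -
      have "(\<integral>\<^sup>+ x. (\<Sum>k. ennreal (c k) * (e k x * indicator B x)) \<partial>M) =
          (\<Sum>k. \<integral>\<^sup>+ x. ennreal (c k) * (e k x * indicator B x) \<partial>M)"
        by (intro nn_integral_suminf) measurable
      also have "\<dots> = (\<Sum>k. ennreal (c k) * (\<integral>\<^sup>+ x \<in> B. e k x \<partial>M))"
        by (intro arg_cong[where f = suminf] ext nn_integral_cmult) measurable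
      finally show ?thesis .
    qed
    also have "\<dots> \<le> (\<Sum>k. \<Sum>j. ennreal ((1 / 2) ^ k / 2) * (if B \<inter> U j = {} then 0 else ennreal (\<delta> j)))"
    proof (intro suminf_le allI)
      fix k
      have "ennreal (c k) * (\<integral>\<^sup>+ x \<in> B. e k x \<partial>M) \<le> ennreal (c k) * (\<Sum>j. if B \<inter> U j = {} then 0 else ennreal (2 * \<epsilon> k j))"
        by (intro mult_left_mono eint B) auto
      also have "\<dots> = (\<Sum>j. ennreal (c k) * (if B \<inter> U j = {} then 0 else ennreal (2 * \<epsilon> k j)))"
        by (rule ennreal_suminf_cmult[symmetric])
      also have "\<dots> \<le> (\<Sum>j. ennreal ((1 / 2) ^ k / 2) * (if B \<inter> U j = {} then 0 else ennreal (\<delta> j)))"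
      proof (intro suminf_le allI)
        fix j
        have "ennreal (c k) * ennreal (2 * \<epsilon> k j) = ennreal (c k * (2 * \<epsilon> k j))"
          using c[of k] \<epsilon>(1)[of k j] by (subst ennreal_mult) auto
        also have "\<dots> \<le> ennreal (\<delta> j * (1 / 2) ^ k / 2)" by (intro ennreal_leI \<epsilon>(3))
        also have "\<dots> = ennreal ((1 / 2) ^ k / 2) * ennreal (\<delta> j)"
          using \<delta>[of j] by (subst ennreal_mult[symmetric]) (auto simp: mult.commute)
        finally show "ennreal (c k) * (if B \<inter> U j = {} then 0 else ennreal (2 * \<epsilon> k j)) \<le>
            ennreal ((1 / 2) ^ k / 2) * (if B \<inter> U j = {} then 0 else ennreal (\<delta> j))" by auto
      qed auto
      finally show "ennreal (c k) * (\<integral>\<^sup>+ x \<in> B. e k x \<partial>M) \<le>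
          (\<Sum>j. ennreal ((1 / 2) ^ k / 2) * (if B \<inter> U j = {} then 0 else ennreal (\<delta> j)))" .
    qed auto
    also have "\<dots> = (\<Sum>k. ennreal ((1 / 2) ^ k / 2)) * (\<Sum>j. if B \<inter> U j = {} then 0 else ennreal (\<delta> j))"
      by (rule suminf_mult_ennreal_prod)
    also have "(\<Sum>k. ennreal ((1 / 2) ^ k / 2)) = 1"
      using power_half_series by (intro suminf_ennreal_eq[where x = 1, simplified]) (auto simp: mult.commute)
    finally show ?thesis by simp
  qed
  show thesis by (rule that[OF VM ugV gint Vint Vq])
qed

end

section \<open>From extended real to real-valued functions\<close>

lemma real_upper_gradient_cong:
  assumes "real_upper_gradient \<Omega> f g" "\<And>x. x \<in> \<Omega> \<Longrightarrow> f x = f' x"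
  shows "real_upper_gradient \<Omega> f' g"
  unfolding real_upper_gradient_def
proof (intro conjI allI impI)
  show "g \<in> borel_measurable borel" using assms(1) by (simp add: real_upper_gradient_def)
  fix \<gamma> :: "real \<Rightarrow> 'a" assume \<gamma>: "nonconstant_curve \<gamma> \<and> path_image \<gamma> \<subseteq> \<Omega>"
  then have "pathstart \<gamma> \<in> \<Omega>" "pathfinish \<gamma> \<in> \<Omega>"
    by (auto simp: path_image_def pathstart_def pathfinish_def)
  then show "ennreal \<bar>f' (pathstart \<gamma>) - f' (pathfinish \<gamma>)\<bar> \<le> line_integral \<gamma> g"
    using assms(1) \<gamma> by (simp add: real_upper_gradient_def assms(2)[symmetric])
qed

lemma ennreal_abs_real_of_ereal_le: "ennreal \<bar>real_of_ereal a\<bar> \<le> e2ennreal \<bar>a\<bar>"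
  by (cases a) auto

lemma ennreal_abs_diff_real_of_ereal_le:
  "ennreal \<bar>real_of_ereal a - real_of_ereal b\<bar> \<le> e2ennreal \<bar>a - b\<bar>"
  by (cases a; cases b) auto

lemma subseq_le_of_liminf_less:
  fixes f :: "nat \<Rightarrow> ennreal"
  assumes "liminf f < c"
  shows "\<exists>r :: nat \<Rightarrow> nat. strict_mono r \<and> (\<forall>n. f (r n) \<le> c)"
proof -
  have "infinite {i. f i \<le> c}"
  proof
    assume "finite {i. f i \<le> c}"
    then obtain n where n: "{i. f i \<le> c} \<subseteq> {..<n}" using finite_nat_bounded by blast
    have "\<forall>\<^sub>F i in sequentially. c \<le> f i"
      using eventually_ge_at_top[of n]
    proof eventually_elim
      case (elim i)
      then have "i \<notin> {i. f i \<le> c}" using n by auto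
      then show ?case by simp
    qed
    then have "c \<le> liminf f" by (rule Liminf_bounded)
    with assms show False by simp
  qed
  then obtain r :: "nat \<Rightarrow> nat" where "strict_mono r" "\<forall>n. r n \<in> {i. f i \<le> c}"
    using infinite_enumerate by blast
  then show ?thesis by auto
qed

lemma doubling_space_caratheodory:
  assumes "borel_regular_outer_measure \<mu>" "doubling_measure (caratheodory_measure \<mu>)"
  shows "doubling_space (caratheodory_measure \<mu>)"
proof
  have om: "outer_measure_space (Pow UNIV) \<mu>" and bor: "sets borel \<subseteq> lambda_system UNIV (Pow UNIV) \<mu>"
    and reg: "\<And>A. \<exists>B \<in> sets borel. A \<subseteq> B \<and> \<mu> B = \<mu> A"
    using assms(1) by (auto simp: borel_regular_outer_measure_def)
  note sets = sets_caratheodory_measure[OF om] and em = emeasure_caratheodory_measure[OF om]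
  show "sets borel \<subseteq> sets (caratheodory_measure \<mu>)" using bor sets by simp
  fix A assume "A \<in> sets (caratheodory_measure \<mu>)"
  then show "\<exists>B\<in>sets borel. A \<subseteq> B \<and> emeasure (caratheodory_measure \<mu>) B = emeasure (caratheodory_measure \<mu>) A"
    using reg[of A] bor em sets by (metis subsetD)
qed (use assms in simp_all)

section \<open>Behaviour near the boundary and conclusion\<close>

context doubling_space
begin

text \<open>Cover K by finitely many balls of radius c / 2. If x lies in the one about y, then
  \<open>ball y (c / 2)\<close> is contained in \<open>ball x c\<close>, so the finitely many
  positive values at the centres give the bound without any continuity in x. Positivity holds since
  \<Omega> meets the ball in an open set containing a small ball.\<close>

lemma emeasure_ball_Int_lower_bound:
  assumes \<Omega>: "open \<Omega>" and K: "compact K" "K \<subseteq> closure \<Omega>" and c: "0 < c"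
  obtains m where "0 < m" "m \<le> 1" "\<And>x. x \<in> K \<Longrightarrow> ennreal m \<le> emeasure M (ball x c \<inter> \<Omega>)"
proof -
  define f where "f x = measure M (ball x (c / 2) \<inter> \<Omega>)" for x
  have fin: "emeasure M (ball x r \<inter> \<Omega>) < \<infinity>" for x r
    using emeasure_mono[of "ball x r \<inter> \<Omega>" "ball x r" M] emeasure_ball_finite[of x r]
    by (auto intro: le_less_trans)
  have ef: "ennreal (f x) = emeasure M (ball x (c / 2) \<inter> \<Omega>)" for x
    using fin[of x "c / 2"] by (simp add: f_def emeasure_eq_ennreal_measure)
  have fpos: "0 < f x" if "x \<in> K" for x
  proof -
    have "x \<in> closure \<Omega>" using that K by auto
    then obtain y where y: "y \<in> \<Omega>" "dist y x < c / 2"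
      using c unfolding closure_approachable by (meson half_gt_zero)
    then have "open (ball x (c / 2) \<inter> \<Omega>)" "y \<in> ball x (c / 2) \<inter> \<Omega>" using \<Omega> by (auto simp: dist_commute)
    then obtain s where s: "0 < s" "ball y s \<subseteq> ball x (c / 2) \<inter> \<Omega>" using open_contains_ball by blast
    have "0 < emeasure M (ball y s)" using s by (intro emeasure_ball_pos)
    also have "\<dots> \<le> ennreal (f x)" unfolding ef using s \<Omega> by (intro emeasure_mono) auto
    finally show ?thesis by simp
  qed
  have "K \<subseteq> (\<Union>x\<in>K. ball x (c / 2))" using c by auto
  then obtain D where D: "D \<subseteq> K" "finite D" "K \<subseteq> (\<Union>x\<in>D. ball x (c / 2))"
    by (rule compactE_image[OF K(1) open_ball])
  \<comment> \<open>The inserted 1 keeps the minimum meaningful when K is empty and gives m \<le>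
    1.\<close>
  define m where "m = Min (insert 1 (f ` D))"
  show thesis
  proof (rule that[of m])
    show "0 < m" "m \<le> 1" using D fpos by (auto simp: m_def)
    fix x assume "x \<in> K"
    then obtain y where y: "y \<in> D" "dist y x < c / 2" using D by auto
    have "ennreal m \<le> ennreal (f y)" using y D by (intro ennreal_leI) (auto simp: m_def)
    also have "\<dots> \<le> emeasure M (ball x c \<inter> \<Omega>)"
      unfolding ef
    proof (intro emeasure_mono)
      show "ball y (c / 2) \<inter> \<Omega> \<subseteq> ball x c \<inter> \<Omega>"
      proof
        fix z assume z: "z \<in> ball y (c / 2) \<inter> \<Omega>"
        then show "z \<in> ball x c \<inter> \<Omega>" using dist_triangle[of x z y] y by (auto simp: dist_commute)
      qed
    qed (use \<Omega> in auto)
    finally show "ennreal m \<le> emeasure M (ball x c \<inter> \<Omega>)" .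
  qed
qed

lemma BV_approximating_sequence:
  assumes \<Omega>: "open \<Omega>" and u: "u \<in> BV M \<Omega>"
    and U: "\<And>j::nat. open (U j)" "\<And>j. U j \<Subset> \<Omega>" "\<Omega> \<subseteq> (\<Union>j. U j)"
  obtains W :: "nat \<Rightarrow> 'a \<Rightarrow> real" and h C where "\<And>i. W i \<in> borel_measurable M" "\<And>i. real_upper_gradient \<Omega> (W i) (h i)"
    "\<And>i. (\<integral>\<^sup>+ x \<in> \<Omega>. h i x \<partial>M) \<le> ennreal C"
    "\<And>j. (\<lambda>i. \<integral>\<^sup>+ x \<in> U j. ennreal \<bar>W i x - real_of_ereal (u x) * indicator \<Omega> x\<bar> \<partial>M) \<longlonglongrightarrow> 0"
proof -
  have \<Omega>M: "\<Omega> \<in> sets M" using \<Omega> by auto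
  have U\<Omega>: "U j \<subseteq> \<Omega>" for j using U(2)[of j] closure_subset[of "U j"] by (auto simp: compactly_inside_def)
  have "total_variation M \<Omega> u < \<infinity>" using u by (simp add: BV_def)
  then obtain w g where lim: "liminf (\<lambda>i. \<integral>\<^sup>+ x \<in> \<Omega>. g i x \<partial>M) < \<infinity>"
    and wg: "\<And>i::nat. w i \<in> N11_loc M \<Omega> \<and> minimal_weak_upper_gradient M \<Omega> (w i) (g i)"
    and conv: "tendsto_L1_loc M \<Omega> w u"
    unfolding total_variation_def Inf_less_iff by auto
  define L where "L = liminf (\<lambda>i. \<integral>\<^sup>+ x \<in> \<Omega>. g i x \<partial>M)"
  obtain l where l: "L = ennreal l" "0 \<le> l" using lim by (cases L) (auto simp: L_def)
  have "L < ennreal (l + 1)" using l by (simp add: ennreal_less_iff)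
  \<comment> \<open>Infinitely many energies lie below the limit inferior plus one, and local L^1
    convergence passes to the subsequence.\<close>
  then have "\<exists>r :: nat \<Rightarrow> nat. strict_mono r \<and> (\<forall>n. (\<integral>\<^sup>+ x \<in> \<Omega>. g (r n) x \<partial>M) \<le> ennreal (l + 1))"
    unfolding L_def
    by (rule subseq_le_of_liminf_less)
  then obtain r :: "nat \<Rightarrow> nat" where r': "strict_mono r \<and> (\<forall>n. (\<integral>\<^sup>+ x \<in> \<Omega>. g (r n) x \<partial>M) \<le> ennreal (l + 1))"
    by (elim exE)
  have r: "strict_mono r" "\<And>n. (\<integral>\<^sup>+ x \<in> \<Omega>. g (r n) x \<partial>M) \<le> ennreal (l + 1)"
    using r' by simp_all
  have "\<forall>i. \<exists>h. real_upper_gradient \<Omega> (\<lambda>x. real_of_ereal (w (r i) x)) h \<and> (\<integral>\<^sup>+ x \<in> \<Omega>. h x \<partial>M) \<le> ennreal (l + 2)"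
  proof
    fix i
    have "weak_upper_gradient M \<Omega> (w (r i)) (g (r i))" using wg by (simp add: minimal_weak_upper_gradient_def)
    then obtain h where h: "real_upper_gradient \<Omega> (\<lambda>x. real_of_ereal (w (r i) x)) h"
      "(\<integral>\<^sup>+ x \<in> \<Omega>. h x \<partial>M) \<le> (\<integral>\<^sup>+ x \<in> \<Omega>. g (r i) x \<partial>M) + 1"
      by (rule weak_upper_gradient_imp_real_upper_gradient[OF _ \<Omega>]) blast
    have "(\<integral>\<^sup>+ x \<in> \<Omega>. g (r i) x \<partial>M) + 1 \<le> ennreal (l + 1) + 1" by (intro add_right_mono r(2))
    \<comment> \<open>One unit is spent on the subsequence, the other on removing the exceptional
      curves.\<close>
    also have "\<dots> = ennreal (l + 2)" using l by (simp flip: ennreal_1 ennreal_plus)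
    finally show "\<exists>h. real_upper_gradient \<Omega> (\<lambda>x. real_of_ereal (w (r i) x)) h \<and> (\<integral>\<^sup>+ x \<in> \<Omega>. h x \<partial>M) \<le> ennreal (l + 2)"
      using h by (intro exI[of _ h]) auto
  qed
  from this[unfolded choice_iff] obtain h where
    h: "\<forall>i. real_upper_gradient \<Omega> (\<lambda>x. real_of_ereal (w (r i) x)) (h i) \<and> (\<integral>\<^sup>+ x \<in> \<Omega>. h i x \<partial>M) \<le> ennreal (l + 2)"
    by (elim exE)
  define W where "W i x = real_of_ereal (w (r i) x) * indicator \<Omega> x" for i x
  have WM: "W i \<in> borel_measurable M" for i
  \<comment> \<open>Local membership gives measurability only on each U j, so the function is
    assembled from these countably many pieces and the value 0 off \<Omega>.\<close>
  proof (rule measurable_piecewise_restrict[where C = "insert (- \<Omega>) (range U)"])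
    fix B assume "B \<in> insert (- \<Omega>) (range U)"
    then consider "B = - \<Omega>" | j where "B = U j" by auto
    then show "W i \<in> borel_measurable (restrict_space M B)"
    proof cases
      case 1
      have "(\<lambda>x. 0 :: real) \<in> borel_measurable (restrict_space M B)" by simp
      then show ?thesis by (rule measurable_cong[THEN iffD1, rotated]) (auto simp: W_def 1 space_restrict_space)
    next
      case 2
      have "w (r i) \<in> N11 M (U j)" using wg U by (auto simp: N11_loc_def)
      then have "w (r i) \<in> borel_measurable (restrict_space M (U j))" by (simp add: N11_def)
      then have "(\<lambda>x. real_of_ereal (w (r i) x)) \<in> borel_measurable (restrict_space M B)" unfolding 2 by measurable
      then show ?thesis
        by (rule measurable_cong[THEN iffD1, rotated]) (use U\<Omega>[of j] in \<open>auto simp: W_def 2 space_restrict_space\<close>)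
    qed
  next
    show "B \<inter> space M \<in> sets M" if "B \<in> insert (- \<Omega>) (range U)" for B
      using that U(1) sets.compl_sets[OF \<Omega>M] by (auto simp: Compl_eq_Diff_UNIV)
  qed (use U in auto)
  have "real_upper_gradient \<Omega> (W i) (h i)" for i
    by (rule real_upper_gradient_cong[of \<Omega> "\<lambda>x. real_of_ereal (w (r i) x)"]) (use h in \<open>auto simp: W_def\<close>)
  moreover have "(\<lambda>i. \<integral>\<^sup>+ x \<in> U j. ennreal \<bar>W i x - real_of_ereal (u x) * indicator \<Omega> x\<bar> \<partial>M) \<longlonglongrightarrow> 0" for j
  proof (rule tendsto_sandwich[OF _ _ tendsto_const])
    have "(\<lambda>i. L1_norm M (U j) (\<lambda>x. w i x - u x)) \<longlonglongrightarrow> 0"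
      using conv U by (simp add: tendsto_L1_loc_def)
    then show "(\<lambda>i. L1_norm M (U j) (\<lambda>x. w (r i) x - u x)) \<longlonglongrightarrow> 0"
      using LIMSEQ_subseq_LIMSEQ[OF _ r(1), unfolded comp_def] by blast
    show "\<forall>\<^sub>F i in sequentially. (\<integral>\<^sup>+ x \<in> U j. ennreal \<bar>W i x - real_of_ereal (u x) * indicator \<Omega> x\<bar> \<partial>M)
        \<le> L1_norm M (U j) (\<lambda>x. w (r i) x - u x)"
    proof (intro always_eventually allI)
      fix i
      show "(\<integral>\<^sup>+ x \<in> U j. ennreal \<bar>W i x - real_of_ereal (u x) * indicator \<Omega> x\<bar> \<partial>M) \<le> L1_norm M (U j) (\<lambda>x. w (r i) x - u x)"
        unfolding L1_norm_def
      proof (rule nn_integral_mono)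
        fix x
        show "ennreal \<bar>W i x - real_of_ereal (u x) * indicator \<Omega> x\<bar> * indicator (U j) x \<le> e2ennreal \<bar>w (r i) x - u x\<bar> * indicator (U j) x"
          using U\<Omega>[of j] ennreal_abs_diff_real_of_ereal_le[of "w (r i) x" "u x"] by (auto simp: W_def indicator_def)
      qed
    qed
  qed auto
  ultimately show thesis using that[of W h "l + 2"] WM h by blast
qed

lemma real_upper_gradient_imp_N11:
  assumes \<Omega>: "open \<Omega>" and v: "v \<in> borel_measurable M" "real_upper_gradient \<Omega> v g"
    "(\<integral>\<^sup>+ x \<in> \<Omega>. g x \<partial>M) < \<infinity>" "(\<integral>\<^sup>+ x \<in> \<Omega>. ennreal \<bar>v x\<bar> \<partial>M) < \<infinity>"
  shows "(\<lambda>x. ereal (v x)) \<in> N11 M \<Omega>"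
proof -
  have gb: "g \<in> borel_measurable M" using v(2) by (auto simp: real_upper_gradient_def)
  have "zero_modulus M {}"
    unfolding zero_modulus_def by (auto intro!: bexI[of _ "\<lambda>_. 0"])
  moreover have "upper_gradient_inequality (\<lambda>x. ereal (v x)) g \<gamma>" if "nonconstant_curve \<gamma>" "path_image \<gamma> \<subseteq> \<Omega>" for \<gamma>
    using v(2) that unfolding upper_gradient_inequality_def ereal_distance_def real_upper_gradient_def by simp
  ultimately have "weak_upper_gradient M \<Omega> (\<lambda>x. ereal (v x)) g"
    unfolding weak_upper_gradient_def using gb by (auto intro!: measurable_restrict_space1 exI[of _ "{}"])
  then have "(INF g \<in> {g. weak_upper_gradient M \<Omega> (\<lambda>x. ereal (v x)) g}. \<integral>\<^sup>+ x \<in> \<Omega>. g x \<partial>M) \<le> (\<integral>\<^sup>+ x \<in> \<Omega>. g x \<partial>M)"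
    by (intro INF_lower) simp
  then have "(INF g \<in> {g. weak_upper_gradient M \<Omega> (\<lambda>x. ereal (v x)) g}. \<integral>\<^sup>+ x \<in> \<Omega>. g x \<partial>M) < \<infinity>"
    using v(3) by (rule le_less_trans)
  then have "N11_norm M \<Omega> (\<lambda>x. ereal (v x)) < \<infinity>"
    unfolding N11_norm_def L1_norm_def using v(4) by simp
  moreover have "(\<lambda>x. ereal (v x)) \<in> borel_measurable (restrict_space M \<Omega>)"
    using v(1) by (intro measurable_restrict_space1) measurable
  ultimately show ?thesis by (simp add: N11_def)
qed

text \<open>The q-th power average over a ball of radius r < 1 about a boundary point turns out to
  be at most 8 * r, a bound independent of the point. A layer met by such a ball satisfies 1 / 2 ^
  (j + 2) < r, so small balls see only layers with large j.\<close>

lemma BV_boundary_approximation: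
  assumes \<Omega>: "open \<Omega>" and u: "u \<in> BV M \<Omega>" and q: "1 \<le> q"
  shows "\<exists>v \<in> N11 M \<Omega>. \<forall>\<epsilon>::real. \<epsilon> > 0 \<longrightarrow>
           (\<forall>\<^sub>F r in at_right 0. \<forall>x \<in> frontier \<Omega>.
              (\<integral>\<^sup>+ y \<in> ball x r \<inter> \<Omega>. ennreal_powr (e2ennreal \<bar>v y - u y\<bar>) q \<partial>M)
                / emeasure M (ball x r \<inter> \<Omega>) < ennreal \<epsilon>)"
proof -
  have \<Omega>M: "\<Omega> \<in> sets M" using \<Omega> by auto
  obtain U :: "nat \<Rightarrow> 'a set" and \<phi> :: "nat \<Rightarrow> 'a \<Rightarrow> real" where
    U: "\<And>j. open (U j)" "\<And>j. U j \<Subset> \<Omega>" "\<And>x. finite {j. x \<in> U j}" "\<And>x. card {j. x \<in> U j} \<le> 4"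
    and far: "\<And>j x y. y \<in> U j \<Longrightarrow> x \<notin> \<Omega> \<Longrightarrow> 1 / 2 ^ (j + 2) < dist x y"
    and \<phi>: "\<And>j x. 0 \<le> \<phi> j x" "\<And>j x y. \<bar>\<phi> j x - \<phi> j y\<bar> \<le> 2 ^ (j + 2) * dist x y"
      "\<And>j x. x \<notin> U j \<Longrightarrow> \<phi> j x = 0"
    and loc: "\<And>y. y \<in> \<Omega> \<Longrightarrow> \<exists>N J. open N \<and> y \<in> N \<and> finite J \<and> card J \<le> 4 \<and> (\<forall>j\<in>J. N \<subseteq> U j) \<and>
        (\<forall>x\<in>N. (\<Sum>j\<in>J. \<phi> j x) = 1 \<and> (\<forall>j. j \<notin> J \<longrightarrow> \<phi> j x = 0))"
    by (rule whitney_partition[OF \<Omega>]) blast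
  have U\<Omega>: "U j \<subseteq> \<Omega>" for j using U(2)[of j] closure_subset[of "U j"] by (auto simp: compactly_inside_def)
  have cover: "\<Omega> \<subseteq> (\<Union>j. U j)"
  proof
    fix y assume "y \<in> \<Omega>"
    from loc[OF this] obtain N J where "y \<in> N" "\<forall>j\<in>J. N \<subseteq> U j" "(\<Sum>j\<in>J. \<phi> j y) = 1" by blast
    moreover from this(3) have "J \<noteq> {}" by auto
    ultimately show "y \<in> (\<Union>j. U j)" by blast
  qed
  obtain W h C where W: "\<And>i::nat. W i \<in> borel_measurable M" "\<And>i. real_upper_gradient \<Omega> (W i) (h i)"
    "\<And>i. (\<integral>\<^sup>+ x \<in> \<Omega>. h i x \<partial>M) \<le> ennreal C"
    "\<And>j. (\<lambda>i. \<integral>\<^sup>+ x \<in> U j. ennreal \<bar>W i x - real_of_ereal (u x) * indicator \<Omega> x\<bar> \<partial>M) \<longlonglongrightarrow> 0"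
    using BV_approximating_sequence[OF \<Omega> u U(1,2) cover] by blast
  define u0 where "u0 x = real_of_ereal (u x) * indicator \<Omega> x" for x
  have uL: "u \<in> borel_measurable (restrict_space M \<Omega>)" "L1_norm M \<Omega> u < \<infinity>"
    using u by (auto simp: BV_def L1_def)
  have u0M: "u0 \<in> borel_measurable M"
  proof -
    have "(\<lambda>x. real_of_ereal (u x)) \<in> borel_measurable (restrict_space M \<Omega>)" using uL by measurable
    then have "(\<lambda>x. indicator \<Omega> x *\<^sub>R real_of_ereal (u x)) \<in> borel_measurable M"
      using \<Omega>M by (subst borel_measurable_restrict_space_iff[symmetric]) auto
    then show ?thesis unfolding u0_def[abs_def] by (simp add: mult.commute)
  qed
  have u0int: "(\<integral>\<^sup>+ x \<in> \<Omega>. ennreal \<bar>u0 x\<bar> \<partial>M) < \<infinity>"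
  proof -
    have "(\<integral>\<^sup>+ x \<in> \<Omega>. ennreal \<bar>u0 x\<bar> \<partial>M) \<le> L1_norm M \<Omega> u"
      unfolding L1_norm_def
      by (intro nn_integral_mono mult_right_mono order.trans[OF _ ennreal_abs_real_of_ereal_le])
         (auto simp: u0_def indicator_def intro!: ennreal_leI)
    then show ?thesis using uL(2) by (rule le_less_trans)
  qed
  have ufin: "AE x in M. x \<in> \<Omega> \<longrightarrow> \<bar>u x\<bar> \<noteq> \<infinity>"
  proof -
    have "(\<lambda>x. e2ennreal \<bar>u x\<bar>) \<in> borel_measurable (restrict_space M \<Omega>)" using uL by measurable
    then have "(\<lambda>x. e2ennreal \<bar>u x\<bar> * indicator \<Omega> x) \<in> borel_measurable M"
      using \<Omega>M by (subst borel_measurable_restrict_space_iff_ennreal[symmetric]) auto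
    then have "AE x in M. e2ennreal \<bar>u x\<bar> * indicator \<Omega> x \<noteq> \<infinity>"
      using uL(2) unfolding L1_norm_def by (intro nn_integral_noteq_infinite) auto
    then show ?thesis by eventually_elim (auto simp: indicator_def)
  qed
  have "\<forall>j. \<exists>m. 0 < m \<and> m \<le> 1 \<and> (\<forall>x\<in>frontier \<Omega>. \<forall>r\<le>1. ball x r \<inter> U j \<noteq> {} \<longrightarrow> ennreal m \<le> emeasure M (ball x r \<inter> \<Omega>))"
  proof
    fix j
    have "bounded (U j)"
      using U(2)[of j] bounded_subset[OF compact_imp_bounded closure_subset] by (auto simp: compactly_inside_def)
    then obtain x0 R where R: "\<And>y. y \<in> U j \<Longrightarrow> dist x0 y \<le> R" by (auto simp: bounded_def)
    \<comment> \<open>Boundary points whose ball of radius at most 1 meets the bounded set U j all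
      lie in this compact set, so one constant m j serves them.\<close>
    define K where "K = cball x0 (R + 1) \<inter> frontier \<Omega>"
    have "compact K" unfolding K_def by (intro compact_Int_closed compact_cball frontier_closed)
    moreover have "K \<subseteq> closure \<Omega>" by (auto simp: K_def frontier_def)
    moreover have "0 < 1 / (2 :: real) ^ (j + 2)" by simp
    ultimately obtain m where m: "0 < m" "m \<le> 1"
      "\<And>x. x \<in> K \<Longrightarrow> ennreal m \<le> emeasure M (ball x (1 / 2 ^ (j + 2)) \<inter> \<Omega>)"
      by (rule emeasure_ball_Int_lower_bound[OF \<Omega>]) blast
    show "\<exists>m. 0 < m \<and> m \<le> 1 \<and> (\<forall>x\<in>frontier \<Omega>. \<forall>r\<le>1. ball x r \<inter> U j \<noteq> {} \<longrightarrow> ennreal m \<le> emeasure M (ball x r \<inter> \<Omega>))"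
    proof (intro exI[of _ m] conjI m ballI allI impI)
      fix x r assume x: "x \<in> frontier \<Omega>" and r: "r \<le> (1::real)" and ne: "ball x r \<inter> U j \<noteq> {}"
      then obtain y where y: "dist x y < r" "y \<in> U j" by auto
      have "x \<notin> \<Omega>" using x \<Omega> by (auto simp: frontier_def interior_open)
      then have "1 / 2 ^ (j + 2) < r" using far[OF y(2)] y(1) by (meson order.strict_trans)
      have "dist x0 x \<le> R + 1" using dist_triangle2[of x0 x y] R[OF y(2)] y(1) r by simp
      then have "x \<in> K" using x by (simp add: K_def)
      then have "ennreal m \<le> emeasure M (ball x (1 / 2 ^ (j + 2)) \<inter> \<Omega>)" by (rule m(3))
      also have "\<dots> \<le> emeasure M (ball x r \<inter> \<Omega>)"
        using \<open>1 / 2 ^ (j + 2) < r\<close> \<Omega> by (intro emeasure_mono) auto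
      finally show "ennreal m \<le> emeasure M (ball x r \<inter> \<Omega>)" .
    qed
  qed
  from this[unfolded choice_iff] obtain m where
    m: "\<forall>j. 0 < m j \<and> m j \<le> 1 \<and> (\<forall>x\<in>frontier \<Omega>. \<forall>r\<le>1. ball x r \<inter> U j \<noteq> {} \<longrightarrow> ennreal (m j) \<le> emeasure M (ball x r \<inter> \<Omega>))"
    by (elim exE)
  \<comment> \<open>m j bounds the measure of any admissible ball within \<Omega> that reaches U j.
    Of the two factors 1 / 2 ^ j, one is at most 4 * r and yields the decay, the other makes the sum
    over the layers converge.\<close>
  define \<delta> where "\<delta> j = (1 / 4) ^ j * m j" for j
  have \<delta>: "0 < \<delta> j" for j using m by (simp add: \<delta>_def)
  show ?thesis
  proof (rule whitney_approximation[where \<delta> = \<delta>, OF \<Omega> W(1) u0M W(2,3) u0int W(4)[folded u0_def] q \<delta> U(1) U\<Omega> U(3,4) \<phi> loc])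
    fix v g
    assume v: "v \<in> borel_measurable M" "real_upper_gradient \<Omega> v g" "(\<integral>\<^sup>+ x \<in> \<Omega>. g x \<partial>M) < \<infinity>"
      "(\<integral>\<^sup>+ x \<in> \<Omega>. ennreal \<bar>v x\<bar> \<partial>M) < \<infinity>"
    and vq: "\<And>A. A \<in> sets M \<Longrightarrow> A \<subseteq> \<Omega> \<Longrightarrow> (\<integral>\<^sup>+ x \<in> A. ennreal (\<bar>v x - u0 x\<bar> powr q) \<partial>M)
        \<le> (\<Sum>j. if A \<inter> U j = {} then 0 else ennreal (\<delta> j))"
    show ?thesis
    proof (intro bexI[of _ "\<lambda>x. ereal (v x)"] allI impI)
      show "(\<lambda>x. ereal (v x)) \<in> N11 M \<Omega>" by (rule real_upper_gradient_imp_N11[OF \<Omega> v])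
      fix \<epsilon> :: real assume \<epsilon>: "0 < \<epsilon>"
      have "0 < min 1 (\<epsilon> / 8)" using \<epsilon> by simp
      then have "\<forall>\<^sub>F r in at_right 0. r \<in> {0<..<min 1 (\<epsilon> / 8)}" by (rule eventually_at_right_real)
      then show "\<forall>\<^sub>F r in at_right 0. \<forall>x \<in> frontier \<Omega>.
                (\<integral>\<^sup>+ y \<in> ball x r \<inter> \<Omega>. ennreal_powr (e2ennreal \<bar>ereal (v y) - u y\<bar>) q \<partial>M)
                  / emeasure M (ball x r \<inter> \<Omega>) < ennreal \<epsilon>"
      proof eventually_elim
        case (elim r)
        then have r: "0 < r" "r < 1" "r < \<epsilon> / 8" by auto
        show ?case
        proof
          fix x assume x: "x \<in> frontier \<Omega>"
          let ?B = "ball x r \<inter> \<Omega>"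
          have BM: "?B \<in> sets M" using \<Omega> by auto
          have x\<Omega>: "x \<notin> \<Omega>" using x \<Omega> by (auto simp: frontier_def interior_open)
          have Bfin: "emeasure M ?B < \<infinity>"
            using emeasure_mono[of ?B "ball x r" M] emeasure_ball_finite[of x r] by (auto intro: le_less_trans)
          \<comment> \<open>Positivity and finiteness allow the measure to be cancelled from the
            quotient at the end.\<close>
          have Bpos: "0 < emeasure M ?B"
          proof -
            have "{x} \<subseteq> closure \<Omega>" using x by (auto simp: frontier_def)
            then obtain m' where "0 < m'" "\<And>y. y \<in> {x} \<Longrightarrow> ennreal m' \<le> emeasure M (ball y r \<inter> \<Omega>)"
              by (rule emeasure_ball_Int_lower_bound[OF \<Omega> compact_sing _ r(1)]) blast
            then have "0 < ennreal m'" "ennreal m' \<le> emeasure M ?B" by auto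
            then show ?thesis by (rule less_le_trans)
          qed
          have "(\<integral>\<^sup>+ y \<in> ?B. ennreal_powr (e2ennreal \<bar>ereal (v y) - u y\<bar>) q \<partial>M) =
              (\<integral>\<^sup>+ y \<in> ?B. ennreal (\<bar>v y - u0 y\<bar> powr q) \<partial>M)"
          proof (rule nn_integral_cong_AE)
            show "AE y in M. ennreal_powr (e2ennreal \<bar>ereal (v y) - u y\<bar>) q * indicator ?B y =
                ennreal (\<bar>v y - u0 y\<bar> powr q) * indicator ?B y"
              using ufin
            proof eventually_elim
              case (elim y)
              show ?case
              proof (cases "y \<in> ?B")
                case True
                \<comment> \<open>u is finite almost everywhere on \<Omega>, and there its real
                  version \<open>u0\<close> is equal to it; at infinite values the two integrands
                  could differ.\<close>
                then obtain s where "u y = ereal s" using elim by (cases "u y") auto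
                then show ?thesis using True by (simp add: u0_def ennreal_powr_def)
              qed simp
            qed
          qed
          also have "\<dots> \<le> (\<Sum>j. if ?B \<inter> U j = {} then 0 else ennreal (\<delta> j))" by (rule vq[OF BM]) auto
          also have "\<dots> \<le> (\<Sum>j. ennreal ((1 / 2) ^ j) * (ennreal (4 * r) * emeasure M ?B))"
          proof (intro suminf_le allI)
            fix j
            show "(if ?B \<inter> U j = {} then 0 else ennreal (\<delta> j)) \<le> ennreal ((1 / 2) ^ j) * (ennreal (4 * r) * emeasure M ?B)"
            proof (cases "?B \<inter> U j = {}")
              case False
              then obtain y where y: "dist x y < r" "y \<in> U j" by auto
              have "ball x r \<inter> U j \<noteq> {}" using y by auto
              then have mj: "ennreal (m j) \<le> emeasure M ?B" using m x r by auto
              have "1 / 2 ^ (j + 2) < r" using far[OF y(2) x\<Omega>] y(1) by (meson order.strict_trans)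
              \<comment> \<open>The distance of U j from the boundary is converted into smallness in
                r; the constant 4 is the offset 2 in the exponent j + 2.\<close>
              then have "(1 / 2) ^ j \<le> 4 * r" by (simp add: power_add power_one_over)
              then have "(1 / 2) ^ j * ((1 / 2) ^ j * m j) \<le> (1 / 2) ^ j * (4 * r * m j)"
                using m by (intro mult_left_mono mult_right_mono) (auto intro: less_imp_le)
              moreover have "(1 / 2) ^ j * ((1 / 2) ^ j * m j) = \<delta> j"
                by (simp add: \<delta>_def mult.assoc[symmetric] power_mult_distrib[symmetric])
              ultimately have "ennreal (\<delta> j) \<le> ennreal ((1 / 2) ^ j * (4 * r * m j))" by (intro ennreal_leI) simp
              also have "\<dots> = ennreal ((1 / 2) ^ j) * (ennreal (4 * r) * ennreal (m j))"
                using r m by (simp add: ennreal_mult less_imp_le)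
              also have "\<dots> \<le> ennreal ((1 / 2) ^ j) * (ennreal (4 * r) * emeasure M ?B)"
                using mj by (intro mult_left_mono) auto
              finally show ?thesis using False by simp
            qed simp
          qed auto
          also have "\<dots> = 2 * (ennreal (4 * r) * emeasure M ?B)"
            by (simp only: ennreal_suminf_multc suminf_half_powers)
          also have "\<dots> = ennreal (8 * r) * emeasure M ?B"
          proof -
            have "ennreal (8 * r) = ennreal (2 * (4 * r))" by simp
            also have "\<dots> = 2 * ennreal (4 * r)" using r by (subst ennreal_mult) auto
            finally show ?thesis by (simp only: mult.assoc)
          qed
          finally have "(\<integral>\<^sup>+ y \<in> ?B. ennreal_powr (e2ennreal \<bar>ereal (v y) - u y\<bar>) q \<partial>M) / emeasure M ?B
              \<le> ennreal (8 * r) * emeasure M ?B / emeasure M ?B" by (rule divide_right_mono_ennreal)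
          also have "\<dots> = ennreal (8 * r)" using Bpos Bfin by (intro mult_divide_eq_ennreal) auto
          also have "\<dots> < ennreal \<epsilon>" using r \<epsilon> by (intro ennreal_lessI) auto
          finally show "(\<integral>\<^sup>+ y \<in> ?B. ennreal_powr (e2ennreal \<bar>ereal (v y) - u y\<bar>) q \<partial>M) / emeasure M ?B < ennreal \<epsilon>" .
        qed
      qed
    qed
  qed
qed

end

theorem theorem1p3:
  fixes \<mu> :: "'a::complete_space set \<Rightarrow> ennreal"
    and M :: "'a measure"
    and \<Omega> :: "'a set"
    and u :: "'a \<Rightarrow> ereal"
    and q :: real
  assumes "borel_regular_outer_measure \<mu>"
    and "M = caratheodory_measure \<mu>"
    and "doubling_measure M"
    and "poincare_1_1 M"
    and "open \<Omega>" and "\<Omega> \<noteq> {}"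
    and "u \<in> BV M \<Omega>"
    and "1 \<le> q"
  shows "\<exists>v \<in> N11 M \<Omega>. \<forall>\<epsilon>::real. \<epsilon> > 0 \<longrightarrow>
           (\<forall>\<^sub>F r in at_right 0. \<forall>x \<in> frontier \<Omega>.
              (\<integral>\<^sup>+ y \<in> ball x r \<inter> \<Omega>. ennreal_powr (e2ennreal \<bar>v y - u y\<bar>) q \<partial>M)
                / emeasure M (ball x r \<inter> \<Omega>) < ennreal \<epsilon>)"
proof -
  interpret doubling_space M
    using doubling_space_caratheodory[of \<mu>] assms(1-3) by simp
  show ?thesis by (rule BV_boundary_approximation[OF assms(5,7,8)])
qed

end
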